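(* For every fixed integer $r\ge 3$, the number of $r$-uniform hypergraphs on the vertex set $\{1,\dots,n\}$ (labeled vertices) with girth greater than $5$ is $2^{o(n^{3/2})}$.
   Context: A (Berge) cycle of length $k\ge 2$ in a hypergraph is an alternating sequence $v_1,e_1,\dots,v_k,e_k$ of distinct vertices and distinct edges with $v_i,v_{i+1}\in e_i$ for each $i$ (indices mod $k$); a $2$-cycle is a pair of edges sharing two distinct vertices. The girth is the length of the shortest cycle. *)

theory Defs
  imports Complex_Main "HOL-Library.Extended_Nat" "HOL-Library.Landau_Symbols"
begin

definition berge_cycle :: "'a set set \<Rightarrow> nat \<Rightarrow> bool" where
  "berge_cycle H k \<longleftrightarrow> k \<ge> 2 \<and>
     (\<exists>vs es. length vs = k \<and> length es = k \<and> distinct vs \<and> distinct es \<and>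
        set es \<subseteq> H \<and>
        (\<forall>i<k. vs ! i \<in> es ! i \<and> vs ! ((i + 1) mod k) \<in> es ! i))"

text \<open>Girth: length of a shortest cycle; infinity if there is no cycle.\<close>
definition girth :: "'a set set \<Rightarrow> enat" where
  "girth H = (INF k \<in> {k. berge_cycle H k}. enat k)"

definition uniform_hypergraphs :: "nat \<Rightarrow> nat \<Rightarrow> nat set set set" where
  "uniform_hypergraphs r n = {H. H \<subseteq> {e. e \<subseteq> {1..n} \<and> card e = r}}"

end

theory Submission
  imports Defs "HOL-Analysis.Analysis" "HOL-Real_Asymp.Real_Asymp"
begin

text \<open>
  A hypergraph of girth greater than five is determined by the graphs formed by its pairs of \<open>i\<close>-th and
  \<open>j\<close>-th smallest vertices, and each of these graphs has no 4-cycle. So it suffices to show that the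
  hypergraph has \<open>o(n\<^sup>3\<^sup>/\<^sup>2)\<close> edges and that there are only \<open>2\<close> to the \<open>o(n\<^sup>3\<^sup>/\<^sup>2)\<close> graphs
  without 4-cycles and with \<open>o(n\<^sup>3\<^sup>/\<^sup>2)\<close> edges.

  For the number of edges, a triple from each hyperedge gives edge-disjoint triangles in a graph without
  4-cycles and 5-cycles. In a graph without 4-cycles the adjacency matrix, rescaled by \<open>\<surd>n\<close>, has bounded
  energy with respect to every bounded partition, so energy increments give a partition \<open>\<kappa>\<close> whose energy
  hardly changes under a refinement \<open>\<kappa>2\<close> that is regular on a scale much finer than \<open>\<kappa>\<close>. Many triangles
  would leave three cells of \<open>\<kappa>\<close> that are pairwise dense. Second neighbourhoods of vertices have linear
  size because there are no 4-cycles, and an edge inside one of them closes a 5-cycle; regularity turns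
  this into a positive density of 5-cycles in the three cells.

  The count of sparse graphs without 4-cycles is the argument of Kleitman and Winston: remove a vertex of
  minimum degree and bound the number of its possible neighbourhoods, which are independent sets in the
  graph of pairs with a common neighbour, by a container lemma.
\<close>

section \<open>Averages over partitions and 4-cycle-free graphs\<close>

text \<open>The 4-cycle-free graphs alone already number 2 to the order of n^(3/2), so the saving
  must come from the edge count. The obstacle there is that regularity of a sparse graph does not by
  itself give a counting lemma: a neighbourhood has about sqrt n vertices, below the scale that
  regularity controls. Two steps from a vertex reach linearly many vertices, so 5-cycles, made of
  two 2-paths from a common start and a middle edge, can be counted. The middle edge is tested
  against \<open>\<kappa>1\<close>, the 2-paths against \<open>\<kappa>2\<close>. The share of the
  second neighbourhood in each cell of \<open>\<kappa>1\<close> has to be predicted for all pairs of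
  cells at once, so the regularity of \<open>\<kappa>2\<close> must beat the number of cells of
  \<open>\<kappa>1\<close>; hence two successive refinements. Because the energies nearly agree,
  pairs that are dense for \<open>\<kappa>\<close> stay dense almost everywhere for both.
  Hypergraphs are encoded by pairs at fixed positions because all pairs of one hyperedge together
  contain 4-cycles once r \<ge> 4.\<close>

definition cavg :: "'a set \<Rightarrow> ('a \<Rightarrow> 'b) \<Rightarrow> ('a \<Rightarrow> real) \<Rightarrow> 'a \<Rightarrow> real" where
  "cavg U lab f x = (\<Sum>y | y \<in> U \<and> lab y = lab x. f y) / real (card {y \<in> U. lab y = lab x})"

lemma cavg_cong: "lab x = lab y \<Longrightarrow> cavg U lab f x = cavg U lab f y"
  by (simp add: cavg_def)

lemma cavg_nonneg: "(\<And>x. x \<in> U \<Longrightarrow> 0 \<le> f x) \<Longrightarrow> 0 \<le> cavg U lab f x"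
  unfolding cavg_def by (intro divide_nonneg_nonneg sum_nonneg) auto

text \<open>\<open>cavg\<close> is the conditional expectation for the partition of \<open>U\<close>
  into the fibres of \<open>lab\<close>, and a test function that is constant on cells does not see
  averaging inside a cell. Partitions are encoded by labellings, so that a refinement is an
  implication between equalities of labels.\<close>

lemma sum_cavg_mult:
  assumes fin: "finite U"
    and meas: "\<And>x y. x \<in> U \<Longrightarrow> y \<in> U \<Longrightarrow> lab x = lab y \<Longrightarrow> h x = h y"
  shows "(\<Sum>x\<in>U. cavg U lab f x * h x) = (\<Sum>x\<in>U. f x * h x)"
proof -
  have *: "(\<Sum>x | x \<in> U \<and> lab x = l. cavg U lab f x * h x) = (\<Sum>x | x \<in> U \<and> lab x = l. f x * h x)"
    if l: "l \<in> lab ` U" for l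
  proof -
    from l obtain z where z: "z \<in> U" "lab z = l" by auto
    let ?C = "{x \<in> U. lab x = l}"
    have C: "finite ?C" "card ?C \<noteq> 0" using fin z by auto
    have "(\<Sum>x\<in>?C. cavg U lab f x * h x) = (\<Sum>x\<in>?C. ((\<Sum>y\<in>?C. f y) / card ?C) * h z)"
      by (intro sum.cong refl arg_cong2[where f="(*)"]) (use z in \<open>auto simp: cavg_def intro: meas\<close>)
    also have "\<dots> = (\<Sum>y\<in>?C. f y) * h z" using C by simp
    also have "\<dots> = (\<Sum>y\<in>?C. f y * h y)"
      unfolding sum_distrib_right
      by (intro sum.cong refl arg_cong2[where f="(*)"]) (use z in \<open>auto intro: meas\<close>)
    finally show ?thesis by simp
  qed
  have "(\<Sum>x\<in>U. cavg U lab f x * h x) = (\<Sum>l\<in>lab ` U. \<Sum>x | x \<in> U \<and> lab x = l. cavg U lab f x * h x)"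
    by (rule sum.image_gen[OF fin])
  also have "\<dots> = (\<Sum>l\<in>lab ` U. \<Sum>x | x \<in> U \<and> lab x = l. f x * h x)"
    by (intro sum.cong refl *)
  also have "\<dots> = (\<Sum>x\<in>U. f x * h x)"
    by (rule sum.image_gen[OF fin, symmetric])
  finally show ?thesis .
qed

text \<open>Orthogonality of projections: the coarse average is constant on the fine cells too, so
  \<open>sum_cavg_mult\<close> gives it the same inner product with the fine average, with
  \<open>f\<close> and with itself.\<close>

lemma cavg_pythagoras:
  assumes fin: "finite U"
    and ref: "\<And>x y. x \<in> U \<Longrightarrow> y \<in> U \<Longrightarrow> lab' x = lab' y \<Longrightarrow> lab x = lab y"
  shows "(\<Sum>x\<in>U. (cavg U lab' f x)\<^sup>2)
    = (\<Sum>x\<in>U. (cavg U lab f x)\<^sup>2) + (\<Sum>x\<in>U. (cavg U lab' f x - cavg U lab f x)\<^sup>2)"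
proof -
  let ?a = "cavg U lab f" and ?b = "cavg U lab' f"
  have "(\<Sum>x\<in>U. ?b x * ?a x) = (\<Sum>x\<in>U. f x * ?a x)"
    by (rule sum_cavg_mult[OF fin]) (intro cavg_cong ref)
  also have "\<dots> = (\<Sum>x\<in>U. ?a x * ?a x)"
    by (rule sum_cavg_mult[OF fin, symmetric]) (rule cavg_cong)
  finally have "(\<Sum>x\<in>U. ?b x * ?a x) = (\<Sum>x\<in>U. ?a x * ?a x)" .
  moreover have "(\<Sum>x\<in>U. (?b x - ?a x)\<^sup>2)
      = (\<Sum>x\<in>U. (?b x)\<^sup>2) + (\<Sum>x\<in>U. (?a x)\<^sup>2) - 2 * (\<Sum>x\<in>U. ?b x * ?a x)"
    by (simp add: power2_diff sum.distrib sum_subtractf sum_distrib_left mult.assoc)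
  ultimately show ?thesis by (simp add: power2_eq_square)
qed

section \<open>Graphs in which two vertices have at most one common neighbour\<close>

definition graph_on :: "'a set \<Rightarrow> ('a \<times> 'a) set \<Rightarrow> bool" where
  "graph_on V E \<longleftrightarrow> E \<subseteq> V \<times> V \<and> sym E \<and> irrefl E"

definition c4free :: "('a \<times> 'a) set \<Rightarrow> bool" where
  "c4free E \<longleftrightarrow> (\<forall>x y u v. x \<noteq> y \<and> (x,u) \<in> E \<and> (y,u) \<in> E \<and> (x,v) \<in> E \<and> (y,v) \<in> E \<longrightarrow> u = v)"

definition c5free :: "('a \<times> 'a) set \<Rightarrow> bool" where
  "c5free E \<longleftrightarrow> (\<forall>a b c d e. (a,b) \<in> E \<and> (b,c) \<in> E \<and> (c,d) \<in> E \<and> (d,e) \<in> E \<and> (e,a) \<in> E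
      \<longrightarrow> \<not> distinct [a,b,c,d,e])"

lemma c4freeD:
  "c4free E \<Longrightarrow> (x,u) \<in> E \<Longrightarrow> (y,u) \<in> E \<Longrightarrow> (x,v) \<in> E \<Longrightarrow> (y,v) \<in> E \<Longrightarrow> x = y \<or> u = v"
  unfolding c4free_def by blast

lemma graph_onD:
  assumes "graph_on V E"
  shows "(x,y) \<in> E \<Longrightarrow> x \<in> V" "(x,y) \<in> E \<Longrightarrow> y \<in> V" "(x,y) \<in> E \<Longrightarrow> (y,x) \<in> E" "(x,x) \<notin> E"
  using assms by (auto simp: graph_on_def sym_def irrefl_def)

lemma card_codegree_le_1:
  assumes "c4free E" "x \<noteq> y"
  shows "card {u. (x,u) \<in> E \<and> (y,u) \<in> E} \<le> 1"
proof (cases "{u. (x,u) \<in> E \<and> (y,u) \<in> E} = {}")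
  case False
  then obtain u where u: "(x,u) \<in> E" "(y,u) \<in> E" by auto
  have "{u. (x,u) \<in> E \<and> (y,u) \<in> E} \<subseteq> {u}"
    using c4freeD[OF assms(1)] assms(2) u by blast
  from card_mono[OF _ this] show ?thesis by simp
next
  case True
  then show ?thesis by (metis card.empty zero_le)
qed

text \<open>Both sides count walks \<open>y, x, z\<close> with ends in \<open>X\<close>, once by the
  middle vertex and once by the ordered pair of ends.\<close>

lemma sum_degree_square:
  assumes V: "finite V" and E: "graph_on V E" and X: "X \<subseteq> V"
  shows "(\<Sum>x\<in>V. (real (card (E `` {x} \<inter> X)))\<^sup>2)
    = (\<Sum>y\<in>X. \<Sum>z\<in>X. real (card {x. (y,x) \<in> E \<and> (z,x) \<in> E}))"
proof -
  have fX: "finite X" using V X finite_subset by blast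
  have deg: "real (card (E `` {x} \<inter> X)) = (\<Sum>y\<in>X. of_bool ((x,y) \<in> E))" for x
  proof -
    have "(\<Sum>y\<in>X. of_bool ((x,y) \<in> E)) = real (card (X \<inter> {y. (x,y) \<in> E}))"
      using fX by simp
    also have "X \<inter> {y. (x,y) \<in> E} = E `` {x} \<inter> X" by auto
    finally show ?thesis by simp
  qed
  have "(\<Sum>x\<in>V. (real (card (E `` {x} \<inter> X)))\<^sup>2)
      = (\<Sum>x\<in>V. \<Sum>y\<in>X. \<Sum>z\<in>X. of_bool ((x,y) \<in> E) * of_bool ((x,z) \<in> E))"
    by (simp only: deg power2_eq_square sum_product)
  also have "\<dots> = (\<Sum>y\<in>X. \<Sum>x\<in>V. \<Sum>z\<in>X. of_bool ((x,y) \<in> E) * of_bool ((x,z) \<in> E))"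
    by (rule sum.swap)
  also have "\<dots> = (\<Sum>y\<in>X. \<Sum>z\<in>X. \<Sum>x\<in>V. of_bool ((x,y) \<in> E) * of_bool ((x,z) \<in> E))"
    by (intro sum.cong refl sum.swap)
  also have "\<dots> = (\<Sum>y\<in>X. \<Sum>z\<in>X. real (card {x. (y,x) \<in> E \<and> (z,x) \<in> E}))"
  proof (intro sum.cong refl)
    fix y z assume "y \<in> X" "z \<in> X"
    have "(\<Sum>x\<in>V. of_bool ((x,y) \<in> E) * of_bool ((x,z) \<in> E))
        = (\<Sum>x\<in>V. of_bool ((x,y) \<in> E \<and> (x,z) \<in> E) :: real)"
      by (intro sum.cong refl) auto
    also have "\<dots> = real (card (V \<inter> {x. (x,y) \<in> E \<and> (x,z) \<in> E}))"
      using V by simp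
    also have "V \<inter> {x. (x,y) \<in> E \<and> (x,z) \<in> E} = {x. (y,x) \<in> E \<and> (z,x) \<in> E}"
      using graph_onD[OF E] by blast
    finally show "(\<Sum>x\<in>V. of_bool ((x,y) \<in> E) * of_bool ((x,z) \<in> E))
      = real (card {x. (y,x) \<in> E \<and> (z,x) \<in> E})" .
  qed
  finally show ?thesis .
qed

text \<open>The pairs \<open>y = z\<close> contribute the degrees, every other ordered pair at most
  one common neighbour.\<close>

lemma sum_degree_square_le:
  assumes V: "finite V" and E: "graph_on V E" and c4: "c4free E" and X: "X \<subseteq> V"
  shows "(\<Sum>x\<in>V. (real (card (E `` {x} \<inter> X)))\<^sup>2)
    \<le> (real (card X))\<^sup>2 + (\<Sum>y\<in>X. real (card (E `` {y})))"
proof -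
  have fX: "finite X" using V X finite_subset by blast
  have "(\<Sum>z\<in>X. real (card {x. (y,x) \<in> E \<and> (z,x) \<in> E})) \<le> card X + real (card (E `` {y}))"
    if "y \<in> X" for y
  proof -
    have "(\<Sum>z\<in>X. real (card {x. (y,x) \<in> E \<and> (z,x) \<in> E}))
       = real (card {x. (y,x) \<in> E}) + (\<Sum>z\<in>X-{y}. real (card {x. (y,x) \<in> E \<and> (z,x) \<in> E}))"
      using fX that by (subst sum.remove[of _ y]) auto
    also have "(\<Sum>z\<in>X-{y}. real (card {x. (y,x) \<in> E \<and> (z,x) \<in> E})) \<le> (\<Sum>z\<in>X-{y}. 1)"
      by (intro sum_mono) (use card_codegree_le_1[OF c4, of y] in \<open>auto simp: eq_commute\<close>)
    also have "\<dots> \<le> card X" using fX by (simp add: card_Diff1_le)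
    also have "{x. (y,x) \<in> E} = E `` {y}" by auto
    finally show ?thesis by simp
  qed
  then have "(\<Sum>y\<in>X. \<Sum>z\<in>X. real (card {x. (y,x) \<in> E \<and> (z,x) \<in> E}))
     \<le> (\<Sum>y\<in>X. card X + real (card (E `` {y})))"
    by (intro sum_mono) auto
  also have "\<dots> = (real (card X))\<^sup>2 + (\<Sum>y\<in>X. real (card (E `` {y})))"
    by (simp add: sum.distrib power2_eq_square)
  finally show ?thesis using sum_degree_square[OF V E X] by simp
qed

section \<open>Sparse regularity\<close>

text \<open>The degree bound does not follow from the absence of 4-cycles, as a star shows. It makes
  every row of the rescaled matrix sum to at most \<open>C * n\<close>; \<open>few_triangles\<close>
  reduces the general case to this one.\<close>

locale sparse_graph =
  fixes V :: "'a set" and E :: "('a \<times> 'a) set" and C :: real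
  assumes finV: "finite V" and V_ne: "V \<noteq> {}" and gr: "graph_on V E" and c4: "c4free E"
    and C_ge_1: "1 \<le> C"
    and deg_le: "v \<in> V \<Longrightarrow> real (card (E `` {v})) \<le> C * sqrt (real (card V))"
begin

definition "n = real (card V)"

text \<open>The adjacency matrix is rescaled so that graphs with order \<open>n\<^sup>3\<^sup>/\<^sup>2\<close> edges have
  average entries of order \<open>1\<close>.\<close>
definition "g p = (if p \<in> E then sqrt n else 0)"

definition "w \<kappa> = cavg (V \<times> V) (map_prod \<kappa> \<kappa>) g"

definition "energy \<kappa> = (\<Sum>p\<in>V \<times> V. (w \<kappa> p)\<^sup>2) / n\<^sup>2"

text \<open>The cut norm of \<open>g - w \<kappa>\<close> is small, as in the weak regularity of
  Frieze and Kannan. The sets \<open>S\<close> and \<open>T\<close> are arbitrary, so they may later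
  be parts of a second neighbourhood.\<close>

definition "cut_regular \<kappa> \<epsilon> \<longleftrightarrow>
  (\<forall>S T. S \<subseteq> V \<longrightarrow> T \<subseteq> V \<longrightarrow> \<bar>\<Sum>x\<in>S. \<Sum>y\<in>T. g (x,y) - w \<kappa> (x,y)\<bar> \<le> \<epsilon> * n\<^sup>2)"

lemma n_ge_1: "1 \<le> n"
  using finV V_ne by (simp add: n_def Suc_le_eq card_gt_0_iff)

lemma n_pos: "0 < n" using n_ge_1 by simp

lemma g_nonneg: "0 \<le> g p" by (simp add: g_def n_def)

lemma g_sym: "g (x,y) = g (y,x)"
  using graph_onD(3)[OF gr] by (auto simp: g_def)

lemma w_nonneg: "0 \<le> w \<kappa> p"
  unfolding w_def by (rule cavg_nonneg) (rule g_nonneg)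

lemma w_cong: "\<kappa> x = \<kappa> x' \<Longrightarrow> \<kappa> y = \<kappa> y' \<Longrightarrow> w \<kappa> (x,y) = w \<kappa> (x',y')"
  unfolding w_def by (rule cavg_cong) simp

lemma sum_w_mult:
  assumes "\<And>x y x' y'. x \<in> V \<Longrightarrow> y \<in> V \<Longrightarrow> x' \<in> V \<Longrightarrow> y' \<in> V \<Longrightarrow> \<kappa> x = \<kappa> x' \<Longrightarrow> \<kappa> y = \<kappa> y'
    \<Longrightarrow> h (x,y) = h (x',y')"
  shows "(\<Sum>p\<in>V\<times>V. w \<kappa> p * h p) = (\<Sum>p\<in>V\<times>V. g p * h p)"
  unfolding w_def
  by (rule sum_cavg_mult) (use finV assms in \<open>auto simp: map_prod_def\<close>)

lemma sum_g_row_le: "x \<in> V \<Longrightarrow> X \<subseteq> V \<Longrightarrow> (\<Sum>y\<in>X. g (x,y)) \<le> C * n"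
proof -
  assume x: "x \<in> V" and X: "X \<subseteq> V"
  have fX: "finite X" using X finV finite_subset by blast
  have fE: "finite (E `` {x})"
    by (rule finite_subset[OF _ finV]) (use graph_onD[OF gr] in auto)
  have "(\<Sum>y\<in>X. g (x,y)) = sqrt n * real (card (X \<inter> {y. (x,y) \<in> E}))"
    using fX by (simp add: g_def sum.If_cases)
  also have "card (X \<inter> {y. (x,y) \<in> E}) \<le> card (E `` {x})"
    by (rule card_mono[OF fE]) auto
  also have "real (card (E `` {x})) \<le> C * sqrt n" using deg_le[OF x] by (simp add: n_def)
  also have "sqrt n * (C * sqrt n) = C * n" using n_pos by simp
  finally show ?thesis using n_pos by simp
qed

text \<open>A row of \<open>w \<kappa>\<close> is the average, over the cell of \<open>x\<close>, of
  row sums of \<open>g\<close>; this is seen by testing with the indicator of that cell in the first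
  coordinate.\<close>

lemma sum_w_row_le: "x \<in> V \<Longrightarrow> X \<subseteq> V \<Longrightarrow> (\<Sum>y\<in>X. w \<kappa> (x,y)) \<le> C * n"
proof -
  assume x: "x \<in> V" and X: "X \<subseteq> V"
  let ?A = "{z \<in> V. \<kappa> z = \<kappa> x}"
  have A: "finite ?A" "card ?A > 0" using x finV by (auto simp: card_gt_0_iff)
  have "real (card ?A) * (\<Sum>y\<in>V. w \<kappa> (x,y)) = (\<Sum>z\<in>?A. \<Sum>y\<in>V. w \<kappa> (z,y))"
  proof -
    have "(\<Sum>z\<in>?A. \<Sum>y\<in>V. w \<kappa> (z,y)) = (\<Sum>z\<in>?A. \<Sum>y\<in>V. w \<kappa> (x,y))"
      by (intro sum.cong refl w_cong) auto
    then show ?thesis by simp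
  qed
  also have "\<dots> = (\<Sum>z\<in>V. \<Sum>y\<in>V. w \<kappa> (z,y) * of_bool (\<kappa> z = \<kappa> x))"
    using finV by (intro sum.mono_neutral_cong_left) auto
  also have "\<dots> = (\<Sum>p\<in>V\<times>V. w \<kappa> p * of_bool (\<kappa> (fst p) = \<kappa> x))"
    by (simp add: sum.cartesian_product case_prod_beta)
  also have "\<dots> = (\<Sum>p\<in>V\<times>V. g p * of_bool (\<kappa> (fst p) = \<kappa> x))"
    by (rule sum_w_mult) auto
  also have "\<dots> = (\<Sum>z\<in>V. \<Sum>y\<in>V. g (z,y) * of_bool (\<kappa> z = \<kappa> x))"
    by (simp add: sum.cartesian_product case_prod_beta)
  also have "\<dots> = (\<Sum>z\<in>?A. \<Sum>y\<in>V. g (z,y))"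
    using finV by (intro sum.mono_neutral_cong_right) auto
  also have "\<dots> \<le> (\<Sum>z\<in>?A. C * n)"
    by (intro sum_mono sum_g_row_le) auto
  also have "\<dots> = real (card ?A) * (C * n)" by simp
  finally have "(\<Sum>y\<in>V. w \<kappa> (x,y)) \<le> C * n" using A by simp
  moreover have "(\<Sum>y\<in>X. w \<kappa> (x,y)) \<le> (\<Sum>y\<in>V. w \<kappa> (x,y))"
    by (intro sum_mono2 finV X w_nonneg)
  ultimately show ?thesis by simp
qed

section \<open>Energy and its increments\<close>

lemma energy_nonneg: "0 \<le> energy \<kappa>"
  unfolding energy_def by (intro divide_nonneg_nonneg sum_nonneg) auto

lemma energy_refine:
  assumes "\<And>x y. x \<in> V \<Longrightarrow> y \<in> V \<Longrightarrow> \<kappa>' x = \<kappa>' y \<Longrightarrow> \<kappa> x = \<kappa> y"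
  shows "energy \<kappa>' = energy \<kappa> + (\<Sum>p\<in>V\<times>V. (w \<kappa>' p - w \<kappa> p)\<^sup>2) / n\<^sup>2"
proof -
  have "(\<Sum>p\<in>V\<times>V. (w \<kappa>' p)\<^sup>2) = (\<Sum>p\<in>V\<times>V. (w \<kappa> p)\<^sup>2) + (\<Sum>p\<in>V\<times>V. (w \<kappa>' p - w \<kappa> p)\<^sup>2)"
    unfolding w_def by (rule cavg_pythagoras) (auto simp: finV intro: assms)
  then show ?thesis by (simp add: energy_def add_divide_distrib)
qed

text \<open>Each nonempty cell contributes exactly one, and there are at most \<open>K\<close> of
  them.\<close>

lemma sum_inverse_cell_le:
  assumes "\<And>x. x \<in> V \<Longrightarrow> \<kappa> x < (K::nat)"
  shows "(\<Sum>y\<in>V. 1 / real (card {z \<in> V. \<kappa> z = \<kappa> y})) \<le> K"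
proof -
  have "(\<Sum>y\<in>V. 1 / real (card {z \<in> V. \<kappa> z = \<kappa> y}))
     = (\<Sum>l\<in>\<kappa> ` V. \<Sum>y | y \<in> V \<and> \<kappa> y = l. 1 / real (card {z \<in> V. \<kappa> z = \<kappa> y}))"
    by (rule sum.image_gen[OF finV])
  also have "\<dots> = (\<Sum>l\<in>\<kappa> ` V. 1)"
  proof (intro sum.cong refl)
    fix l assume "l \<in> \<kappa> ` V"
    then have "card {z \<in> V. \<kappa> z = l} > 0" using finV by (auto simp: card_gt_0_iff)
    moreover have "(\<Sum>y | y \<in> V \<and> \<kappa> y = l. 1 / real (card {z \<in> V. \<kappa> z = \<kappa> y}))
       = (\<Sum>y | y \<in> V \<and> \<kappa> y = l. 1 / real (card {z \<in> V. \<kappa> z = l}))"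
      by (intro sum.cong) auto
    ultimately show "(\<Sum>y | y \<in> V \<and> \<kappa> y = l. 1 / real (card {z \<in> V. \<kappa> z = \<kappa> y})) = 1"
      by simp
  qed
  also have "\<dots> = card (\<kappa> ` V)" by simp
  also have "card (\<kappa> ` V) \<le> card {..<K}" by (intro card_mono) (use assms in auto)
  finally show ?thesis by simp
qed

text \<open>Averaging over the second coordinate only gives a larger energy, and that energy counts
  cherries, which are bounded because \<open>E\<close> has no 4-cycle.\<close>
lemma energy_le:
  assumes "\<And>x. x \<in> V \<Longrightarrow> \<kappa> x < (K::nat)"
  shows "energy \<kappa> \<le> 1 + real K * C / sqrt n"
proof -
  let ?u = "cavg (V\<times>V) (map_prod id \<kappa>) g"
  let ?X = "\<lambda>y. {z \<in> V. \<kappa> z = \<kappa> y}"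
  have "(\<Sum>p\<in>V\<times>V. (?u p)\<^sup>2) = (\<Sum>p\<in>V\<times>V. (w \<kappa> p)\<^sup>2) + (\<Sum>p\<in>V\<times>V. (?u p - w \<kappa> p)\<^sup>2)"
    unfolding w_def by (rule cavg_pythagoras) (use finV in auto)
  then have "(\<Sum>p\<in>V\<times>V. (w \<kappa> p)\<^sup>2) \<le> (\<Sum>p\<in>V\<times>V. (?u p)\<^sup>2)"
    by (simp add: sum_nonneg)
  also have "\<dots> = (\<Sum>x\<in>V. \<Sum>y\<in>V. (?u (x,y))\<^sup>2)"
    by (simp add: sum.cartesian_product)
  also have "\<dots> = (\<Sum>y\<in>V. \<Sum>x\<in>V. (?u (x,y))\<^sup>2)" by (rule sum.swap)
  also have "\<dots> \<le> (\<Sum>y\<in>V. n + n * (C * sqrt n) * (1 / real (card (?X y))))"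
  proof (intro sum_mono)
    fix y assume y: "y \<in> V"
    have X: "?X y \<subseteq> V" "card (?X y) > 0" using y finV by (auto simp: card_gt_0_iff)
    have u: "?u (x,y) = sqrt n * real (card (E `` {x} \<inter> ?X y)) / real (card (?X y))" if "x \<in> V" for x
    proof -
      have "{q \<in> V \<times> V. map_prod id \<kappa> q = map_prod id \<kappa> (x,y)} = Pair x ` ?X y"
        using that by auto
      then have "?u (x,y) = (\<Sum>q\<in>Pair x ` ?X y. g q) / card (Pair x ` ?X y)"
        by (simp add: cavg_def)
      also have "\<dots> = (\<Sum>z\<in>?X y. g (x,z)) / card (?X y)"
        by (subst sum.reindex) (auto simp: inj_on_def card_image)
      also have "(\<Sum>z\<in>?X y. g (x,z)) = sqrt n * real (card (?X y \<inter> {z. (x,z) \<in> E}))"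
        using finV by (simp add: g_def sum.If_cases)
      also have "?X y \<inter> {z. (x,z) \<in> E} = E `` {x} \<inter> ?X y" by auto
      finally show ?thesis .
    qed
    have "(\<Sum>x\<in>V. (?u (x,y))\<^sup>2) = (\<Sum>x\<in>V. n / (real (card (?X y)))\<^sup>2 * (real (card (E `` {x} \<inter> ?X y)))\<^sup>2)"
      using n_pos by (intro sum.cong refl) (simp add: u power_mult_distrib power_divide)
    also have "\<dots> = n / (real (card (?X y)))\<^sup>2 * (\<Sum>x\<in>V. (real (card (E `` {x} \<inter> ?X y)))\<^sup>2)"
      by (simp add: sum_distrib_left)
    \<comment> \<open>The degenerate cherries leave an error inversely proportional to the cell
      size; its sum over \<open>y\<close> then costs only a factor \<open>K\<close>.\<close>
    also have "\<dots> \<le> n / (real (card (?X y)))\<^sup>2 * ((real (card (?X y)))\<^sup>2 + real (card (?X y)) * (C * sqrt n))"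
    proof (intro mult_left_mono)
      have "(\<Sum>x\<in>V. (real (card (E `` {x} \<inter> ?X y)))\<^sup>2)
         \<le> (real (card (?X y)))\<^sup>2 + (\<Sum>z\<in>?X y. real (card (E `` {z})))"
        by (rule sum_degree_square_le[OF finV gr c4 X(1)])
      also have "(\<Sum>z\<in>?X y. real (card (E `` {z}))) \<le> (\<Sum>z\<in>?X y. C * sqrt n)"
        by (intro sum_mono) (use deg_le in \<open>auto simp: n_def\<close>)
      also have "\<dots> = real (card (?X y)) * (C * sqrt n)" by simp
      finally show "(\<Sum>x\<in>V. (real (card (E `` {x} \<inter> ?X y)))\<^sup>2)
        \<le> (real (card (?X y)))\<^sup>2 + real (card (?X y)) * (C * sqrt n)" by simp
    qed (use n_pos in auto)
    also have "\<dots> = n + n * (C * sqrt n) * (1 / real (card (?X y)))"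
      using X(2) by (simp add: field_simps power2_eq_square)
    finally show "(\<Sum>x\<in>V. (?u (x,y))\<^sup>2) \<le> n + n * (C * sqrt n) * (1 / real (card (?X y)))" .
  qed
  also have "\<dots> = n * n + n * (C * sqrt n) * (\<Sum>y\<in>V. 1 / real (card (?X y)))"
    by (simp add: sum.distrib n_def sum_distrib_left)
  also have "\<dots> \<le> n * n + n * (C * sqrt n) * real K"
    by (intro add_left_mono mult_left_mono sum_inverse_cell_le assms) (use n_pos C_ge_1 in auto)
  finally have "energy \<kappa> \<le> (n * n + n * (C * sqrt n) * real K) / n\<^sup>2"
    unfolding energy_def by (rule divide_right_mono) auto
  also have "\<dots> = 1 + real K * C * (sqrt n / n)"
    using n_pos by (simp add: field_simps power2_eq_square)
  also have "sqrt n / n = 1 / sqrt n" using n_pos by (simp add: real_div_sqrt field_simps)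
  finally show ?thesis by simp
qed

text \<open>The new labels make \<open>S \<times> T\<close> a union of blocks, so
  \<open>w \<kappa>' - w \<kappa>\<close> has the same sum over it as \<open>g - w \<kappa>\<close>.
  Cauchy-Schwarz bounds the square sum of this difference from below, and by Pythagoras that square
  sum is the energy gain.\<close>

lemma energy_increment:
  assumes ST: "S \<subseteq> V" "T \<subseteq> V" and big: "\<bar>\<Sum>x\<in>S. \<Sum>y\<in>T. g (x,y) - w \<kappa> (x,y)\<bar> > \<epsilon> * n\<^sup>2"
    and \<epsilon>: "0 \<le> \<epsilon>"
    and \<kappa>': "\<kappa>' = (\<lambda>x. 4 * \<kappa> x + (2 * of_bool (x \<in> S) + of_bool (x \<in> T)) :: nat)"
  shows "energy \<kappa>' \<ge> energy \<kappa> + \<epsilon>\<^sup>2"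
proof -
  have ref: "\<kappa> x = \<kappa> y \<and> (x \<in> S \<longleftrightarrow> y \<in> S) \<and> (x \<in> T \<longleftrightarrow> y \<in> T)" if "\<kappa>' x = \<kappa>' y" for x y
    using that unfolding \<kappa>' by (auto simp: of_bool_def split: if_splits) presburger+
  let ?F = "\<lambda>p. of_bool (fst p \<in> S \<and> snd p \<in> T) :: real"
  let ?D = "\<lambda>p. w \<kappa>' p - w \<kappa> p"
  have "(\<Sum>x\<in>S. \<Sum>y\<in>T. g (x,y) - w \<kappa> (x,y)) = (\<Sum>p\<in>S\<times>T. g p - w \<kappa> p)"
    by (simp add: sum.cartesian_product)
  also have "\<dots> = (\<Sum>p\<in>V\<times>V. (g p - w \<kappa> p) * ?F p)"
    using ST finV by (intro sum.mono_neutral_cong_left) auto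
  also have "\<dots> = (\<Sum>p\<in>V\<times>V. g p * ?F p) - (\<Sum>p\<in>V\<times>V. w \<kappa> p * ?F p)"
    by (simp add: left_diff_distrib sum_subtractf)
  also have "(\<Sum>p\<in>V\<times>V. g p * ?F p) = (\<Sum>p\<in>V\<times>V. w \<kappa>' p * ?F p)"
  proof (rule sum_w_mult[symmetric])
    fix x y x' y' assume "\<kappa>' x = \<kappa>' x'" "\<kappa>' y = \<kappa>' y'"
    from ref[OF this(1)] ref[OF this(2)] show "?F (x,y) = ?F (x',y')" by simp
  qed
  also have "\<dots> - (\<Sum>p\<in>V\<times>V. w \<kappa> p * ?F p) = (\<Sum>p\<in>V\<times>V. ?D p * ?F p)"
    by (simp add: left_diff_distrib sum_subtractf)
  finally have 1: "\<epsilon> * n\<^sup>2 < \<bar>\<Sum>p\<in>V\<times>V. ?D p * ?F p\<bar>" using big by simp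
  have "(\<epsilon> * n\<^sup>2)\<^sup>2 \<le> \<bar>\<Sum>p\<in>V\<times>V. ?D p * ?F p\<bar>\<^sup>2"
    using 1 \<epsilon> by (intro power_mono) auto
  also have "\<dots> = (\<Sum>p\<in>V\<times>V. ?D p * ?F p)\<^sup>2" by simp
  also have "\<dots> \<le> (\<Sum>p\<in>V\<times>V. (?D p)\<^sup>2) * (\<Sum>p\<in>V\<times>V. (?F p)\<^sup>2)"
    by (rule Cauchy_Schwarz_ineq_sum)
  also have "\<dots> \<le> (\<Sum>p\<in>V\<times>V. (?D p)\<^sup>2) * n\<^sup>2"
  proof (intro mult_left_mono sum_nonneg)
    have "(\<Sum>p\<in>V\<times>V. (?F p)\<^sup>2) \<le> (\<Sum>p\<in>V\<times>V. 1)" by (intro sum_mono) auto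
    then show "(\<Sum>p\<in>V\<times>V. (?F p)\<^sup>2) \<le> n\<^sup>2" by (simp add: n_def power2_eq_square card_cartesian_product)
  qed auto
  finally have "\<epsilon>\<^sup>2 * n\<^sup>2 \<le> (\<Sum>p\<in>V\<times>V. (?D p)\<^sup>2)"
    using n_pos by (simp add: power_mult_distrib power2_eq_square)
  then have "\<epsilon>\<^sup>2 \<le> (\<Sum>p\<in>V\<times>V. (?D p)\<^sup>2) / n\<^sup>2" using n_pos by (simp add: field_simps)
  moreover have "energy \<kappa>' = energy \<kappa> + (\<Sum>p\<in>V\<times>V. (?D p)\<^sup>2) / n\<^sup>2"
    by (rule energy_refine) (use ref in blast)
  ultimately show ?thesis by simp
qed

text \<open>\<open>t\<close> is the number of increments still available: each failure of regularity
  gains \<epsilon> squared in energy and multiplies the number of labels by four. With none left the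
  energy would exceed 2.\<close>

lemma exists_cut_regular_refinement_aux:
  assumes \<epsilon>: "0 < \<epsilon>"
  shows "(\<And>x. x \<in> V \<Longrightarrow> \<kappa> x < (K::nat)) \<Longrightarrow> energy \<kappa> > 2 - real t * \<epsilon>\<^sup>2
    \<Longrightarrow> real (K * 4 ^ t) * C \<le> sqrt n
    \<Longrightarrow> \<exists>\<kappa>'. (\<forall>x\<in>V. \<kappa>' x < K * 4 ^ t) \<and> (\<forall>x\<in>V. \<forall>y\<in>V. \<kappa>' x = \<kappa>' y \<longrightarrow> \<kappa> x = \<kappa> y)
          \<and> cut_regular \<kappa>' \<epsilon>"
proof (induction t arbitrary: \<kappa> K)
  case 0
  \<comment> \<open>The lower bound on \<open>sqrt n\<close> makes the error term in
    \<open>energy_le\<close> at most one.\<close>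
  have "energy \<kappa> \<le> 1 + real K * C / sqrt n" by (rule energy_le) (rule 0)
  also have "\<dots> \<le> 2" using 0(3) n_pos by (simp add: divide_le_eq)
  finally show ?case using 0(2) by simp
next
  case (Suc t)
  show ?case
  proof (cases "cut_regular \<kappa> \<epsilon>")
    case True
    have "K * 1 \<le> K * 4 ^ Suc t" by (intro mult_le_mono2) simp
    then have "\<forall>x\<in>V. \<kappa> x < K * 4 ^ Suc t" using Suc.prems(1) by (metis less_le_trans mult.right_neutral)
    with True show ?thesis by blast
  next
    case False
    then obtain S T where ST: "S \<subseteq> V" "T \<subseteq> V"
      and big: "\<bar>\<Sum>x\<in>S. \<Sum>y\<in>T. g (x,y) - w \<kappa> (x,y)\<bar> > \<epsilon> * n\<^sup>2"
      unfolding cut_regular_def by (auto simp: not_le)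
    define \<kappa>1 where "\<kappa>1 = (\<lambda>x. 4 * \<kappa> x + (2 * of_bool (x \<in> S) + of_bool (x \<in> T)) :: nat)"
    have inc: "energy \<kappa>1 \<ge> energy \<kappa> + \<epsilon>\<^sup>2"
      by (rule energy_increment[OF ST big _ \<kappa>1_def]) (use \<epsilon> in simp)
    have lab: "\<kappa>1 x < 4 * K" if "x \<in> V" for x
      using Suc.prems(1)[OF that] unfolding \<kappa>1_def by (auto simp: of_bool_def)
    have ref: "\<kappa> x = \<kappa> y" if "\<kappa>1 x = \<kappa>1 y" for x y
      using that unfolding \<kappa>1_def by (auto simp: of_bool_def split: if_splits) presburger+
    have "\<exists>\<kappa>'. (\<forall>x\<in>V. \<kappa>' x < 4 * K * 4 ^ t) \<and> (\<forall>x\<in>V. \<forall>y\<in>V. \<kappa>' x = \<kappa>' y \<longrightarrow> \<kappa>1 x = \<kappa>1 y)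
          \<and> cut_regular \<kappa>' \<epsilon>"
    proof (rule Suc.IH)
      show "energy \<kappa>1 > 2 - real t * \<epsilon>\<^sup>2"
        using inc Suc.prems(2) by (simp add: algebra_simps)
      show "real (4 * K * 4 ^ t) * C \<le> sqrt n" using Suc.prems(3) by (simp add: mult_ac)
    qed (rule lab)
    then obtain \<kappa>' where "\<forall>x\<in>V. \<kappa>' x < K * 4 ^ Suc t" "cut_regular \<kappa>' \<epsilon>"
      "\<forall>x\<in>V. \<forall>y\<in>V. \<kappa>' x = \<kappa>' y \<longrightarrow> \<kappa>1 x = \<kappa>1 y"
      by (auto simp: mult_ac)
    then show ?thesis using ref by blast
  qed
qed

lemma exists_cut_regular_refinement:
  assumes \<epsilon>: "0 < \<epsilon>" and "\<And>x. x \<in> V \<Longrightarrow> \<kappa> x < (K::nat)"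
    and t: "real t * \<epsilon>\<^sup>2 > 2" and "real (K * 4 ^ t) * C \<le> sqrt n"
  shows "\<exists>\<kappa>'. (\<forall>x\<in>V. \<kappa>' x < K * 4 ^ t) \<and> (\<forall>x\<in>V. \<forall>y\<in>V. \<kappa>' x = \<kappa>' y \<longrightarrow> \<kappa> x = \<kappa> y)
      \<and> cut_regular \<kappa>' \<epsilon>"
proof -
  have "energy \<kappa> > 2 - real t * \<epsilon>\<^sup>2" using energy_nonneg[of \<kappa>] t by linarith
  from exists_cut_regular_refinement_aux[OF \<epsilon> assms(2) this assms(4)] show ?thesis .
qed

text \<open>For fixed \<open>S\<close> the sum is linear in every \<open>h y\<close>, so it is
  extremal when \<open>h\<close> is \<open>M\<close> on the columns of one sign and 0 elsewhere,
  which is a cut. Splitting \<open>V\<close> by the sign of the inner sum removes the absolute value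
  and gives the factor 2.\<close>

lemma cut_regular_weighted:
  assumes reg: "cut_regular \<kappa> \<epsilon>" and h: "\<And>y. y \<in> V \<Longrightarrow> 0 \<le> h y \<and> h y \<le> M"
  shows "(\<Sum>x\<in>V. \<bar>\<Sum>y\<in>V. (g (x,y) - w \<kappa> (x,y)) * h y\<bar>) \<le> 2 * M * \<epsilon> * n\<^sup>2"
proof -
  let ?D = "\<lambda>x y. g (x,y) - w \<kappa> (x,y)"
  let ?I = "\<lambda>x. \<Sum>y\<in>V. ?D x y * h y"
  have M: "0 \<le> M" using h V_ne by force
  have half: "\<bar>\<Sum>x\<in>S. ?I x\<bar> \<le> M * (\<epsilon> * n\<^sup>2)" if S: "S \<subseteq> V" for S
  proof -
    let ?c = "\<lambda>y. \<Sum>x\<in>S. ?D x y"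
    have eq: "(\<Sum>x\<in>S. ?I x) = (\<Sum>y\<in>V. ?c y * h y)"
      unfolding sum_distrib_right by (rule sum.swap)
    have cut: "\<bar>\<Sum>y\<in>T. ?c y\<bar> \<le> \<epsilon> * n\<^sup>2" if "T \<subseteq> V" for T
      using reg S that unfolding cut_regular_def by (subst sum.swap) blast
    have "(\<Sum>y\<in>V. ?c y * h y) \<le> (\<Sum>y\<in>{y\<in>V. ?c y > 0}. ?c y * M)"
    proof -
      have "(\<Sum>y\<in>V. ?c y * h y) \<le> (\<Sum>y\<in>V. if ?c y > 0 then ?c y * M else 0)"
        by (intro sum_mono) (use h in \<open>auto intro!: mult_left_mono simp: mult_nonpos_nonneg\<close>)
      also have "\<dots> = (\<Sum>y\<in>{y\<in>V. ?c y > 0}. ?c y * M)"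
        using finV by (simp add: sum.inter_filter)
      finally show ?thesis .
    qed
    also have "\<dots> = M * (\<Sum>y\<in>{y\<in>V. ?c y > 0}. ?c y)"
      by (simp add: sum_distrib_left mult.commute)
    also have "\<dots> \<le> M * (\<epsilon> * n\<^sup>2)" using cut[of "{y\<in>V. ?c y > 0}"] M by (intro mult_left_mono) auto
    finally have up: "(\<Sum>y\<in>V. ?c y * h y) \<le> M * (\<epsilon> * n\<^sup>2)" .
    have "- (\<Sum>y\<in>V. ?c y * h y) \<le> (\<Sum>y\<in>{y\<in>V. ?c y < 0}. - ?c y * M)"
    proof -
      have "- (\<Sum>y\<in>V. ?c y * h y) = (\<Sum>y\<in>V. - ?c y * h y)" by (simp add: sum_negf)
      also have "\<dots> \<le> (\<Sum>y\<in>V. if ?c y < 0 then - ?c y * M else 0)"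
      proof (intro sum_mono)
        fix y assume y: "y \<in> V"
        show "- ?c y * h y \<le> (if ?c y < 0 then - ?c y * M else 0)"
        proof (cases "?c y < 0")
          case True
          then have "- ?c y * h y \<le> - ?c y * M" using h[OF y] by (intro mult_left_mono) auto
          then show ?thesis using True by simp
        next
          case False
          then have "0 \<le> ?c y * h y" using h[OF y] by (intro mult_nonneg_nonneg) auto
          then show ?thesis using False by simp
        qed
      qed
      also have "\<dots> = (\<Sum>y\<in>{y\<in>V. ?c y < 0}. - ?c y * M)"
        by (rule sum.inter_filter[OF finV, symmetric])
      finally show ?thesis .
    qed
    also have "\<dots> = M * - (\<Sum>y\<in>{y\<in>V. ?c y < 0}. ?c y)"
      by (simp add: sum_distrib_left mult.commute sum_negf)
    also have "\<dots> \<le> M * (\<epsilon> * n\<^sup>2)" using cut[of "{y\<in>V. ?c y < 0}"] M by (intro mult_left_mono) auto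
    finally have dn: "- (\<Sum>y\<in>V. ?c y * h y) \<le> M * (\<epsilon> * n\<^sup>2)" .
    show ?thesis unfolding eq using up dn by (simp add: abs_le_iff)
  qed
  let ?S = "{x\<in>V. ?I x \<ge> 0}" and ?T = "{x\<in>V. \<not> ?I x \<ge> 0}"
  have "(\<Sum>x\<in>V. \<bar>?I x\<bar>) = (\<Sum>x\<in>?S. \<bar>?I x\<bar>) + (\<Sum>x\<in>?T. \<bar>?I x\<bar>)"
    by (subst sum.union_disjoint[symmetric]) (use finV in \<open>auto intro!: sum.cong\<close>)
  also have "(\<Sum>x\<in>?S. \<bar>?I x\<bar>) = (\<Sum>x\<in>?S. ?I x)" by (intro sum.cong) auto
  also have "(\<Sum>x\<in>?T. \<bar>?I x\<bar>) = - (\<Sum>x\<in>?T. ?I x)"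
    by (subst sum_negf[symmetric], intro sum.cong) auto
  also have "(\<Sum>x\<in>?S. ?I x) \<le> M * (\<epsilon> * n\<^sup>2)" using half[of ?S] by auto
  also have "- (\<Sum>x\<in>?T. ?I x) \<le> M * (\<epsilon> * n\<^sup>2)" using half[of ?T] by auto
  finally show ?thesis by (simp add: algebra_simps)
qed

end

section \<open>Short walks\<close>

lemma sum_over_labels:
  fixes \<kappa> :: "'a \<Rightarrow> nat" and f :: "'a \<Rightarrow> real"
  assumes "finite X" "\<And>x. x \<in> X \<Longrightarrow> \<kappa> x < K"
  shows "(\<Sum>j<K. \<Sum>x | x \<in> X \<and> \<kappa> x = j. f x) = (\<Sum>x\<in>X. f x)"
  by (rule sum.group) (use assms in auto)

text \<open>The weight \<open>c\<close> sees only labels. The cellwise form serves the upper bound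
  for walks, the vertexwise form the lower bound.\<close>

lemma sum_over_label_pairs:
  fixes \<kappa> :: "'a \<Rightarrow> nat" and f h :: "'a \<Rightarrow> real"
  assumes X: "finite X" "\<And>x. x \<in> X \<Longrightarrow> \<kappa> x < K" and Y: "finite Y" "\<And>x. x \<in> Y \<Longrightarrow> \<kappa> x < K"
  shows "(\<Sum>j<K. \<Sum>k<K. c j k * ((\<Sum>x | x \<in> X \<and> \<kappa> x = j. f x) * (\<Sum>y | y \<in> Y \<and> \<kappa> y = k. h y)))
     = (\<Sum>x\<in>X. \<Sum>y\<in>Y. c (\<kappa> x) (\<kappa> y) * (f x * h y))"
proof -
  have "(\<Sum>x\<in>X. \<Sum>y\<in>Y. c (\<kappa> x) (\<kappa> y) * (f x * h y))
      = (\<Sum>j<K. \<Sum>x | x \<in> X \<and> \<kappa> x = j. \<Sum>k<K. \<Sum>y | y \<in> Y \<and> \<kappa> y = k. c (\<kappa> x) (\<kappa> y) * (f x * h y))"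
    by (simp only: sum_over_labels[OF X] sum_over_labels[OF Y])
  also have "\<dots> = (\<Sum>j<K. \<Sum>x | x \<in> X \<and> \<kappa> x = j. \<Sum>k<K. \<Sum>y | y \<in> Y \<and> \<kappa> y = k. c j k * (f x * h y))"
    by (intro sum.cong refl) auto
  also have "\<dots> = (\<Sum>j<K. \<Sum>k<K. \<Sum>x | x \<in> X \<and> \<kappa> x = j. \<Sum>y | y \<in> Y \<and> \<kappa> y = k. c j k * (f x * h y))"
    by (intro sum.cong refl sum.swap)
  also have "\<dots> = (\<Sum>j<K. \<Sum>k<K. c j k * ((\<Sum>x | x \<in> X \<and> \<kappa> x = j. f x) * (\<Sum>y | y \<in> Y \<and> \<kappa> y = k. h y)))"
    unfolding sum_product unfolding sum_distrib_left ..
  finally show ?thesis by simp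
qed

text \<open>A union bound over the five links of a closed walk \<open>v, a, b', a', b\<close>: each
  link is bad for at most a \<gamma> fraction of the choices. The threshold for \<open>f3\<close> is
  1 because the middle link will be the indicator of a dense pair of cells.\<close>

lemma sum_five_lower_bound:
  fixes f1 f2 f3 f4 f5 :: "'a \<Rightarrow> 'a \<Rightarrow> real" and d \<gamma> :: real
  assumes fin: "finite A" "finite B" "finite D" and d: "0 \<le> d"
    and nn: "\<And>x y. 0 \<le> f1 x y" "\<And>x y. 0 \<le> f2 x y" "\<And>x y. 0 \<le> f3 x y" "\<And>x y. 0 \<le> f4 x y" "\<And>x y. 0 \<le> f5 x y"
    and b1: "real (card {(v,a) \<in> D \<times> A. f1 v a < d}) \<le> \<gamma> * real (card D) * real (card A)"
    and b2: "real (card {(a,b) \<in> A \<times> B. f2 a b < d}) \<le> \<gamma> * real (card A) * real (card B)"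
    and b3: "real (card {(b,a) \<in> B \<times> A. f3 b a < 1}) \<le> \<gamma> * real (card A) * real (card B)"
    and b4: "real (card {(b,a) \<in> B \<times> A. f4 b a < d}) \<le> \<gamma> * real (card A) * real (card B)"
    and b5: "real (card {(v,b) \<in> D \<times> B. f5 v b < d}) \<le> \<gamma> * real (card D) * real (card B)"
  shows "d ^ 4 * (1 - 5 * \<gamma>) * (real (card D) * (real (card A))\<^sup>2 * (real (card B))\<^sup>2)
    \<le> (\<Sum>v\<in>D. \<Sum>b'\<in>B. \<Sum>a'\<in>A. f3 b' a' * ((\<Sum>a\<in>A. f1 v a * f2 a b') * (\<Sum>b\<in>B. f5 v b * f4 b a')))"
proof -
  define B1 B2 B3 B4 B5 :: "'a \<Rightarrow> 'a \<Rightarrow> real" where "B1 v a = of_bool (f1 v a < d)" and "B2 a b = of_bool (f2 a b < d)"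
    and "B3 b a = of_bool (f3 b a < 1)" and "B4 b a = of_bool (f4 b a < d)" and "B5 v b = of_bool (f5 v b < d)"
    for a b v
  have cnt: "(\<Sum>x\<in>X. \<Sum>y\<in>Y. of_bool (P x y)) = real (card {(x,y) \<in> X \<times> Y. P x y})"
    if "finite X" "finite Y" for X Y :: "'a set" and P
  proof -
    have "(\<Sum>x\<in>X. \<Sum>y\<in>Y. of_bool (P x y)) = (\<Sum>p\<in>X\<times>Y. of_bool (P (fst p) (snd p)) :: real)"
      by (simp add: sum.cartesian_product case_prod_beta)
    also have "\<dots> = real (card ((X\<times>Y) \<inter> {p. P (fst p) (snd p)}))" using that by simp
    also have "(X\<times>Y) \<inter> {p. P (fst p) (snd p)} = {(x,y) \<in> X \<times> Y. P x y}" by auto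
    finally show ?thesis .
  qed
  note c = b1[folded cnt[OF fin(3,1)] B1_def] b2[folded cnt[OF fin(1,2)] B2_def]
    b3[folded cnt[OF fin(2,1)] B3_def] b4[folded cnt[OF fin(2,1)] B4_def] b5[folded cnt[OF fin(3,2)] B5_def]
  have pt: "d ^ 4 * (1 - B1 v a - B2 a b' - B3 b' a' - B4 b a' - B5 v b)
      \<le> f3 b' a' * ((f1 v a * f2 a b') * (f5 v b * f4 b a'))" for v a b' a' b
  proof (cases "f1 v a < d \<or> f2 a b' < d \<or> f3 b' a' < 1 \<or> f4 b a' < d \<or> f5 v b < d")
    case True
    then have "1 - B1 v a - B2 a b' - B3 b' a' - B4 b a' - B5 v b \<le> 0"
      by (auto simp: B1_def B2_def B3_def B4_def B5_def)
    then have "d ^ 4 * (1 - B1 v a - B2 a b' - B3 b' a' - B4 b a' - B5 v b) \<le> 0"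
      using d by (intro mult_nonneg_nonpos) auto
    also have "0 \<le> f3 b' a' * ((f1 v a * f2 a b') * (f5 v b * f4 b a'))"
      using nn by simp
    finally show ?thesis .
  next
    case False
    then have "1 * ((d * d) * (d * d)) \<le> f3 b' a' * ((f1 v a * f2 a b') * (f5 v b * f4 b a'))"
      using d nn by (intro mult_mono) auto
    moreover have "d ^ 4 = 1 * ((d * d) * (d * d))" by (simp add: power4_eq_xxxx)
    ultimately show ?thesis using False by (simp add: B1_def B2_def B3_def B4_def B5_def)
  qed
  let ?N = "real (card D) * (real (card A))\<^sup>2 * (real (card B))\<^sup>2"
  \<comment> \<open>Each prefactor counts the choices for the three vertices that are not on the bad
    link.\<close>
  have "(1 - 5 * \<gamma>) * ?N \<le> ?N - (real (card B) * real (card A) * real (card B)) * (\<Sum>v\<in>D. \<Sum>a\<in>A. B1 v a)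
     - (real (card D) * real (card A) * real (card B)) * (\<Sum>a\<in>A. \<Sum>b\<in>B. B2 a b)
     - (real (card D) * real (card A) * real (card B)) * (\<Sum>b\<in>B. \<Sum>a\<in>A. B3 b a)
     - (real (card D) * real (card A) * real (card B)) * (\<Sum>b\<in>B. \<Sum>a\<in>A. B4 b a)
     - (real (card A) * real (card B) * real (card A)) * (\<Sum>v\<in>D. \<Sum>b\<in>B. B5 v b)"
  proof -
    have "(real (card B) * real (card A) * real (card B)) * (\<Sum>v\<in>D. \<Sum>a\<in>A. B1 v a) \<le> (real (card B) * real (card A) * real (card B)) * (\<gamma> * real (card D) * real (card A))"
      by (intro mult_left_mono c) auto
    moreover have "(real (card D) * real (card A) * real (card B)) * (\<Sum>a\<in>A. \<Sum>b\<in>B. B2 a b) \<le> (real (card D) * real (card A) * real (card B)) * (\<gamma> * real (card A) * real (card B))"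
      by (intro mult_left_mono c) auto
    moreover have "(real (card D) * real (card A) * real (card B)) * (\<Sum>b\<in>B. \<Sum>a\<in>A. B3 b a) \<le> (real (card D) * real (card A) * real (card B)) * (\<gamma> * real (card A) * real (card B))"
      by (intro mult_left_mono c) auto
    moreover have "(real (card D) * real (card A) * real (card B)) * (\<Sum>b\<in>B. \<Sum>a\<in>A. B4 b a) \<le> (real (card D) * real (card A) * real (card B)) * (\<gamma> * real (card A) * real (card B))"
      by (intro mult_left_mono c) auto
    moreover have "(real (card A) * real (card B) * real (card A)) * (\<Sum>v\<in>D. \<Sum>b\<in>B. B5 v b) \<le> (real (card A) * real (card B) * real (card A)) * (\<gamma> * real (card D) * real (card B))"
      by (intro mult_left_mono c) auto
    ultimately show ?thesis by (simp add: algebra_simps power2_eq_square)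
  qed
  also have "\<dots> = (\<Sum>v\<in>D. \<Sum>a\<in>A. \<Sum>b'\<in>B. \<Sum>a'\<in>A. \<Sum>b\<in>B. 1 - B1 v a - B2 a b' - B3 b' a' - B4 b a' - B5 v b)"
  proof -
    have s4: "(\<Sum>a'\<in>A. \<Sum>b\<in>B. B4 b a') = (\<Sum>b\<in>B. \<Sum>a\<in>A. B4 b a)" by (rule sum.swap)
    show ?thesis
      by (simp add: sum_subtractf sum_distrib_left[symmetric] s4)
        (simp add: power2_eq_square algebra_simps)
  qed
  finally have "d ^ 4 * ((1 - 5 * \<gamma>) * ?N) \<le> d ^ 4 * \<dots>" using d by (intro mult_left_mono) auto
  also have "\<dots> = (\<Sum>v\<in>D. \<Sum>a\<in>A. \<Sum>b'\<in>B. \<Sum>a'\<in>A. \<Sum>b\<in>B. d ^ 4 * (1 - B1 v a - B2 a b' - B3 b' a' - B4 b a' - B5 v b))"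
    by (simp only: sum_distrib_left)
  also have "\<dots> \<le> (\<Sum>v\<in>D. \<Sum>a\<in>A. \<Sum>b'\<in>B. \<Sum>a'\<in>A. \<Sum>b\<in>B. f3 b' a' * ((f1 v a * f2 a b') * (f5 v b * f4 b a')))"
    by (intro sum_mono pt)
  also have "\<dots> = (\<Sum>v\<in>D. \<Sum>b'\<in>B. \<Sum>a\<in>A. \<Sum>a'\<in>A. \<Sum>b\<in>B. f3 b' a' * ((f1 v a * f2 a b') * (f5 v b * f4 b a')))"
    by (intro sum.cong refl sum.swap)
  also have "\<dots> = (\<Sum>v\<in>D. \<Sum>b'\<in>B. \<Sum>a'\<in>A. \<Sum>a\<in>A. \<Sum>b\<in>B. f3 b' a' * ((f1 v a * f2 a b') * (f5 v b * f4 b a')))"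
    by (intro sum.cong refl sum.swap)
  also have "\<dots> = (\<Sum>v\<in>D. \<Sum>b'\<in>B. \<Sum>a'\<in>A. f3 b' a' * ((\<Sum>a\<in>A. f1 v a * f2 a b') * (\<Sum>b\<in>B. f5 v b * f4 b a')))"
    unfolding sum_product unfolding sum_distrib_left ..
  finally show ?thesis by (simp add: mult.assoc)
qed

section \<open>Second neighbourhoods and 2-paths\<close>

context sparse_graph
begin

text \<open>Defined by walks, so \<open>v\<close> itself belongs to it as soon as it has a
  neighbour; walks that return to \<open>v\<close> must be bounded separately.\<close>

definition "second_nbrs v = {y. \<exists>x. (v,x) \<in> E \<and> (x,y) \<in> E}"

lemma finE: "finite E"
  by (rule finite_subset[of _ "V\<times>V"]) (use finV gr in \<open>auto simp: graph_on_def\<close>)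

lemma fin_nbrs: "finite (E `` {x})"
  using finE by (simp add: finite_Image)

lemma deg_le_n: "v \<in> V \<Longrightarrow> real (card (E `` {v})) \<le> C * sqrt n"
  using deg_le by (simp add: n_def)

text \<open>An edge inside the second neighbourhood of \<open>v\<close> closes a walk of length five through \<open>v\<close>,
  and without 5-cycles such a walk is degenerate.\<close>
lemma card_edges_second_nbrs_le:
  assumes c5: "c5free E" and v: "v \<in> V"
  shows "real (card (E \<inter> second_nbrs v \<times> second_nbrs v)) \<le> 3 * C\<^sup>2 * n"
proof -
  let ?N = "E `` {v}"
  \<comment> \<open>\<open>?W\<close> lists the walks \<open>v, a, b'\<close> by their last step
    \<open>(a, b')\<close>. For each of them \<open>?P\<close> contains the pairs
    \<open>(b', z)\<close> with \<open>z\<close> a common neighbour of \<open>a\<close> and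
    \<open>b'\<close>, of which there is at most one.\<close>
  let ?W = "Sigma ?N (\<lambda>a. E `` {a})"
  let ?P = "\<Union>p\<in>?W. Pair (snd p) ` {z. (fst p,z) \<in> E \<and> (snd p,z) \<in> E}"
  have NV: "?N \<subseteq> V" using graph_onD[OF gr] by auto
  have finW: "finite ?W" by (intro finite_SigmaI fin_nbrs)
  have W: "real (card ?W) \<le> C\<^sup>2 * n"
  proof -
    have "card ?W = (\<Sum>a\<in>?N. card (E `` {a}))" by (intro card_SigmaI) (auto simp: fin_nbrs)
    then have "real (card ?W) = (\<Sum>a\<in>?N. real (card (E `` {a})))" by simp
    also have "\<dots> \<le> (\<Sum>a\<in>?N. C * sqrt n)" by (intro sum_mono deg_le_n) (use NV in auto)
    also have "\<dots> = real (card ?N) * (C * sqrt n)" by simp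
    also have "\<dots> \<le> (C * sqrt n) * (C * sqrt n)"
      by (intro mult_right_mono deg_le_n v) (use C_ge_1 n_pos in auto)
    finally show ?thesis using n_pos by (simp add: power2_eq_square mult_ac)
  qed
  have finz: "finite {z. (x,z) \<in> E \<and> (y,z) \<in> E}" for x y
    by (rule finite_subset[OF _ fin_nbrs[of x]]) auto
  have P: "card ?P \<le> card ?W"
  proof -
    have "card ?P \<le> (\<Sum>p\<in>?W. card (Pair (snd p) ` {z. (fst p,z) \<in> E \<and> (snd p,z) \<in> E}))"
      by (rule card_UN_le[OF finW])
    also have "\<dots> \<le> (\<Sum>p\<in>?W. 1)"
    proof (intro sum_mono)
      fix p assume "p \<in> ?W"
      then have "fst p \<noteq> snd p" using graph_onD(4)[OF gr] by auto
      then show "card (Pair (snd p) ` {z. (fst p,z) \<in> E \<and> (snd p,z) \<in> E}) \<le> 1"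
        using card_codegree_le_1[OF c4] card_image_le[OF finz] le_trans by blast
    qed
    finally show ?thesis by simp
  qed
  \<comment> \<open>A coincidence in the walk \<open>v, a, b', a', b\<close> makes \<open>a'\<close>
    or \<open>b'\<close> a neighbour of \<open>v\<close>, or gives the two 2-paths the same
    midpoint. Each of these three cases accounts for at most \<open>card ?W\<close> pairs.\<close>
  have sub: "E \<inter> second_nbrs v \<times> second_nbrs v \<subseteq> ?W\<inverse> \<union> ?W \<union> ?P"
  proof
    fix p assume "p \<in> E \<inter> second_nbrs v \<times> second_nbrs v"
    then obtain b' a' a b where p: "p = (b',a')" "(b',a') \<in> E" "(v,a) \<in> E" "(a,b') \<in> E" "(v,b) \<in> E" "(b,a') \<in> E"
      by (auto simp: second_nbrs_def)
    note sy = graph_onD(3)[OF gr]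
    have "\<not> distinct [v,a,b',a',b]"
      using c5 p sy unfolding c5free_def by blast
    then have "v = b' \<or> v = a' \<or> a = a' \<or> a = b \<or> b' = b"
      using p graph_onD(4)[OF gr] by auto
    then consider "a' \<in> ?N" | "b' \<in> ?N" | "a = b" using p sy by blast
    then show "p \<in> ?W\<inverse> \<union> ?W \<union> ?P"
    proof cases
      case 1
      then show ?thesis using p sy by blast
    next
      case 2
      then show ?thesis using p sy by blast
    next
      case 3
      then have "(a,b') \<in> ?W" "a' \<in> {z. (a,z) \<in> E \<and> (b',z) \<in> E}" using p by auto
      then have "p \<in> ?P" using p(1) by force
      then show ?thesis by blast
    qed
  qed
  have "card (E \<inter> second_nbrs v \<times> second_nbrs v) \<le> card (?W\<inverse> \<union> ?W \<union> ?P)"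
    by (rule card_mono[OF _ sub]) (use finW finz in auto)
  also have "\<dots> \<le> card (?W\<inverse>) + card ?W + card ?P"
    by (meson card_Un_le le_trans add_le_mono1)
  also have "\<dots> \<le> 3 * card ?W" using P by simp
  finally show ?thesis using W by linarith
qed

text \<open>A nonzero product of two entries equals \<open>n\<close>. For \<open>b\<close> other
  than \<open>v\<close> there is at most one midpoint, and none unless \<open>b\<close> is a second
  neighbour; the walks returning to \<open>v\<close> are counted by its degree.\<close>

lemma sum_two_paths_le:
  assumes v: "v \<in> V" and A: "A \<subseteq> V" and X: "X \<subseteq> V"
  shows "(\<Sum>b\<in>X. \<Sum>a\<in>A. g (v,a) * g (a,b)) \<le> n * (real (card (X \<inter> second_nbrs v)) + C * sqrt n)"
proof -
  have fX: "finite X" and fA: "finite A" using A X finV finite_subset by blast+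
  have inner: "(\<Sum>a\<in>A. g (v,a) * g (a,b)) \<le> n * real (card {a. (v,a) \<in> E \<and> (b,a) \<in> E})" for b
  proof -
    have "(\<Sum>a\<in>A. g (v,a) * g (a,b)) = (\<Sum>a\<in>A. n * of_bool ((v,a) \<in> E \<and> (b,a) \<in> E))"
      using n_pos graph_onD(3)[OF gr] by (intro sum.cong refl) (auto simp: g_def)
    also have "\<dots> = n * real (card (A \<inter> {a. (v,a) \<in> E \<and> (b,a) \<in> E}))"
      using fA by (simp add: sum_distrib_left[symmetric])
    also have "card (A \<inter> {a. (v,a) \<in> E \<and> (b,a) \<in> E}) \<le> card {a. (v,a) \<in> E \<and> (b,a) \<in> E}"
      by (intro card_mono finite_subset[OF _ fin_nbrs[of v]]) auto
    finally show ?thesis using n_pos by simp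
  qed
  have "(\<Sum>b\<in>X. \<Sum>a\<in>A. g (v,a) * g (a,b)) \<le> (\<Sum>b\<in>X. n * (of_bool (b \<in> second_nbrs v) + of_bool (b = v) * (C * sqrt n)))"
  proof (intro sum_mono)
    fix b
    have "real (card {a. (v,a) \<in> E \<and> (b,a) \<in> E}) \<le> of_bool (b \<in> second_nbrs v) + of_bool (b = v) * (C * sqrt n)"
    proof (cases "b = v")
      case True
      then have "{a. (v,a) \<in> E \<and> (b,a) \<in> E} = E `` {v}" by auto
      then show ?thesis using deg_le_n[OF v] True by simp
    next
      case False
      show ?thesis
      proof (cases "b \<in> second_nbrs v")
        case True
        have "card {a. (v,a) \<in> E \<and> (b,a) \<in> E} \<le> 1"
          using card_codegree_le_1[OF c4, of v b] False by blast
        then show ?thesis using True False by (simp only: of_bool_eq)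
      next
        case f: False
        then have "{a. (v,a) \<in> E \<and> (b,a) \<in> E} = {}"
          using graph_onD(3)[OF gr] by (auto simp: second_nbrs_def)
        then have "card {a. (v,a) \<in> E \<and> (b,a) \<in> E} = 0" by (metis card.empty)
        then show ?thesis using False by simp
      qed
    qed
    then show "(\<Sum>a\<in>A. g (v,a) * g (a,b)) \<le> n * (of_bool (b \<in> second_nbrs v) + of_bool (b = v) * (C * sqrt n))"
      using inner[of b] n_pos by (meson mult_left_mono less_imp_le order_trans)
  qed
  also have "\<dots> = n * ((\<Sum>b\<in>X. of_bool (b \<in> second_nbrs v)) + (\<Sum>b\<in>X. of_bool (b = v)) * (C * sqrt n))"
    by (simp only: sum_distrib_left sum_distrib_right sum.distrib distrib_left)
  also have "(\<Sum>b\<in>X. of_bool (b \<in> second_nbrs v)) = real (card (X \<inter> second_nbrs v))"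
    using fX by simp
  also have "(\<Sum>b\<in>X. of_bool (b = v)) \<le> (1::real)"
    using fX by (simp add: of_bool_def)
  finally show ?thesis using n_pos C_ge_1 by simp
qed

text \<open>The factors are replaced one at a time, by
  \<open>g g - w w = g (g - w) + (g - w) w\<close>. In each term the factor that is kept enters only
  through row sums of at most \<open>C * n\<close>, and \<open>cut_regular_weighted\<close> treats
  the difference.\<close>

lemma two_path_approx:
  assumes reg: "cut_regular \<kappa> \<epsilon>" and A: "A \<subseteq> V" and X: "X \<subseteq> V"
  shows "(\<Sum>v\<in>V. \<bar>(\<Sum>b\<in>X. \<Sum>a\<in>A. g (v,a) * g (a,b)) - (\<Sum>b\<in>X. \<Sum>a\<in>A. w \<kappa> (v,a) * w \<kappa> (a,b))\<bar>)
    \<le> 4 * C * \<epsilon> * n ^ 3"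
proof -
  have fX: "finite X" and fA: "finite A" using A X finV finite_subset by blast+
  let ?D = "\<lambda>x y. g (x,y) - w \<kappa> (x,y)"
  let ?I = "\<lambda>a. \<Sum>b\<in>V. ?D a b * of_bool (b \<in> X)"
  let ?h = "\<lambda>a. of_bool (a \<in> A) * (\<Sum>b\<in>X. w \<kappa> (a,b))"
  have I: "?I a = (\<Sum>b\<in>X. ?D a b)" for a
    using finV X by (intro sum.mono_neutral_cong_right) auto
  have dec: "(\<Sum>b\<in>X. \<Sum>a\<in>A. g (v,a) * g (a,b)) - (\<Sum>b\<in>X. \<Sum>a\<in>A. w \<kappa> (v,a) * w \<kappa> (a,b))
     = (\<Sum>a\<in>A. g (v,a) * ?I a) + (\<Sum>a\<in>V. ?D v a * ?h a)" for v
  proof -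
    have "(\<Sum>b\<in>X. \<Sum>a\<in>A. g (v,a) * g (a,b)) - (\<Sum>b\<in>X. \<Sum>a\<in>A. w \<kappa> (v,a) * w \<kappa> (a,b))
      = (\<Sum>b\<in>X. \<Sum>a\<in>A. g (v,a) * ?D a b + ?D v a * w \<kappa> (a,b))"
      by (simp add: sum_subtractf[symmetric] algebra_simps)
    also have "\<dots> = (\<Sum>a\<in>A. \<Sum>b\<in>X. g (v,a) * ?D a b + ?D v a * w \<kappa> (a,b))" by (rule sum.swap)
    also have "\<dots> = (\<Sum>a\<in>A. g (v,a) * ?I a) + (\<Sum>a\<in>A. ?D v a * (\<Sum>b\<in>X. w \<kappa> (a,b)))"
      by (simp only: sum.distrib sum_distrib_left I)
    also have "(\<Sum>a\<in>A. ?D v a * (\<Sum>b\<in>X. w \<kappa> (a,b))) = (\<Sum>a\<in>V. ?D v a * ?h a)"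
      using finV A by (intro sum.mono_neutral_cong_left) auto
    finally show ?thesis .
  qed
  have 1: "(\<Sum>v\<in>V. \<bar>\<Sum>a\<in>A. g (v,a) * ?I a\<bar>) \<le> 2 * C * \<epsilon> * n ^ 3"
  proof -
    have "(\<Sum>v\<in>V. \<bar>\<Sum>a\<in>A. g (v,a) * ?I a\<bar>) \<le> (\<Sum>v\<in>V. \<Sum>a\<in>V. g (v,a) * \<bar>?I a\<bar>)"
    proof (intro sum_mono)
      fix v
      have "\<bar>\<Sum>a\<in>A. g (v,a) * ?I a\<bar> \<le> (\<Sum>a\<in>A. \<bar>g (v,a) * ?I a\<bar>)" by (rule sum_abs)
      also have "\<dots> = (\<Sum>a\<in>A. g (v,a) * \<bar>?I a\<bar>)" using g_nonneg by (simp add: abs_mult)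
      also have "\<dots> \<le> (\<Sum>a\<in>V. g (v,a) * \<bar>?I a\<bar>)"
        by (intro sum_mono2 finV A) (use g_nonneg in auto)
      finally show "\<bar>\<Sum>a\<in>A. g (v,a) * ?I a\<bar> \<le> (\<Sum>a\<in>V. g (v,a) * \<bar>?I a\<bar>)" .
    qed
    also have "\<dots> = (\<Sum>a\<in>V. \<Sum>v\<in>V. g (v,a) * \<bar>?I a\<bar>)" by (rule sum.swap)
    also have "\<dots> = (\<Sum>a\<in>V. (\<Sum>v\<in>V. g (a,v)) * \<bar>?I a\<bar>)"
      by (simp add: sum_distrib_right g_sym)
    also have "\<dots> \<le> (\<Sum>a\<in>V. C * n * \<bar>?I a\<bar>)"
      by (intro sum_mono mult_right_mono sum_g_row_le) auto
    also have "\<dots> = C * n * (\<Sum>a\<in>V. \<bar>?I a\<bar>)" by (simp add: sum_distrib_left)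
    also have "\<dots> \<le> C * n * (2 * 1 * \<epsilon> * n\<^sup>2)"
      by (intro mult_left_mono cut_regular_weighted[OF reg]) (use C_ge_1 n_pos in auto)
    also have "\<dots> = 2 * C * \<epsilon> * n ^ 3" by (simp add: power2_eq_square power3_eq_cube)
    finally show ?thesis .
  qed
  have 2: "(\<Sum>v\<in>V. \<bar>\<Sum>a\<in>V. ?D v a * ?h a\<bar>) \<le> 2 * C * \<epsilon> * n ^ 3"
  proof -
    have "(\<Sum>v\<in>V. \<bar>\<Sum>a\<in>V. ?D v a * ?h a\<bar>) \<le> 2 * (C * n) * \<epsilon> * n\<^sup>2"
    proof (rule cut_regular_weighted[OF reg])
      fix y assume y: "y \<in> V"
      show "0 \<le> ?h y \<and> ?h y \<le> C * n"
        using sum_w_row_le[OF y X, of \<kappa>] w_nonneg C_ge_1 n_pos by (auto intro: sum_nonneg)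
    qed
    then show ?thesis by (simp add: power2_eq_square power3_eq_cube mult_ac)
  qed
  have "(\<Sum>v\<in>V. \<bar>(\<Sum>a\<in>A. g (v,a) * ?I a) + (\<Sum>a\<in>V. ?D v a * ?h a)\<bar>)
     \<le> (\<Sum>v\<in>V. \<bar>\<Sum>a\<in>A. g (v,a) * ?I a\<bar> + \<bar>\<Sum>a\<in>V. ?D v a * ?h a\<bar>)"
    by (intro sum_mono abs_triangle_ineq)
  also have "\<dots> \<le> 4 * C * \<epsilon> * n ^ 3" using 1 2 by (simp add: sum.distrib)
  finally show ?thesis by (simp only: dec)
qed

end

section \<open>Counting 5-cycles across three dense cells\<close>

context sparse_graph
begin

text \<open>Since \<open>c * d \<le> w \<kappa>\<close>, the main term is, up to a factor 1/d, the
  mass of \<open>w \<kappa>\<close> between two parts of the second neighbourhood of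
  \<open>v\<close>. Cut regularity exchanges it for the mass of edges of \<open>E\<close> there, and
  \<open>card_edges_second_nbrs_le\<close> allows only linearly many. The last term comes from walks
  returning to \<open>v\<close>, paid for each pair of cells.\<close>

lemma weighted_two_paths_le:
  assumes c5: "c5free E" and v: "v \<in> V" and A: "A \<subseteq> V" and B: "B \<subseteq> V"
    and reg: "cut_regular \<kappa> \<epsilon>" and lab: "\<And>x. x \<in> V \<Longrightarrow> \<kappa> x < K" and d: "0 < d"
    and c01: "\<And>j k. 0 \<le> c j k \<and> c j k \<le> 1"
    and c: "\<And>b a. b \<in> B \<Longrightarrow> a \<in> A \<Longrightarrow> c (\<kappa> b) (\<kappa> a) * d \<le> w \<kappa> (b,a)"
  shows "(\<Sum>j<K. \<Sum>k<K. c j k * ((\<Sum>b | b \<in> B \<and> \<kappa> b = j. \<Sum>a\<in>A. g (v,a) * g (a,b))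
            * (\<Sum>a | a \<in> A \<and> \<kappa> a = k. \<Sum>b\<in>B. g (v,b) * g (b,a))))
    \<le> n\<^sup>2 * ((3 * C\<^sup>2 * n * sqrt n + \<epsilon> * n\<^sup>2) / d + 3 * (real K)\<^sup>2 * C\<^sup>2 * n * sqrt n)"
proof -
  let ?N = "second_nbrs v"
  let ?P = "\<lambda>j. \<Sum>b | b \<in> B \<and> \<kappa> b = j. \<Sum>a\<in>A. g (v,a) * g (a,b)"
  let ?Q = "\<lambda>k. \<Sum>a | a \<in> A \<and> \<kappa> a = k. \<Sum>b\<in>B. g (v,b) * g (b,a)"
  let ?s = "\<lambda>j. real (card {b \<in> B \<inter> ?N. \<kappa> b = j})"
  let ?t = "\<lambda>k. real (card {a \<in> A \<inter> ?N. \<kappa> a = k})"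
  have fin: "finite (A \<inter> ?N)" "finite (B \<inter> ?N)" using A B finV finite_subset by blast+
  have s1: "?s j \<le> n" and t1: "?t j \<le> n" for j
    unfolding n_def by (auto intro!: card_mono finV simp: A[THEN subsetD] B[THEN subsetD])
  have P: "?P j \<le> n * (?s j + C * sqrt n)" for j
  proof -
    have "?P j \<le> n * (real (card ({b \<in> B. \<kappa> b = j} \<inter> ?N)) + C * sqrt n)"
      by (rule sum_two_paths_le[OF v A]) (use B in auto)
    also have "{b \<in> B. \<kappa> b = j} \<inter> ?N = {b \<in> B \<inter> ?N. \<kappa> b = j}" by auto
    finally show ?thesis .
  qed
  have Q: "?Q j \<le> n * (?t j + C * sqrt n)" for j
  proof -
    have "?Q j \<le> n * (real (card ({b \<in> A. \<kappa> b = j} \<inter> ?N)) + C * sqrt n)"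
      by (rule sum_two_paths_le[OF v B]) (use A in auto)
    also have "{b \<in> A. \<kappa> b = j} \<inter> ?N = {b \<in> A \<inter> ?N. \<kappa> b = j}" by auto
    finally show ?thesis .
  qed
  have sqn: "sqrt n * sqrt n = n" "1 \<le> sqrt n" "sqrt n \<le> n"
    using n_ge_1 real_sqrt_le_iff[of n "n\<^sup>2"] by (auto simp: power2_eq_square)
  have C2: "C \<le> C\<^sup>2" using C_ge_1 by (simp add: power2_eq_square)
  have step: "c j k * (?P j * ?Q k) \<le> n\<^sup>2 * (c j k * (?s j * ?t k) + 3 * C\<^sup>2 * n * sqrt n)" for j k
  proof -
    have "?P j * ?Q k \<le> (n * (?s j + C * sqrt n)) * (n * (?t k + C * sqrt n))"
      using n_pos C_ge_1 g_nonneg by (intro mult_mono P Q) (auto intro!: sum_nonneg)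
    also have "\<dots> = n\<^sup>2 * (?s j * ?t k + (C * sqrt n * ?s j + C * sqrt n * ?t k + C\<^sup>2 * (sqrt n * sqrt n)))"
      by (simp add: algebra_simps power2_eq_square)
    also have "\<dots> \<le> n\<^sup>2 * (?s j * ?t k + (C\<^sup>2 * sqrt n * n + C\<^sup>2 * sqrt n * n + C\<^sup>2 * (sqrt n * n)))"
      using C2 s1 t1 sqn n_pos C_ge_1 by (intro mult_left_mono add_left_mono add_mono mult_mono) auto
    also have "\<dots> = n\<^sup>2 * (?s j * ?t k + 3 * C\<^sup>2 * n * sqrt n)" by (simp add: algebra_simps)
    finally have "c j k * (?P j * ?Q k) \<le> c j k * (n\<^sup>2 * (?s j * ?t k + 3 * C\<^sup>2 * n * sqrt n))"
      using c01 by (intro mult_left_mono) auto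
    also have "\<dots> = n\<^sup>2 * (c j k * (?s j * ?t k) + c j k * (3 * C\<^sup>2 * n * sqrt n))" by (simp add: algebra_simps)
    also have "\<dots> \<le> n\<^sup>2 * (c j k * (?s j * ?t k) + 1 * (3 * C\<^sup>2 * n * sqrt n))"
      using c01 n_pos by (intro mult_left_mono add_left_mono mult_right_mono) auto
    finally show ?thesis by simp
  qed
  have st: "(\<Sum>j<K. \<Sum>k<K. c j k * (?s j * ?t k)) \<le> (3 * C\<^sup>2 * n * sqrt n + \<epsilon> * n\<^sup>2) / d"
  proof -
    have "(\<Sum>j<K. \<Sum>k<K. c j k * (?s j * ?t k))
       = (\<Sum>j<K. \<Sum>k<K. c j k * ((\<Sum>b | b \<in> B \<inter> ?N \<and> \<kappa> b = j. 1) * (\<Sum>a | a \<in> A \<inter> ?N \<and> \<kappa> a = k. 1)))"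
      by simp
    also have "\<dots> = (\<Sum>b\<in>B \<inter> ?N. \<Sum>a\<in>A \<inter> ?N. c (\<kappa> b) (\<kappa> a) * (1 * 1))"
      by (rule sum_over_label_pairs) (use fin lab A B in auto)
    also have "\<dots> = (\<Sum>b\<in>B \<inter> ?N. \<Sum>a\<in>A \<inter> ?N. c (\<kappa> b) (\<kappa> a) * d) / d"
      unfolding sum_distrib_right[symmetric] using d by simp
    also have "\<dots> \<le> (\<Sum>b\<in>B \<inter> ?N. \<Sum>a\<in>A \<inter> ?N. w \<kappa> (b,a)) / d"
      using d c by (intro divide_right_mono sum_mono) auto
    also have "\<dots> \<le> (3 * C\<^sup>2 * n * sqrt n + \<epsilon> * n\<^sup>2) / d"
    proof (intro divide_right_mono)
      have "\<bar>\<Sum>b\<in>B \<inter> ?N. \<Sum>a\<in>A \<inter> ?N. g (b,a) - w \<kappa> (b,a)\<bar> \<le> \<epsilon> * n\<^sup>2"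
        by (rule reg[unfolded cut_regular_def, rule_format]) (use A B in auto)
      then have "(\<Sum>b\<in>B \<inter> ?N. \<Sum>a\<in>A \<inter> ?N. w \<kappa> (b,a)) \<le> (\<Sum>b\<in>B \<inter> ?N. \<Sum>a\<in>A \<inter> ?N. g (b,a)) + \<epsilon> * n\<^sup>2"
        by (simp add: sum_subtractf)
      also have "(\<Sum>b\<in>B \<inter> ?N. \<Sum>a\<in>A \<inter> ?N. g (b,a)) = (\<Sum>p\<in>(B \<inter> ?N)\<times>(A \<inter> ?N). g p)"
        by (simp add: sum.cartesian_product)
      also have "\<dots> = sqrt n * real (card (((B \<inter> ?N)\<times>(A \<inter> ?N)) \<inter> E))"
        using fin by (simp add: g_def sum.If_cases)
      also have "\<dots> \<le> sqrt n * real (card (E \<inter> ?N \<times> ?N))"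
        using n_pos by (intro mult_left_mono of_nat_mono card_mono) (auto simp: finE)
      also have "\<dots> \<le> sqrt n * (3 * C\<^sup>2 * n)"
        using n_pos by (intro mult_left_mono card_edges_second_nbrs_le c5 v) auto
      finally show "(\<Sum>b\<in>B \<inter> ?N. \<Sum>a\<in>A \<inter> ?N. w \<kappa> (b,a)) \<le> 3 * C\<^sup>2 * n * sqrt n + \<epsilon> * n\<^sup>2"
        by (simp add: mult_ac)
    qed (use d in auto)
    finally show ?thesis .
  qed
  have "(\<Sum>j<K. \<Sum>k<K. c j k * (?P j * ?Q k)) \<le> (\<Sum>j<K. \<Sum>k<K. n\<^sup>2 * (c j k * (?s j * ?t k) + 3 * C\<^sup>2 * n * sqrt n))"
    by (intro sum_mono step)
  also have "\<dots> = n\<^sup>2 * ((\<Sum>j<K. \<Sum>k<K. c j k * (?s j * ?t k)) + 3 * (real K)\<^sup>2 * C\<^sup>2 * n * sqrt n)"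
    by (simp add: sum_distrib_left[symmetric] sum.distrib power2_eq_square mult_ac)
  also have "\<dots> \<le> n\<^sup>2 * ((3 * C\<^sup>2 * n * sqrt n + \<epsilon> * n\<^sup>2) / d + 3 * (real K)\<^sup>2 * C\<^sup>2 * n * sqrt n)"
    by (intro mult_left_mono add_right_mono st) auto
  finally show ?thesis .
qed

text \<open>Stated for a general \<open>f\<close> because it is needed for \<open>g\<close> and for
  \<open>w \<kappa>2\<close>, which satisfy the same row bound.\<close>

lemma sum_two_paths_le_crude:
  assumes f: "\<And>x X. x \<in> V \<Longrightarrow> X \<subseteq> V \<Longrightarrow> (\<Sum>y\<in>X. f (x,y)) \<le> C * n" and nn: "\<And>p. 0 \<le> f p"
    and v: "v \<in> V" and A: "A \<subseteq> V" and X: "X \<subseteq> V"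
  shows "(\<Sum>b\<in>X. \<Sum>a\<in>A. f (v,a) * f (a,b)) \<le> C\<^sup>2 * n\<^sup>2"
proof -
  have "(\<Sum>b\<in>X. \<Sum>a\<in>A. f (v,a) * f (a,b)) = (\<Sum>a\<in>A. f (v,a) * (\<Sum>b\<in>X. f (a,b)))"
    by (subst sum.swap) (simp add: sum_distrib_left)
  also have "\<dots> \<le> (\<Sum>a\<in>A. f (v,a) * (C * n))"
    using A X nn by (intro sum_mono mult_left_mono f) auto
  also have "\<dots> = (\<Sum>a\<in>A. f (v,a)) * (C * n)" by (simp add: sum_distrib_right)
  also have "\<dots> \<le> (C * n) * (C * n)" using C_ge_1 n_pos by (intro mult_right_mono f v A) auto
  finally show ?thesis by (simp add: power2_eq_square mult_ac)
qed

text \<open>One weighted count of closed walks \<open>v, a, b', a', b\<close> is evaluated with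
  2-paths from \<open>w \<kappa>2\<close> and with 2-paths from \<open>g\<close>. The first value
  has order n^5 because almost all pairs are dense, the second is small without 5-cycles. The middle
  pair is judged by \<open>\<kappa>1\<close> in both, and the comparison is paid for every pair of
  labels of \<open>\<kappa>1\<close>, whence \<open>(real K)\<^sup>2\<close> beside
  \<open>\<epsilon>2\<close>. Five tolerances of 1/25 leave the factor 4/5.\<close>

lemma dense_triple_bound:
  assumes c5: "c5free E" and A: "A \<subseteq> V" and B: "B \<subseteq> V" and D: "D \<subseteq> V"
    and lab: "\<And>x. x \<in> V \<Longrightarrow> \<kappa>1 x < K"
    and reg1: "cut_regular \<kappa>1 \<epsilon>1" and reg2: "cut_regular \<kappa>2 \<epsilon>2" and d: "0 < d"
    and \<theta>: "0 < \<theta>" "\<theta> * n \<le> card A" "\<theta> * n \<le> card B" "\<theta> * n \<le> card D"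
    and b1: "real (card {(v,a) \<in> D \<times> A. w \<kappa>2 (v,a) < d}) \<le> 1/25 * real (card D) * real (card A)"
    and b2: "real (card {(a,b) \<in> A \<times> B. w \<kappa>2 (a,b) < d}) \<le> 1/25 * real (card A) * real (card B)"
    and b3: "real (card {(b,a) \<in> B \<times> A. w \<kappa>1 (b,a) < d}) \<le> 1/25 * real (card A) * real (card B)"
    and b4: "real (card {(b,a) \<in> B \<times> A. w \<kappa>2 (b,a) < d}) \<le> 1/25 * real (card A) * real (card B)"
    and b5: "real (card {(v,b) \<in> D \<times> B. w \<kappa>2 (v,b) < d}) \<le> 1/25 * real (card D) * real (card B)"
  shows "d ^ 4 * (4/5) * \<theta> ^ 5 \<le> (3 * C\<^sup>2 / sqrt n + \<epsilon>1) / d + 3 * (real K)\<^sup>2 * C\<^sup>2 / sqrt n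
    + 8 * (real K)\<^sup>2 * C ^ 3 * \<epsilon>2"
proof -
  have fin: "finite A" "finite B" "finite D" using A B D finV finite_subset by blast+
  \<comment> \<open>The indicator of the pairs of labels that are dense at level \<open>d\<close>;
    as \<open>w \<kappa>1\<close> is constant on blocks, any representatives decide it.\<close>
  define c :: "nat \<Rightarrow> nat \<Rightarrow> real" where
    "c j k = of_bool (\<exists>b\<in>B. \<exists>a\<in>A. \<kappa>1 b = j \<and> \<kappa>1 a = k \<and> d \<le> w \<kappa>1 (b,a))" for j k
  have c_eq: "c (\<kappa>1 b) (\<kappa>1 a) = of_bool (d \<le> w \<kappa>1 (b,a))" if "b \<in> B" "a \<in> A" for a b
  proof -
    have "(\<exists>b'\<in>B. \<exists>a'\<in>A. \<kappa>1 b' = \<kappa>1 b \<and> \<kappa>1 a' = \<kappa>1 a \<and> d \<le> w \<kappa>1 (b',a')) \<longleftrightarrow> d \<le> w \<kappa>1 (b,a)"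
      using that w_cong[of \<kappa>1] by metis
    then show ?thesis by (simp add: c_def)
  qed
  have c01: "0 \<le> c j k \<and> c j k \<le> 1" for j k by (simp add: c_def)
  define P where "P f v j = (\<Sum>b | b \<in> B \<and> \<kappa>1 b = j. \<Sum>a\<in>A. f (v,a) * f (a,b))" for f :: "'a \<times> 'a \<Rightarrow> real" and v j
  define Q where "Q f v k = (\<Sum>a | a \<in> A \<and> \<kappa>1 a = k. \<Sum>b\<in>B. f (v,b) * f (b,a))" for f :: "'a \<times> 'a \<Rightarrow> real" and v k
  let ?g = g and ?w = "w \<kappa>2"
  have subs: "{b. b \<in> B \<and> \<kappa>1 b = j} \<subseteq> V" "{a. a \<in> A \<and> \<kappa>1 a = j} \<subseteq> V" for j using A B by auto
  have nnP: "0 \<le> P g v j" "0 \<le> Q ?w v j" for v j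
    unfolding P_def Q_def by (auto intro!: sum_nonneg mult_nonneg_nonneg g_nonneg w_nonneg)
  have bP: "P g v j \<le> C\<^sup>2 * n\<^sup>2" and bQ: "Q ?w v j \<le> C\<^sup>2 * n\<^sup>2" if "v \<in> V" for v j
    unfolding P_def Q_def using that A B subs
    by (auto intro!: sum_two_paths_le_crude sum_g_row_le sum_w_row_le g_nonneg w_nonneg)
  have eP: "(\<Sum>v\<in>V. \<bar>P g v j - P ?w v j\<bar>) \<le> 4 * C * \<epsilon>2 * n ^ 3" for j
    unfolding P_def by (rule two_path_approx[OF reg2 A subs(1)])
  have eQ: "(\<Sum>v\<in>V. \<bar>Q g v j - Q ?w v j\<bar>) \<le> 4 * C * \<epsilon>2 * n ^ 3" for j
    unfolding Q_def by (rule two_path_approx[OF reg2 B subs(2)])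
  let ?L = "\<lambda>f. \<Sum>v\<in>D. \<Sum>j<K. \<Sum>k<K. c j k * (P f v j * Q f v k)"
  have lower: "d ^ 4 * (4/5) * \<theta> ^ 5 * n ^ 5 \<le> ?L ?w"
  proof -
    have b3': "real (card {(b,a) \<in> B \<times> A. c (\<kappa>1 b) (\<kappa>1 a) < 1}) \<le> 1/25 * real (card A) * real (card B)"
    proof -
      have "{(b,a) \<in> B \<times> A. c (\<kappa>1 b) (\<kappa>1 a) < 1} = {(b,a) \<in> B \<times> A. w \<kappa>1 (b,a) < d}"
        using c_eq by auto
      then show ?thesis using b3 by simp
    qed
    have "d ^ 4 * (1 - 5 * (1/25)) * (real (card D) * (real (card A))\<^sup>2 * (real (card B))\<^sup>2)
      \<le> (\<Sum>v\<in>D. \<Sum>b'\<in>B. \<Sum>a'\<in>A. c (\<kappa>1 b') (\<kappa>1 a')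
            * ((\<Sum>a\<in>A. ?w (v,a) * ?w (a,b')) * (\<Sum>b\<in>B. ?w (v,b) * ?w (b,a'))))"
      by (rule sum_five_lower_bound[where ?f1.0 = "\<lambda>x y. ?w (x,y)" and ?f2.0 = "\<lambda>x y. ?w (x,y)"
            and ?f3.0 = "\<lambda>x y. c (\<kappa>1 x) (\<kappa>1 y)" and ?f4.0 = "\<lambda>x y. ?w (x,y)" and ?f5.0 = "\<lambda>x y. ?w (x,y)"])
        (rule fin b1 b2 b3' b4 b5 less_imp_le[OF d] w_nonneg conjunct1[OF c01])+
    also have "\<dots> = ?L ?w"
      unfolding P_def Q_def
      by (intro sum.cong refl sum_over_label_pairs[symmetric]) (use fin A B lab in auto)
    finally have h1: "d ^ 4 * (4/5) * (real (card D) * (real (card A))\<^sup>2 * (real (card B))\<^sup>2) \<le> ?L ?w" by simp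
    have "(\<theta> * n) * (\<theta> * n)\<^sup>2 * (\<theta> * n)\<^sup>2 \<le> real (card D) * (real (card A))\<^sup>2 * (real (card B))\<^sup>2"
      using \<theta> n_pos by (intro mult_mono power_mono) auto
    then have h2: "d ^ 4 * (4/5) * ((\<theta> * n) * (\<theta> * n)\<^sup>2 * (\<theta> * n)\<^sup>2)
      \<le> d ^ 4 * (4/5) * (real (card D) * (real (card A))\<^sup>2 * (real (card B))\<^sup>2)"
      by (rule mult_left_mono) (use d in simp)
    have h3: "(\<theta> * n) * (\<theta> * n)\<^sup>2 * (\<theta> * n)\<^sup>2 = \<theta> ^ 5 * n ^ 5"
      by (simp add: power2_eq_square eval_nat_numeral)
    have "d ^ 4 * (4/5) * (\<theta> ^ 5 * n ^ 5) \<le> ?L ?w"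
      using order_trans[OF h2 h1] unfolding h3 .
    then show ?thesis by (simp add: mult_ac)
  qed
  let ?U = "n\<^sup>2 * ((3 * C\<^sup>2 * n * sqrt n + \<epsilon>1 * n\<^sup>2) / d + 3 * (real K)\<^sup>2 * C\<^sup>2 * n * sqrt n)"
  have upper: "?L g \<le> n * ?U"
  proof -
    have "?L g \<le> (\<Sum>v\<in>V. \<Sum>j<K. \<Sum>k<K. c j k * (P g v j * Q g v k))"
      using c01 g_nonneg unfolding P_def Q_def
      by (intro sum_mono2 finV D) (auto intro!: sum_nonneg mult_nonneg_nonneg)
    also have "\<dots> \<le> (\<Sum>v\<in>V. ?U)"
    proof (intro sum_mono)
      fix v assume v: "v \<in> V"
      show "(\<Sum>j<K. \<Sum>k<K. c j k * (P g v j * Q g v k)) \<le> ?U"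
        unfolding P_def Q_def
        by (rule weighted_two_paths_le[OF c5 v A B reg1 lab d c01])
          (use c_eq d w_nonneg in \<open>auto simp: of_bool_def\<close>)
    qed
    also have "\<dots> = n * ?U" by (simp add: n_def)
    finally show ?thesis .
  qed
  have diff: "?L ?w - ?L g \<le> 8 * (real K)\<^sup>2 * C ^ 3 * \<epsilon>2 * n ^ 5"
  proof -
    \<comment> \<open>One of the two 2-path counts is exchanged at a time, while the other is at
      most \<open>C\<^sup>2 * n\<^sup>2\<close>.\<close>
    have "?L ?w - ?L g = (\<Sum>v\<in>D. \<Sum>j<K. \<Sum>k<K. c j k * (P ?w v j * Q ?w v k - P g v j * Q g v k))"
      by (simp only: sum_subtractf right_diff_distrib)
    also have "\<dots> \<le> (\<Sum>v\<in>D. \<Sum>j<K. \<Sum>k<K. C\<^sup>2 * n\<^sup>2 * \<bar>P g v j - P ?w v j\<bar> + C\<^sup>2 * n\<^sup>2 * \<bar>Q g v k - Q ?w v k\<bar>)"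
    proof (intro sum_mono)
      fix v j k assume v: "v \<in> D"
      have vV: "v \<in> V" using v D by auto
      have "c j k * (P ?w v j * Q ?w v k - P g v j * Q g v k) \<le> 1 * \<bar>P ?w v j * Q ?w v k - P g v j * Q g v k\<bar>"
        using c01[of j k]
        by (intro order_trans[OF mult_left_mono[OF abs_ge_self] mult_right_mono]) auto
      also have "\<dots> = \<bar>(P ?w v j - P g v j) * Q ?w v k + P g v j * (Q ?w v k - Q g v k)\<bar>"
        by (simp add: algebra_simps)
      also have "\<dots> \<le> \<bar>P ?w v j - P g v j\<bar> * Q ?w v k + P g v j * \<bar>Q ?w v k - Q g v k\<bar>"
        using nnP by (intro order_trans[OF abs_triangle_ineq]) (simp add: abs_mult)
      also have "\<dots> \<le> \<bar>P ?w v j - P g v j\<bar> * (C\<^sup>2 * n\<^sup>2) + (C\<^sup>2 * n\<^sup>2) * \<bar>Q ?w v k - Q g v k\<bar>"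
        by (intro add_mono mult_left_mono mult_right_mono bP bQ vV) auto
      finally show "c j k * (P ?w v j * Q ?w v k - P g v j * Q g v k)
        \<le> C\<^sup>2 * n\<^sup>2 * \<bar>P g v j - P ?w v j\<bar> + C\<^sup>2 * n\<^sup>2 * \<bar>Q g v k - Q ?w v k\<bar>"
        by (simp add: abs_minus_commute mult_ac)
    qed
    also have "\<dots> \<le> (\<Sum>v\<in>V. \<Sum>j<K. \<Sum>k<K. C\<^sup>2 * n\<^sup>2 * \<bar>P g v j - P ?w v j\<bar> + C\<^sup>2 * n\<^sup>2 * \<bar>Q g v k - Q ?w v k\<bar>)"
      by (intro sum_mono2 finV D) (auto intro!: sum_nonneg)
    also have "\<dots> = (\<Sum>j<K. \<Sum>v\<in>V. \<Sum>k<K. C\<^sup>2 * n\<^sup>2 * \<bar>P g v j - P ?w v j\<bar> + C\<^sup>2 * n\<^sup>2 * \<bar>Q g v k - Q ?w v k\<bar>)"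
      by (rule sum.swap)
    also have "\<dots> = (\<Sum>j<K. \<Sum>k<K. \<Sum>v\<in>V. C\<^sup>2 * n\<^sup>2 * \<bar>P g v j - P ?w v j\<bar> + C\<^sup>2 * n\<^sup>2 * \<bar>Q g v k - Q ?w v k\<bar>)"
      by (intro sum.cong refl sum.swap)
    also have "\<dots> = (\<Sum>j<K. \<Sum>k<K. C\<^sup>2 * n\<^sup>2 * (\<Sum>v\<in>V. \<bar>P g v j - P ?w v j\<bar>) + C\<^sup>2 * n\<^sup>2 * (\<Sum>v\<in>V. \<bar>Q g v k - Q ?w v k\<bar>))"
      by (simp only: sum.distrib sum_distrib_left)
    also have "\<dots> \<le> (\<Sum>j<K. \<Sum>k<K. C\<^sup>2 * n\<^sup>2 * (4 * C * \<epsilon>2 * n ^ 3) + C\<^sup>2 * n\<^sup>2 * (4 * C * \<epsilon>2 * n ^ 3))"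
      by (intro sum_mono add_mono mult_left_mono eP eQ) auto
    also have "\<dots> = 8 * (real K)\<^sup>2 * C ^ 3 * \<epsilon>2 * n ^ 5"
      by (simp add: power2_eq_square eval_nat_numeral)
    finally show ?thesis .
  qed
  have "d ^ 4 * (4/5) * \<theta> ^ 5 * n ^ 5 \<le> n * ?U + 8 * (real K)\<^sup>2 * C ^ 3 * \<epsilon>2 * n ^ 5"
    using lower upper diff by linarith
  also have "\<dots> = ((3 * C\<^sup>2 / sqrt n + \<epsilon>1) / d + 3 * (real K)\<^sup>2 * C\<^sup>2 / sqrt n
    + 8 * (real K)\<^sup>2 * C ^ 3 * \<epsilon>2) * n ^ 5"
  proof -
    define s where "s = sqrt n"
    have s: "n = s * s" "s > 0" using n_pos by (auto simp: s_def)
    show ?thesis unfolding s_def[symmetric] unfolding s(1)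
      using s(2) d by (simp add: field_simps power2_eq_square eval_nat_numeral)
  qed
  finally show ?thesis using n_pos by simp
qed

end

section \<open>Triangles in graphs without 4-cycles and 5-cycles\<close>

text \<open>Triangles are kept as vertex sets. Edge-disjointness is not demanded because it is
  automatic in a graph without 4-cycles.\<close>

definition triangle_family :: "('a \<times> 'a) set \<Rightarrow> 'a set set \<Rightarrow> bool" where
  "triangle_family E T \<longleftrightarrow> finite T \<and>
     (\<forall>t\<in>T. \<exists>x y z. t = {x,y,z} \<and> (x,y) \<in> E \<and> (y,z) \<in> E \<and> (x,z) \<in> E)"

text \<open>The third vertices of both triangles are common neighbours of \<open>u\<close> and
  \<open>v\<close>, hence equal.\<close>

lemma triangle_of_edge_unique:
  assumes gr: "graph_on V E" and c4: "c4free E"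
    and t: "t = {x,y,z}" "(x,y) \<in> E" "(y,z) \<in> E" "(x,z) \<in> E"
    and t': "t' = {x',y',z'}" "(x',y') \<in> E" "(y',z') \<in> E" "(x',z') \<in> E"
    and u: "u \<in> t" "u \<in> t'" "v \<in> t" "v \<in> t'" "u \<noteq> v"
  shows "t = t'"
proof -
  note sy = graph_onD(3)[OF gr]
  have third: "\<exists>z. s = {u,v,z} \<and> (u,z) \<in> E \<and> (v,z) \<in> E"
    if "s = {x,y,z}" "(x,y) \<in> E" "(y,z) \<in> E" "(x,z) \<in> E" "u \<in> s" "v \<in> s" for s x y z
  proof -
    from that \<open>u \<noteq> v\<close> consider "u = x" "v = y" | "u = y" "v = x" | "u = x" "v = z" | "u = z" "v = x"
      | "u = y" "v = z" | "u = z" "v = y" by auto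
    then show ?thesis
    proof cases
      case 1 then show ?thesis using that sy by (intro exI[of _ z]) auto
    next case 2 then show ?thesis using that sy by (intro exI[of _ z]) auto
    next case 3 then show ?thesis using that sy by (intro exI[of _ y]) auto
    next case 4 then show ?thesis using that sy by (intro exI[of _ y]) auto
    next case 5 then show ?thesis using that sy by (intro exI[of _ x]) auto
    next case 6 then show ?thesis using that sy by (intro exI[of _ x]) auto
    qed
  qed
  obtain p where p: "t = {u,v,p}" "(u,p) \<in> E" "(v,p) \<in> E" using third[OF t u(1,3)] by blast
  obtain q where q: "t' = {u,v,q}" "(u,q) \<in> E" "(v,q) \<in> E" using third[OF t' u(2,4)] by blast
  have "p = q" using c4freeD[OF c4 p(2,3) q(2,3)] u(5) by simp
  then show ?thesis using p q by simp
qed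

text \<open>An edge lies in at most one triangle, so choosing for each triangle an edge of
  \<open>F\<close> inside it is injective. Used contrapositively, it says that deleting fewer edges
  than there are triangles leaves a triangle untouched.\<close>

lemma card_triangles_le_hit:
  assumes gr: "graph_on V E" and c4: "c4free E" and T: "triangle_family E T"
    and fin: "finite F" and FE: "F \<subseteq> E"
    and hit: "\<And>t. t \<in> T \<Longrightarrow> \<exists>p\<in>F. fst p \<in> t \<and> snd p \<in> t"
  shows "card T \<le> card F"
proof -
  from hit obtain f where f: "\<And>t. t \<in> T \<Longrightarrow> f t \<in> F \<and> fst (f t) \<in> t \<and> snd (f t) \<in> t" by metis
  have "inj_on f T"
  proof (rule inj_onI)
    fix t t' assume tt: "t \<in> T" "t' \<in> T" and eq: "f t = f t'"
    obtain x y z where t: "t = {x,y,z}" "(x,y) \<in> E" "(y,z) \<in> E" "(x,z) \<in> E"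
      using T tt(1) unfolding triangle_family_def by blast
    obtain x' y' z' where t': "t' = {x',y',z'}" "(x',y') \<in> E" "(y',z') \<in> E" "(x',z') \<in> E"
      using T tt(2) unfolding triangle_family_def by blast
    have "f t \<in> E" using f[OF tt(1)] FE by auto
    then have ne: "fst (f t) \<noteq> snd (f t)" using graph_onD(4)[OF gr] by (metis prod.collapse)
    show "t = t'"
      by (rule triangle_of_edge_unique[OF gr c4 t t', of "fst (f t)" "snd (f t)"])
        (use f[OF tt(1)] f[OF tt(2)] eq ne in auto)
  qed
  then show ?thesis by (rule card_inj_on_le) (use f fin in auto)
qed

section \<open>Edges to be discarded, and the surviving triangle\<close>

context sparse_graph
begin

lemma card_edges_measurable:
  assumes "\<And>x y x' y'. x \<in> V \<Longrightarrow> y \<in> V \<Longrightarrow> x' \<in> V \<Longrightarrow> y' \<in> V \<Longrightarrow> \<kappa> x = \<kappa> x' \<Longrightarrow> \<kappa> y = \<kappa> y'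
    \<Longrightarrow> Pr (x,y) = Pr (x',y')"
  shows "sqrt n * real (card {p \<in> E. Pr p}) = (\<Sum>p\<in>V\<times>V. w \<kappa> p * of_bool (Pr p))"
proof -
  have E: "E \<subseteq> V \<times> V" using gr by (simp add: graph_on_def)
  have "(\<Sum>p\<in>V\<times>V. w \<kappa> p * of_bool (Pr p)) = (\<Sum>p\<in>V\<times>V. g p * of_bool (Pr p))"
    by (rule sum_w_mult) (rule arg_cong[where f=of_bool], rule assms)
  also have "\<dots> = (\<Sum>p\<in>{p\<in>E. Pr p}. sqrt n)"
    using finV E by (intro sum.mono_neutral_cong_right) (auto simp: g_def)
  finally show ?thesis by simp
qed

text \<open>The variance of \<open>w \<kappa>'\<close> on the block of \<open>p\<close> is large
  against its squared density. The constant is 1/4 times 1/25: an entry below half the density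
  contributes a quarter of the squared density, and a 1/25 fraction of such entries is
  tolerated.\<close>

definition "irregular \<kappa> \<kappa>' p \<longleftrightarrow>
  (w \<kappa> p)\<^sup>2 / 100 < cavg (V\<times>V) (map_prod \<kappa> \<kappa>) (\<lambda>q. (w \<kappa>' q - w \<kappa> q)\<^sup>2) p"

text \<open>Markov's inequality: on the blocks counted here \<delta> times the density is at most
  its square, hence below 100 times the block variance, and the variances sum to the energy gain
  times n^2.\<close>

lemma card_irregular_le:
  assumes ref: "\<And>x y. x \<in> V \<Longrightarrow> y \<in> V \<Longrightarrow> \<kappa>' x = \<kappa>' y \<Longrightarrow> \<kappa> x = \<kappa> y"
    and en: "energy \<kappa>' \<le> energy \<kappa> + \<eta>" and \<delta>: "0 < \<delta>"
  shows "real (card {p \<in> E. \<delta> \<le> w \<kappa> p \<and> irregular \<kappa> \<kappa>' p}) \<le> 100 * \<eta> / \<delta> * n * sqrt n"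
proof -
  let ?h = "\<lambda>q. (w \<kappa>' q - w \<kappa> q)\<^sup>2"
  let ?a = "cavg (V\<times>V) (map_prod \<kappa> \<kappa>) ?h"
  let ?Pr = "\<lambda>p. \<delta> \<le> w \<kappa> p \<and> irregular \<kappa> \<kappa>' p"
  have "sqrt n * real (card {p \<in> E. ?Pr p}) = (\<Sum>p\<in>V\<times>V. w \<kappa> p * of_bool (?Pr p))"
  proof (rule card_edges_measurable)
    fix x y x' y' assume "\<kappa> x = \<kappa> x'" "\<kappa> y = \<kappa> y'"
    then have "w \<kappa> (x,y) = w \<kappa> (x',y')" "?a (x,y) = ?a (x',y')"
      by (auto intro!: w_cong cavg_cong)
    then show "?Pr (x,y) = ?Pr (x',y')" by (simp add: irregular_def)
  qed
  also have "\<dots> \<le> (\<Sum>p\<in>V\<times>V. 100 / \<delta> * ?a p)"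
  proof (intro sum_mono)
    fix p
    have a0: "0 \<le> ?a p" by (rule cavg_nonneg) auto
    show "w \<kappa> p * of_bool (?Pr p) \<le> 100 / \<delta> * ?a p"
    proof (cases "?Pr p")
      case True
      then have "w \<kappa> p * \<delta> \<le> w \<kappa> p * w \<kappa> p"
        by (intro mult_left_mono w_nonneg) auto
      also have "\<dots> \<le> 100 * ?a p" using True by (simp add: irregular_def power2_eq_square)
      finally show ?thesis using True \<delta> by (simp add: field_simps)
    next
      case False
      then have "w \<kappa> p * of_bool (?Pr p) = 0" by (simp only: of_bool_eq mult_zero_right)
      then show ?thesis using a0 \<delta> by (simp only:) simp
    qed
  qed
  also have "\<dots> = 100 / \<delta> * (\<Sum>p\<in>V\<times>V. ?a p)" by (simp add: sum_distrib_left)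
  also have "(\<Sum>p\<in>V\<times>V. ?a p) = (\<Sum>p\<in>V\<times>V. ?h p)"
    using sum_cavg_mult[of "V\<times>V" "map_prod \<kappa> \<kappa>" "\<lambda>_. 1" ?h] finV by simp
  also have "\<dots> \<le> \<eta> * n\<^sup>2"
  proof -
    have "energy \<kappa>' = energy \<kappa> + (\<Sum>p\<in>V\<times>V. ?h p) / n\<^sup>2"
      by (rule energy_refine) (rule ref)
    with en show ?thesis using n_pos by (simp add: divide_le_eq)
  qed
  finally have "sqrt n * real (card {p \<in> E. ?Pr p}) \<le> 100 / \<delta> * (\<eta> * n\<^sup>2)"
    using \<delta> by (simp add: divide_right_mono)
  also have "\<dots> = sqrt n * (100 * \<eta> / \<delta> * n * sqrt n)"
    using n_pos by (simp add: power2_eq_square mult_ac)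
  finally show ?thesis by (rule mult_left_le_imp_le) (use n_pos in simp)
qed

text \<open>Chebyshev's inequality on one regular block: an entry below \<open>d\<close> misses the
  block density by at least half of that density.\<close>

lemma few_small_entries:
  assumes xy: "x \<in> V" "y \<in> V" and d: "0 < d" "2 * d \<le> w \<kappa> (x,y)" and reg: "\<not> irregular \<kappa> \<kappa>' (x,y)"
    and A: "A = {z \<in> V. \<kappa> z = \<kappa> x}" and B: "B = {z \<in> V. \<kappa> z = \<kappa> y}"
  shows "real (card {(a,b) \<in> A \<times> B. w \<kappa>' (a,b) < d}) \<le> 1/25 * real (card A) * real (card B)"
proof -
  let ?h = "\<lambda>q. (w \<kappa>' q - w \<kappa> q)\<^sup>2"
  let ?w = "w \<kappa> (x,y)"
  let ?S = "{(a,b) \<in> A \<times> B. w \<kappa>' (a,b) < d}"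
  have fin: "finite A" "finite B" using finV by (auto simp: A B)
  have blk: "{q \<in> V \<times> V. map_prod \<kappa> \<kappa> q = map_prod \<kappa> \<kappa> (x,y)} = A \<times> B"
    by (auto simp: A B)
  have pos: "card (A \<times> B) > 0" using fin xy by (auto simp: card_gt_0_iff A B)
  have "(\<Sum>q\<in>A\<times>B. ?h q) / real (card (A\<times>B)) \<le> ?w\<^sup>2 / 100"
    using reg unfolding irregular_def cavg_def blk by (simp add: not_less)
  then have "(\<Sum>q\<in>A\<times>B. ?h q) \<le> ?w\<^sup>2 / 100 * real (card (A\<times>B))"
    using pos by (simp add: pos_divide_le_eq)
  moreover have "real (card ?S) * (?w\<^sup>2 / 4) \<le> (\<Sum>q\<in>A\<times>B. ?h q)"
  proof -
    have "real (card ?S) * (?w\<^sup>2 / 4) = (\<Sum>q\<in>?S. ?w\<^sup>2 / 4)" by simp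
    also have "\<dots> \<le> (\<Sum>q\<in>?S. ?h q)"
    proof (intro sum_mono)
      fix q assume q: "q \<in> ?S"
      then have "w \<kappa> q = ?w" by (auto simp: A B intro!: w_cong)
      moreover have "w \<kappa>' q < d" using q by auto
      ultimately have "?w / 2 \<le> w \<kappa> q - w \<kappa>' q" using d by simp
      then have "(?w / 2)\<^sup>2 \<le> (w \<kappa> q - w \<kappa>' q)\<^sup>2" using w_nonneg by (intro power_mono) auto
      then show "?w\<^sup>2 / 4 \<le> ?h q" by (simp add: power_divide power2_commute)
    qed
    also have "\<dots> \<le> (\<Sum>q\<in>A\<times>B. ?h q)" using fin by (intro sum_mono2) auto
    finally show ?thesis .
  qed
  ultimately have "real (card ?S) * (?w\<^sup>2 / 4) \<le> ?w\<^sup>2 / 100 * real (card (A\<times>B))" by linarith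
  then have "real (card ?S) * (?w\<^sup>2 / 4) \<le> (1/25 * real (card A) * real (card B)) * (?w\<^sup>2 / 4)"
    by (simp add: card_cartesian_product mult_ac)
  moreover have "?w\<^sup>2 / 4 > 0" using d by auto
  ultimately show ?thesis by (rule mult_right_le_imp_le)
qed

text \<open>At most \<open>K\<close> cells are tiny, so together they have at most
  \<open>K * \<theta> * n\<close> vertices, each of bounded degree.\<close>

lemma card_tiny_cell_edges_le:
  assumes lab: "\<And>x. x \<in> V \<Longrightarrow> \<kappa> x < (K::nat)" and \<theta>: "0 \<le> \<theta>"
  shows "real (card {p \<in> E. real (card {z \<in> V. \<kappa> z = \<kappa> (fst p)}) < \<theta> * n}) \<le> real K * \<theta> * C * n * sqrt n"
proof -
  let ?X = "{x \<in> V. real (card {z \<in> V. \<kappa> z = \<kappa> x}) < \<theta> * n}"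
  have "real (card ?X) = (\<Sum>j<K. \<Sum>x | x \<in> ?X \<and> \<kappa> x = j. 1)"
    by (subst sum_over_labels) (use finV lab in auto)
  also have "\<dots> \<le> (\<Sum>j<K. \<theta> * n)"
  proof (intro sum_mono)
    fix j
    show "(\<Sum>x | x \<in> ?X \<and> \<kappa> x = j. 1) \<le> \<theta> * n"
    proof (cases "{x. x \<in> ?X \<and> \<kappa> x = j} = {}")
      case True
      then have "(\<Sum>x | x \<in> ?X \<and> \<kappa> x = j. 1) = (0::real)" by (simp only: sum.empty)
      then show ?thesis using \<theta> n_pos by simp
    next
      case False
      then obtain x where x: "x \<in> ?X" "\<kappa> x = j" by blast
      have "card {x. x \<in> ?X \<and> \<kappa> x = j} \<le> card {z \<in> V. \<kappa> z = \<kappa> x}"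
        by (rule card_mono) (use finV x in auto)
      then show ?thesis using x by simp
    qed
  qed
  finally have X: "real (card ?X) \<le> real K * (\<theta> * n)" by simp
  have sub: "{p \<in> E. real (card {z \<in> V. \<kappa> z = \<kappa> (fst p)}) < \<theta> * n} \<subseteq> Sigma ?X (\<lambda>x. E `` {x})"
    using graph_onD[OF gr] by auto
  have "card {p \<in> E. real (card {z \<in> V. \<kappa> z = \<kappa> (fst p)}) < \<theta> * n} \<le> card (Sigma ?X (\<lambda>x. E `` {x}))"
    by (rule card_mono[OF _ sub]) (use finV fin_nbrs in auto)
  also have "\<dots> = (\<Sum>x\<in>?X. card (E `` {x}))"
    by (rule card_SigmaI) (use finV fin_nbrs in auto)
  finally have "real (card {p \<in> E. real (card {z \<in> V. \<kappa> z = \<kappa> (fst p)}) < \<theta> * n}) \<le> (\<Sum>x\<in>?X. real (card (E `` {x})))"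
    using of_nat_mono by fastforce
  also have "\<dots> \<le> (\<Sum>x\<in>?X. C * sqrt n)" by (intro sum_mono deg_le_n) auto
  also have "\<dots> = real (card ?X) * (C * sqrt n)" by simp
  also have "\<dots> \<le> real K * (\<theta> * n) * (C * sqrt n)"
    using X C_ge_1 n_pos by (intro mult_right_mono) auto
  finally show ?thesis by (simp add: mult_ac)
qed

text \<open>If the energy hardly changed, the light edges, the edges from tiny cells and the
  irregular edges would be fewer than the triangles. A triangle avoiding them singles out three
  large cells whose pairs are dense for \<open>\<kappa>1\<close> and \<open>\<kappa>2\<close> alike,
  and \<open>num\<close> contradicts \<open>dense_triple_bound\<close>.\<close>

lemma energy_step:
  assumes c5: "c5free E" and T: "triangle_family E T" and cT: "c * n * sqrt n \<le> card T" and c: "0 < c"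
    and K: "0 < K"
    and lab: "\<And>x. x \<in> V \<Longrightarrow> \<kappa> x < (K::nat)" and lab1: "\<And>x. x \<in> V \<Longrightarrow> \<kappa>1 x < (K1::nat)"
    and ref1: "\<And>x y. x \<in> V \<Longrightarrow> y \<in> V \<Longrightarrow> \<kappa>1 x = \<kappa>1 y \<Longrightarrow> \<kappa> x = \<kappa> y"
    and ref2: "\<And>x y. x \<in> V \<Longrightarrow> y \<in> V \<Longrightarrow> \<kappa>2 x = \<kappa>2 y \<Longrightarrow> \<kappa>1 x = \<kappa>1 y"
    and reg1: "cut_regular \<kappa>1 \<epsilon>1" and reg2: "cut_regular \<kappa>2 \<epsilon>2"
    and num: "(3 * C\<^sup>2 / sqrt n + \<epsilon>1) / (c/8) + 3 * (real K1)\<^sup>2 * C\<^sup>2 / sqrt n + 8 * (real K1)\<^sup>2 * C ^ 3 * \<epsilon>2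
       < (c/8) ^ 4 * (4/5) * (c / (4 * C * real K)) ^ 5"
  shows "energy \<kappa>2 > energy \<kappa> + c\<^sup>2 / 3200"
proof (rule ccontr)
  assume "\<not> ?thesis"
  then have en2: "energy \<kappa>2 \<le> energy \<kappa> + c\<^sup>2 / 3200" by simp
  have "energy \<kappa>2 = energy \<kappa>1 + (\<Sum>p\<in>V\<times>V. (w \<kappa>2 p - w \<kappa>1 p)\<^sup>2) / n\<^sup>2"
    by (rule energy_refine) (rule ref2)
  moreover have "0 \<le> (\<Sum>p\<in>V\<times>V. (w \<kappa>2 p - w \<kappa>1 p)\<^sup>2) / n\<^sup>2"
    by (intro divide_nonneg_nonneg sum_nonneg) auto
  ultimately have "energy \<kappa>1 \<le> energy \<kappa>2" by linarith
  with en2 have en1: "energy \<kappa>1 \<le> energy \<kappa> + c\<^sup>2 / 3200" by simp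
  have ref02: "\<kappa> x = \<kappa> y" if "x \<in> V" "y \<in> V" "\<kappa>2 x = \<kappa>2 y" for x y
    by (rule ref1[OF that(1,2) ref2[OF that]])
  \<comment> \<open>The value for which the edges from tiny cells take a share of
    \<open>c/4\<close>.\<close>
  define \<theta> where "\<theta> = c / (4 * C * real K)"
  have \<theta>: "0 < \<theta>" using c C_ge_1 K by (simp add: \<theta>_def)
  have K\<theta>: "real K * \<theta> * C = c / 4" using C_ge_1 K by (simp add: \<theta>_def)
  define F1 where "F1 = {p \<in> E. w \<kappa> p < c/4}"
  define F2 where "F2 = {p \<in> E. real (card {z \<in> V. \<kappa> z = \<kappa> (fst p)}) < \<theta> * n}"
  define F3 where "F3 = {p \<in> E. c/4 \<le> w \<kappa> p \<and> irregular \<kappa> \<kappa>1 p}"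
  define F4 where "F4 = {p \<in> E. c/4 \<le> w \<kappa> p \<and> irregular \<kappa> \<kappa>2 p}"
  have F1: "real (card F1) \<le> c/4 * n * sqrt n"
  proof -
    have "sqrt n * real (card F1) = (\<Sum>p\<in>V\<times>V. w \<kappa> p * of_bool (w \<kappa> p < c/4))"
      unfolding F1_def by (rule card_edges_measurable) (rule arg_cong[where f="\<lambda>t. t < c/4"], rule w_cong)
    also have "\<dots> \<le> (\<Sum>p\<in>V\<times>V. c/4)" using c by (intro sum_mono) auto
    also have "\<dots> = sqrt n * (c/4 * n * sqrt n)"
      using n_pos by (simp add: card_cartesian_product n_def)
    finally show ?thesis by (rule mult_left_le_imp_le) (use n_pos in simp)
  qed
  have F2: "real (card F2) \<le> c/4 * n * sqrt n"
    unfolding F2_def using card_tiny_cell_edges_le[of \<kappa> K \<theta>] lab \<theta> K\<theta> by simp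
  \<comment> \<open>The allowed gain \<open>c\<^sup>2 / 3200\<close> is calibrated so that each of
    the two refinements makes at most a share of \<open>c/8\<close> irregular.\<close>
  have F3: "real (card F3) \<le> c/8 * n * sqrt n"
  proof -
    have "real (card F3) \<le> 100 * (c\<^sup>2 / 3200) / (c/4) * n * sqrt n"
      unfolding F3_def by (rule card_irregular_le[OF ref1 en1]) (use c in auto)
    also have "100 * (c\<^sup>2 / 3200) / (c/4) = c / 8" using c by (simp add: power2_eq_square)
    finally show ?thesis .
  qed
  have F4: "real (card F4) \<le> c/8 * n * sqrt n"
  proof -
    have "real (card F4) \<le> 100 * (c\<^sup>2 / 3200) / (c/4) * n * sqrt n"
      unfolding F4_def by (rule card_irregular_le[OF ref02 en2]) (use c in auto)
    also have "100 * (c\<^sup>2 / 3200) / (c/4) = c / 8" using c by (simp add: power2_eq_square)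
    finally show ?thesis .
  qed
  \<comment> \<open>The shares \<open>c/4\<close>, \<open>c/4\<close>, \<open>c/8\<close> and
    \<open>c/8\<close> add up to three quarters of \<open>c\<close>.\<close>
  define F where "F = F1 \<union> F2 \<union> F3 \<union> F4"
  have FE: "F \<subseteq> E" by (auto simp: F_def F1_def F2_def F3_def F4_def)
  have "card F \<le> card F1 + card F2 + card F3 + card F4"
    unfolding F_def by (meson card_Un_le le_trans add_le_mono1)
  then have "real (card F) \<le> 3/4 * (c * n * sqrt n)" using F1 F2 F3 F4 by linarith
  also have "\<dots> < c * n * sqrt n" using c n_pos by simp
  finally have "card F < card T" using cT by linarith
  then have "\<not> (\<forall>t\<in>T. \<exists>p\<in>F. fst p \<in> t \<and> snd p \<in> t)"
    using card_triangles_le_hit[OF gr c4 T finite_subset[OF FE finE] FE] by fastforce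
  then obtain t where t: "t \<in> T" and nF: "\<And>p. p \<in> F \<Longrightarrow> fst p \<in> t \<Longrightarrow> snd p \<in> t \<Longrightarrow> False" by blast
  obtain x y z where xyz: "t = {x,y,z}" "(x,y) \<in> E" "(y,z) \<in> E" "(x,z) \<in> E"
    using T t unfolding triangle_family_def by blast
  note sy = graph_onD(3)[OF gr]
  \<comment> \<open>Every side of the triangle is available in both orientations, so testing the
    first endpoint for tiny cells covers all three cells.\<close>
  have good: "2 * (c/8) \<le> w \<kappa> (u,v) \<and> \<theta> * n \<le> real (card {q \<in> V. \<kappa> q = \<kappa> u})
     \<and> \<not> irregular \<kappa> \<kappa>1 (u,v) \<and> \<not> irregular \<kappa> \<kappa>2 (u,v)" if "(u,v) \<in> E" "u \<in> t" "v \<in> t" for u v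
  proof -
    have "(u,v) \<notin> F" using nF[of "(u,v)"] that by auto
    then show ?thesis using that(1) by (auto simp: F_def F1_def F2_def F3_def F4_def not_less)
  qed
  have inV: "x \<in> V" "y \<in> V" "z \<in> V" using xyz graph_onD[OF gr] by auto
  let ?A = "{q \<in> V. \<kappa> q = \<kappa> x}" and ?B = "{q \<in> V. \<kappa> q = \<kappa> y}" and ?D = "{q \<in> V. \<kappa> q = \<kappa> z}"
  have gxy: "2 * (c/8) \<le> w \<kappa> (x,y) \<and> \<theta> * n \<le> real (card ?A) \<and> \<not> irregular \<kappa> \<kappa>1 (x,y) \<and> \<not> irregular \<kappa> \<kappa>2 (x,y)"
    using good xyz by auto
  have gyx: "2 * (c/8) \<le> w \<kappa> (y,x) \<and> \<theta> * n \<le> real (card ?B) \<and> \<not> irregular \<kappa> \<kappa>1 (y,x) \<and> \<not> irregular \<kappa> \<kappa>2 (y,x)"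
    using good xyz sy by auto
  have gzx: "2 * (c/8) \<le> w \<kappa> (z,x) \<and> \<theta> * n \<le> real (card ?D) \<and> \<not> irregular \<kappa> \<kappa>1 (z,x) \<and> \<not> irregular \<kappa> \<kappa>2 (z,x)"
    using good xyz sy by auto
  have gzy: "2 * (c/8) \<le> w \<kappa> (z,y) \<and> \<theta> * n \<le> real (card ?D) \<and> \<not> irregular \<kappa> \<kappa>1 (z,y) \<and> \<not> irregular \<kappa> \<kappa>2 (z,y)"
    using good xyz sy by auto
  have c8: "0 < c/8" using c by simp
  have "(c/8) ^ 4 * (4/5) * \<theta> ^ 5 \<le> (3 * C\<^sup>2 / sqrt n + \<epsilon>1) / (c/8) + 3 * (real K1)\<^sup>2 * C\<^sup>2 / sqrt n
    + 8 * (real K1)\<^sup>2 * C ^ 3 * \<epsilon>2"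
  proof (rule dense_triple_bound[of ?A ?B ?D \<kappa>1 K1 \<epsilon>1 \<kappa>2 \<epsilon>2 "c/8" \<theta>])
    show "real (card {(v,a) \<in> ?D \<times> ?A. w \<kappa>2 (v,a) < c/8}) \<le> 1/25 * real (card ?D) * real (card ?A)"
      by (rule few_small_entries[of z x]) (use inV c8 gzx in auto)
    show "real (card {(a,b) \<in> ?A \<times> ?B. w \<kappa>2 (a,b) < c/8}) \<le> 1/25 * real (card ?A) * real (card ?B)"
      by (rule few_small_entries[of x y]) (use inV c8 gxy in auto)
    have "real (card {(b,a) \<in> ?B \<times> ?A. w \<kappa>1 (b,a) < c/8}) \<le> 1/25 * real (card ?B) * real (card ?A)"
      by (rule few_small_entries[of y x]) (use inV c8 gyx in auto)
    then show "real (card {(b,a) \<in> ?B \<times> ?A. w \<kappa>1 (b,a) < c/8}) \<le> 1/25 * real (card ?A) * real (card ?B)"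
      by (simp add: mult_ac)
    have "real (card {(b,a) \<in> ?B \<times> ?A. w \<kappa>2 (b,a) < c/8}) \<le> 1/25 * real (card ?B) * real (card ?A)"
      by (rule few_small_entries[of y x]) (use inV c8 gyx in auto)
    then show "real (card {(b,a) \<in> ?B \<times> ?A. w \<kappa>2 (b,a) < c/8}) \<le> 1/25 * real (card ?A) * real (card ?B)"
      by (simp add: mult_ac)
    show "real (card {(v,b) \<in> ?D \<times> ?B. w \<kappa>2 (v,b) < c/8}) \<le> 1/25 * real (card ?D) * real (card ?B)"
      by (rule few_small_entries[of z y]) (use inV c8 gzy in auto)
  qed (use c5 lab1 reg1 reg2 c8 \<theta> gxy gyx gzx in auto)
  with num show False unfolding \<theta>_def by linarith
qed

end

text \<open>The constants precede the graph and depend only on \<open>c\<close>, \<open>C\<close>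
  and \<open>K\<close>, so that the step can be iterated. Their order is forced: \<rho> from
  \<open>K\<close>, then \<open>\<epsilon>1\<close>, the number \<open>K1\<close> of labels it
  costs, \<open>\<epsilon>2\<close> small against \<open>K1\<close>, the number \<open>K'\<close> of
  labels that costs, and at last the size threshold \<open>N\<close>.\<close>

lemma uniform_energy_step:
  fixes c C :: real and K :: nat
  assumes c: "0 < c" and C: "1 \<le> C" and K: "0 < K"
  obtains K' N :: nat where "0 < K'"
    "\<And>(V :: 'a set) E T \<kappa>. \<lbrakk>sparse_graph V E C; c5free E; triangle_family E T;
       c * real (card V) * sqrt (real (card V)) \<le> real (card T); N \<le> card V; \<And>x. x \<in> V \<Longrightarrow> \<kappa> x < K\<rbrakk>
      \<Longrightarrow> \<exists>\<kappa>'. (\<forall>x\<in>V. \<kappa>' x < K') \<and> sparse_graph.energy V E \<kappa>' > sparse_graph.energy V E \<kappa> + c\<^sup>2 / 3200"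
proof -
  define \<rho> where "\<rho> = (c/8) ^ 4 * (4/5) * (c / (4 * C * real K)) ^ 5"
  have \<rho>: "0 < \<rho>" using c C K by (simp add: \<rho>_def)
  define \<epsilon>1 where "\<epsilon>1 = \<rho>/4 * (c/8)"
  have \<epsilon>1: "0 < \<epsilon>1" using \<rho> c by (simp add: \<epsilon>1_def)
  obtain t1 :: nat where t1: "real t1 * \<epsilon>1\<^sup>2 > 2"
    using reals_Archimedean3[of "\<epsilon>1\<^sup>2"] \<epsilon>1 by auto
  define K1 where "K1 = K * 4 ^ t1"
  have K1: "0 < K1" using K by (simp add: K1_def)
  define \<epsilon>2 where "\<epsilon>2 = \<rho>/4 / (8 * (real K1)\<^sup>2 * C ^ 3)"
  have \<epsilon>2: "0 < \<epsilon>2" using \<rho> K1 C by (simp add: \<epsilon>2_def)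
  obtain t2 :: nat where t2: "real t2 * \<epsilon>2\<^sup>2 > 2"
    using reals_Archimedean3[of "\<epsilon>2\<^sup>2"] \<epsilon>2 by auto
  define K' where "K' = K1 * 4 ^ t2"
  have K': "0 < K'" using K1 by (simp add: K'_def)
  define a where "a = 3 * C\<^sup>2 / (c/8) + 3 * (real K1)\<^sup>2 * C\<^sup>2"
  have a: "0 \<le> a" using c by (simp add: a_def)
  define M where "M = real K' * C + a * (4 / \<rho>)"
  have M0: "0 \<le> M" using C a \<rho> by (simp add: M_def)
  define N where "N = nat \<lceil>M\<^sup>2\<rceil>"
  have main: "\<exists>\<kappa>'. (\<forall>x\<in>V. \<kappa>' x < K') \<and> sparse_graph.energy V E \<kappa>' > sparse_graph.energy V E \<kappa> + c\<^sup>2 / 3200"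
    if G: "sparse_graph V E C" and c5: "c5free E" and T: "triangle_family E T"
      and cT: "c * real (card V) * sqrt (real (card V)) \<le> real (card T)" and big: "N \<le> card V"
      and lab: "\<And>x. x \<in> V \<Longrightarrow> \<kappa> x < K" for V :: "'a set" and E T and \<kappa> :: "'a \<Rightarrow> nat"
  proof -
    interpret sparse_graph V E C by (rule G)
    have "M\<^sup>2 \<le> n" using big unfolding N_def n_def by linarith
    then have "M \<le> sqrt n" using M0 by (simp add: real_le_rsqrt)
    moreover have "real K' * C \<le> M" "a * (4 / \<rho>) \<le> M" using C a \<rho> by (auto simp: M_def)
    ultimately have n1: "real (K1 * 4 ^ t2) * C \<le> sqrt n" and n2: "a * (4 / \<rho>) \<le> sqrt n"
      by (auto simp: K'_def)
    have "real (K1 * 1) * C \<le> real (K1 * 4 ^ t2) * C"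
      using C by (intro mult_right_mono of_nat_mono mult_le_mono2) auto
    then have n0: "real (K * 4 ^ t1) * C \<le> sqrt n" using n1 unfolding K1_def by linarith
    obtain \<kappa>1 where \<kappa>1: "\<And>x. x \<in> V \<Longrightarrow> \<kappa>1 x < K * 4 ^ t1"
      "\<And>x y. x \<in> V \<Longrightarrow> y \<in> V \<Longrightarrow> \<kappa>1 x = \<kappa>1 y \<Longrightarrow> \<kappa> x = \<kappa> y" "cut_regular \<kappa>1 \<epsilon>1"
      using exists_cut_regular_refinement[of \<epsilon>1 \<kappa> K t1, OF \<epsilon>1 _ t1 n0] lab by blast
    obtain \<kappa>2 where \<kappa>2: "\<And>x. x \<in> V \<Longrightarrow> \<kappa>2 x < K1 * 4 ^ t2"
      "\<And>x y. x \<in> V \<Longrightarrow> y \<in> V \<Longrightarrow> \<kappa>2 x = \<kappa>2 y \<Longrightarrow> \<kappa>1 x = \<kappa>1 y" "cut_regular \<kappa>2 \<epsilon>2"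
      using exists_cut_regular_refinement[of \<epsilon>2 \<kappa>1 K1 t2, OF \<epsilon>2 _ t2 n1] \<kappa>1(1) unfolding K1_def by blast
    have sq: "0 < sqrt n" using n_pos by simp
    have "a / sqrt n \<le> \<rho> / 4"
      using n2 sq \<rho> by (simp add: field_simps)
    then have 1: "3 * C\<^sup>2 / sqrt n / (c/8) + 3 * (real K1)\<^sup>2 * C\<^sup>2 / sqrt n \<le> \<rho> / 4"
      unfolding a_def by (simp add: add_divide_distrib mult_ac)
    have 2: "\<epsilon>1 / (c/8) = \<rho> / 4" using c by (simp add: \<epsilon>1_def)
    have 3: "8 * (real K1)\<^sup>2 * C ^ 3 * \<epsilon>2 = \<rho> / 4" using C K1 by (simp add: \<epsilon>2_def)
    \<comment> \<open>The terms that decay with n, the term of \<open>\<epsilon>1\<close> and the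
      term of \<open>\<epsilon>2\<close> take at most \<rho>/4 each.\<close>
    have num: "(3 * C\<^sup>2 / sqrt n + \<epsilon>1) / (c/8) + 3 * (real K1)\<^sup>2 * C\<^sup>2 / sqrt n + 8 * (real K1)\<^sup>2 * C ^ 3 * \<epsilon>2
       < (c/8) ^ 4 * (4/5) * (c / (4 * C * real K)) ^ 5"
      unfolding \<rho>_def[symmetric] add_divide_distrib 2 3 using 1 \<rho> by linarith
    have "energy \<kappa>2 > energy \<kappa> + c\<^sup>2 / 3200"
      by (rule energy_step[where K = K and ?\<kappa>1.0 = \<kappa>1 and ?K1.0 = K1, OF c5 T _ c K lab \<kappa>1(1)[folded K1_def] \<kappa>1(2) \<kappa>2(2) \<kappa>1(3) \<kappa>2(3) num])
        (use cT in \<open>simp_all add: n_def\<close>)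
    then show ?thesis using \<kappa>2(1) unfolding K'_def by blast
  qed
  show thesis by (rule that[OF K' main])
qed

text \<open>Many triangles allow a fixed energy gain again and again, whereas the energy of a
  partition into boundedly many cells is at most 2 for large n.\<close>

lemma few_triangles_bounded_degree:
  fixes c C :: real
  assumes c: "0 < c" and C: "1 \<le> C"
  obtains N :: nat where
    "\<And>(V :: 'a set) E T. \<lbrakk>sparse_graph V E C; c5free E; triangle_family E T; N \<le> card V\<rbrakk>
      \<Longrightarrow> real (card T) < c * real (card V) * sqrt (real (card V))"
proof -
  define \<eta> where "\<eta> = c\<^sup>2 / 3200"
  have \<eta>: "0 < \<eta>" using c by (simp add: \<eta>_def)
  \<comment> \<open>Only a bound on the number of labels and the energy are carried from step to
    step; the partition itself is forgotten.\<close>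
  have iter: "\<exists>(K :: nat) (N :: nat). 0 < K \<and> (\<forall>(V :: 'a set) E T. sparse_graph V E C \<longrightarrow> c5free E \<longrightarrow> triangle_family E T
      \<longrightarrow> c * real (card V) * sqrt (real (card V)) \<le> real (card T) \<longrightarrow> N \<le> card V
      \<longrightarrow> (\<exists>\<kappa>. (\<forall>x\<in>V. \<kappa> x < K) \<and> real s * \<eta> \<le> sparse_graph.energy V E \<kappa>))" for s :: nat
  proof (induction s)
    case 0
    show ?case
    proof (rule exI[of _ "1::nat"], rule exI[of _ "0::nat"], intro conjI allI impI)
      show "0 < (1::nat)" by simp
    next
      fix V :: "'a set" and E T
      assume "sparse_graph V E C"
      note en = sparse_graph.energy_nonneg[OF this]
      show "\<exists>\<kappa>. (\<forall>x\<in>V. \<kappa> x < (1::nat)) \<and> real 0 * \<eta> \<le> sparse_graph.energy V E \<kappa>"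
        by (rule exI[of _ "\<lambda>_. 0"]) (simp add: en)
    qed
  next
    case (Suc s)
    then obtain K N :: nat where K: "0 < K" and KN: "\<And>(V :: 'a set) E T. \<lbrakk>sparse_graph V E C; c5free E; triangle_family E T;
       c * real (card V) * sqrt (real (card V)) \<le> real (card T); N \<le> card V\<rbrakk>
      \<Longrightarrow> \<exists>\<kappa>. (\<forall>x\<in>V. \<kappa> x < K) \<and> real s * \<eta> \<le> sparse_graph.energy V E \<kappa>"
      by blast
    obtain K' N' :: nat where K': "0 < K'" and KN': "\<And>(V :: 'a set) E T \<kappa>. \<lbrakk>sparse_graph V E C; c5free E; triangle_family E T;
       c * real (card V) * sqrt (real (card V)) \<le> real (card T); N' \<le> card V; \<And>x. x \<in> V \<Longrightarrow> \<kappa> x < K\<rbrakk>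
      \<Longrightarrow> \<exists>\<kappa>'. (\<forall>x\<in>V. \<kappa>' x < K') \<and> sparse_graph.energy V E \<kappa>' > sparse_graph.energy V E \<kappa> + c\<^sup>2 / 3200"
      using uniform_energy_step[OF c C K, where 'a = 'a] by blast
    show ?case
    proof (rule exI[of _ K'], rule exI[of _ "max N N'"], intro conjI allI impI K')
      fix V :: "'a set" and E T
      assume *: "sparse_graph V E C" "c5free E" "triangle_family E T"
        "c * real (card V) * sqrt (real (card V)) \<le> real (card T)" "max N N' \<le> card V"
      obtain \<kappa> where \<kappa>: "\<forall>x\<in>V. \<kappa> x < K" "real s * \<eta> \<le> sparse_graph.energy V E \<kappa>"
        using KN[OF *(1-4)] *(5) by auto
      obtain \<kappa>' where \<kappa>': "\<forall>x\<in>V. \<kappa>' x < K'" "sparse_graph.energy V E \<kappa>' > sparse_graph.energy V E \<kappa> + c\<^sup>2 / 3200"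
        using KN'[OF *(1-4), of \<kappa>] *(5) \<kappa>(1) by auto
      have "real (Suc s) * \<eta> \<le> sparse_graph.energy V E \<kappa>'"
        using \<kappa>(2) \<kappa>'(2) by (simp add: \<eta>_def algebra_simps)
      then show "\<exists>\<kappa>. (\<forall>x\<in>V. \<kappa> x < K') \<and> real (Suc s) * \<eta> \<le> sparse_graph.energy V E \<kappa>"
        using \<kappa>'(1) by blast
    qed
  qed
  obtain s :: nat where s: "real s * \<eta> > 2" using reals_Archimedean3[OF \<eta>] by auto
  obtain K N :: nat where K: "0 < K" and KN: "\<And>(V :: 'a set) E T. \<lbrakk>sparse_graph V E C; c5free E; triangle_family E T;
       c * real (card V) * sqrt (real (card V)) \<le> real (card T); N \<le> card V\<rbrakk>
      \<Longrightarrow> \<exists>\<kappa>. (\<forall>x\<in>V. \<kappa> x < K) \<and> real s * \<eta> \<le> sparse_graph.energy V E \<kappa>"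
    using iter[of s] by blast
  define N' where "N' = max N (nat \<lceil>(real K * C)\<^sup>2\<rceil>)"
  show thesis
  proof (rule that[of N'])
    fix V :: "'a set" and E T
    assume *: "sparse_graph V E C" "c5free E" "triangle_family E T" "N' \<le> card V"
    interpret sparse_graph V E C by (rule *)
    show "real (card T) < c * real (card V) * sqrt (real (card V))"
    proof (rule ccontr)
      assume "\<not> ?thesis"
      then obtain \<kappa> where \<kappa>: "\<forall>x\<in>V. \<kappa> x < K" "real s * \<eta> \<le> energy \<kappa>"
        using KN[OF *(1-3)] *(4) by (auto simp: N'_def not_less)
      have "(real K * C)\<^sup>2 \<le> n" using *(4) unfolding N'_def n_def by linarith
      then have "real K * C \<le> sqrt n" using C by (simp add: real_le_rsqrt)
      then have "real K * C / sqrt n \<le> 1" using n_pos by simp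
      then have "energy \<kappa> \<le> 2" using energy_le[of \<kappa> K] \<kappa>(1) by fastforce
      with \<kappa>(2) s show False by simp
    qed
  qed
qed

text \<open>The degree sum is at most half the square sum plus \<open>n / 2\<close>, so it can be
  absorbed on the left.\<close>

lemma sum_all_degrees_square_le:
  assumes V: "finite V" and E: "graph_on V E" and c4: "c4free E"
  shows "(\<Sum>x\<in>V. (real (card (E `` {x})))\<^sup>2) \<le> 3 * (real (card V))\<^sup>2"
proof -
  let ?d = "\<lambda>x. real (card (E `` {x}))"
  have eq: "E `` {x} \<inter> V = E `` {x}" for x using graph_onD[OF E] by auto
  have "(\<Sum>x\<in>V. (?d x)\<^sup>2) \<le> (real (card V))\<^sup>2 + (\<Sum>x\<in>V. ?d x)"
    using sum_degree_square_le[OF V E c4 subset_refl] by (simp only: eq)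
  moreover have "(\<Sum>x\<in>V. ?d x) \<le> (\<Sum>x\<in>V. ((?d x)\<^sup>2 + 1) / 2)"
  proof (intro sum_mono)
    fix x
    have "0 \<le> (?d x - 1)\<^sup>2" by simp
    then show "?d x \<le> ((?d x)\<^sup>2 + 1) / 2" by (simp add: power2_diff)
  qed
  moreover have "(\<Sum>x\<in>V. ((?d x)\<^sup>2 + 1) / 2) = (\<Sum>x\<in>V. (?d x)\<^sup>2) / 2 + real (card V) / 2"
    by (simp add: sum_divide_distrib[symmetric] sum.distrib add_divide_distrib)
  moreover have "real (card V) \<le> (real (card V))\<^sup>2"
    by (cases "card V") (auto simp: power2_eq_square)
  ultimately show ?thesis by linarith
qed

text \<open>By the bound on squared degrees, at most 3/C times n^(3/2) ordered edges start at
  vertices of degree above C sqrt n, and every triangle meeting such a vertex contains one of them.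
  The choice of \<open>C\<close> makes this half of the allowance.\<close>

theorem few_triangles:
  fixes \<epsilon> :: real
  assumes \<epsilon>: "0 < \<epsilon>"
  obtains N :: nat where
    "\<And>(V :: 'a set) E T. \<lbrakk>finite V; graph_on V E; c4free E; c5free E; triangle_family E T; N \<le> card V\<rbrakk>
      \<Longrightarrow> real (card T) \<le> \<epsilon> * real (card V) * sqrt (real (card V))"
proof -
  define C where "C = max 1 (6 / \<epsilon>)"
  have C: "1 \<le> C" and C': "3 / C \<le> \<epsilon> / 2" using \<epsilon> by (auto simp: C_def field_simps max_def)
  obtain N :: nat where N: "\<And>(V :: 'a set) E T. \<lbrakk>sparse_graph V E C; c5free E; triangle_family E T; N \<le> card V\<rbrakk>
      \<Longrightarrow> real (card T) < \<epsilon>/2 * real (card V) * sqrt (real (card V))"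
    using few_triangles_bounded_degree[of "\<epsilon>/2" C, where 'a = 'a] \<epsilon> C by auto
  show thesis
  proof (rule that[of "max 1 N"])
    fix V :: "'a set" and E T
    assume V: "finite V" and gr: "graph_on V E" and c4: "c4free E" and c5: "c5free E"
      and T: "triangle_family E T" and big: "max 1 N \<le> card V"
    let ?n = "real (card V)"
    let ?d = "\<lambda>x. real (card (E `` {x}))"
    have n: "1 \<le> ?n" using big by simp
    have finE: "finite E" by (rule finite_subset[of _ "V\<times>V"]) (use V gr in \<open>auto simp: graph_on_def\<close>)
    define L where "L = {x \<in> V. ?d x \<le> C * sqrt ?n}"
    \<comment> \<open>The edges at vertices of high degree are deleted but the vertices are kept, so
      the scale \<open>sqrt n\<close> is unchanged.\<close>
    define E' where "E' = E \<inter> L \<times> L"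
    define T' where "T' = {t \<in> T. t \<subseteq> L}"
    have G: "sparse_graph V E' C"
    proof
      show "V \<noteq> {}" using n by auto
      show "graph_on V E'" using gr by (auto simp: graph_on_def E'_def sym_def irrefl_def)
      show "c4free E'" using c4 unfolding c4free_def E'_def by blast
      fix v assume v: "v \<in> V"
      show "real (card (E' `` {v})) \<le> C * sqrt ?n"
      proof (cases "v \<in> L")
        case True
        have "card (E' `` {v}) \<le> card (E `` {v})"
          by (rule card_mono) (use finE in \<open>auto simp: E'_def finite_Image\<close>)
        then show ?thesis using True unfolding L_def by simp
      next
        case False
        then have "E' `` {v} = {}" by (auto simp: E'_def)
        then show ?thesis using C n by simp
      qed
    qed (use V C in auto)
    have c5': "c5free E'" using c5 unfolding c5free_def E'_def by blast
    have T'fam: "triangle_family E' T'"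
    proof -
      have "\<exists>x y z. t = {x,y,z} \<and> (x,y) \<in> E' \<and> (y,z) \<in> E' \<and> (x,z) \<in> E'" if "t \<in> T" "t \<subseteq> L" for t
      proof -
        from that(1) T obtain x y z where "t = {x,y,z}" "(x,y) \<in> E" "(y,z) \<in> E" "(x,z) \<in> E"
          unfolding triangle_family_def by blast
        with that(2) show ?thesis by (intro exI[of _ x] exI[of _ y] exI[of _ z]) (auto simp: E'_def)
      qed
      then show ?thesis using T by (auto simp: triangle_family_def T'_def)
    qed
    have T'c: "real (card T') < \<epsilon>/2 * ?n * sqrt ?n"
      by (rule N[OF G c5' T'fam]) (use big in simp)
    define F where "F = {p \<in> E. fst p \<notin> L}"
    have "card (T - T') \<le> card F"
    proof (rule card_triangles_le_hit[OF gr c4])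
      show "triangle_family E (T - T')" using T by (auto simp: triangle_family_def)
      show "finite F" "F \<subseteq> E" using finE by (auto simp: F_def)
      fix t assume t: "t \<in> T - T'"
      then obtain x y z where xyz: "t = {x,y,z}" "(x,y) \<in> E" "(y,z) \<in> E" "(x,z) \<in> E"
        using T unfolding triangle_family_def by blast
      have "\<not> t \<subseteq> L" using t by (auto simp: T'_def)
      then consider "x \<notin> L" | "y \<notin> L" | "z \<notin> L" using xyz by auto
      then show "\<exists>p\<in>F. fst p \<in> t \<and> snd p \<in> t"
      proof cases
        case 1 then show ?thesis using xyz by (intro bexI[of _ "(x,y)"]) (auto simp: F_def)
      next
        case 2 then show ?thesis using xyz by (intro bexI[of _ "(y,z)"]) (auto simp: F_def)
      next
        case 3 then show ?thesis using xyz graph_onD(3)[OF gr]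
          by (intro bexI[of _ "(z,x)"]) (auto simp: F_def)
      qed
    qed
    moreover have F: "real (card F) \<le> \<epsilon>/2 * ?n * sqrt ?n"
    proof -
      have Feq: "F = Sigma (V - L) (\<lambda>x. E `` {x})" using graph_onD[OF gr] by (auto simp: F_def)
      have "card F = (\<Sum>x\<in>V-L. card (E `` {x}))"
        unfolding Feq by (rule card_SigmaI) (use V finE in \<open>auto simp: finite_Image\<close>)
      then have "(C * sqrt ?n) * real (card F) = (\<Sum>x\<in>V-L. (C * sqrt ?n) * ?d x)"
        by (simp add: sum_distrib_left)
      also have "\<dots> \<le> (\<Sum>x\<in>V-L. (?d x)\<^sup>2)"
        unfolding power2_eq_square by (intro sum_mono mult_right_mono) (auto simp: L_def)
      also have "\<dots> \<le> (\<Sum>x\<in>V. (?d x)\<^sup>2)" using V by (intro sum_mono2) auto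
      also have "\<dots> \<le> 3 * ?n\<^sup>2" by (rule sum_all_degrees_square_le[OF V gr c4])
      also have "\<dots> = (C * sqrt ?n) * (3 / C * ?n * sqrt ?n)"
        using C n by (simp add: power2_eq_square)
      finally have "real (card F) \<le> 3 / C * ?n * sqrt ?n"
        by (rule mult_left_le_imp_le) (use C n in auto)
      also have "\<dots> \<le> \<epsilon>/2 * ?n * sqrt ?n" by (intro mult_right_mono C') auto
      finally show ?thesis .
    qed
    moreover have "card T = card T' + card (T - T')"
      using T unfolding T'_def triangle_family_def
      by (subst card_Un_disjoint[symmetric]) (auto intro!: arg_cong[where f=card])
    ultimately show "real (card T) \<le> \<epsilon> * ?n * sqrt ?n" using T'c by linarith
  qed
qed

section \<open>The number of 4-cycle-free graphs\<close>

text \<open>Branch on a vertex \<open>u\<close> with many \<Gamma>-neighbours in the current set. An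
  independent set avoiding \<open>u\<close> stays in \<open>U1\<close>; one containing
  \<open>u\<close> has its other elements in \<open>U2\<close>, smaller by a factor
  \<open>exp (- \<beta>)\<close>. The budget \<open>q\<close> pays for the selected vertices: once
  it is spent the set has at most \<open>R\<close> elements. Adding them back explains the size
  \<open>R + q\<close>, and the branching gives a Pascal-type recursion for the number of
  containers.\<close>

lemma independent_set_containers:
  fixes \<Gamma> :: "'a \<Rightarrow> 'a \<Rightarrow> bool" and \<beta> R :: real
  shows "\<lbrakk>finite U; \<And>W. W \<subseteq> U \<Longrightarrow> R < card W \<Longrightarrow> \<exists>u\<in>W. \<beta> * card W \<le> card {w \<in> W. w \<noteq> u \<and> \<Gamma> u w};
      card U * exp (- \<beta> * real q) \<le> R\<rbrakk>
    \<Longrightarrow> \<exists>F. finite F \<and> card F \<le> (card U + 1) ^ q \<and> (\<forall>S\<in>F. S \<subseteq> U \<and> real (card S) \<le> R + q) \<and>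
        (\<forall>I\<subseteq>U. (\<forall>x\<in>I. \<forall>y\<in>I. x \<noteq> y \<longrightarrow> \<not> \<Gamma> x y) \<longrightarrow> (\<exists>S\<in>F. I \<subseteq> S))"
proof (induction "card U" arbitrary: U q rule: less_induct)
  case less
  note fU = \<open>finite U\<close>
  show ?case
  proof (cases "card U \<le> R")
    case True
    then show ?thesis using fU by (intro exI[of _ "{U}"]) auto
  next
    case False
    \<comment> \<open>With no budget left the size condition reads
      \<open>card U \<le> R\<close>.\<close>
    then have "q \<noteq> 0" using less.prems(3) by (cases q) auto
    then obtain q' where q: "q = Suc q'" using not0_implies_Suc by blast
    obtain u where u: "u \<in> U" "\<beta> * card U \<le> card {w \<in> U. w \<noteq> u \<and> \<Gamma> u w}"
      using less.prems(2)[of U] False by auto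
    define U1 where "U1 = U - {u}"
    define U2 where "U2 = {w \<in> U. w \<noteq> u \<and> \<not> \<Gamma> u w}"
    have sub: "U1 \<subseteq> U" "U2 \<subseteq> U1" by (auto simp: U1_def U2_def)
    have fin: "finite U1" "finite U2"
      using finite_subset[OF sub(1) fU] finite_subset[OF sub(2)] by auto
    have cU1: "card U = Suc (card U1)" unfolding U1_def by (rule card_Suc_Diff1[OF fU u(1), symmetric])
    have cU2: "card U2 \<le> card U1" using card_mono[OF fin(1) sub(2)] .
    have "\<exists>F. finite F \<and> card F \<le> (card U1 + 1) ^ q \<and> (\<forall>S\<in>F. S \<subseteq> U1 \<and> real (card S) \<le> R + q) \<and>
        (\<forall>I\<subseteq>U1. (\<forall>x\<in>I. \<forall>y\<in>I. x \<noteq> y \<longrightarrow> \<not> \<Gamma> x y) \<longrightarrow> (\<exists>S\<in>F. I \<subseteq> S))"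
    proof (rule less.hyps)
      show "card U1 < card U" using cU1 by simp
      show "\<exists>u\<in>W. \<beta> * card W \<le> card {w \<in> W. w \<noteq> u \<and> \<Gamma> u w}" if "W \<subseteq> U1" "R < card W" for W
        using less.prems(2)[of W] that sub by blast
      have "card U1 * exp (- \<beta> * real q) \<le> card U * exp (- \<beta> * real q)"
        using cU1 by (intro mult_right_mono) auto
      then show "card U1 * exp (- \<beta> * real q) \<le> R" using less.prems(3) by linarith
    qed (rule fin)
    then obtain F1 where F1: "finite F1" "card F1 \<le> (card U1 + 1) ^ q" "\<forall>S\<in>F1. S \<subseteq> U1 \<and> real (card S) \<le> R + q"
      "\<forall>I\<subseteq>U1. (\<forall>x\<in>I. \<forall>y\<in>I. x \<noteq> y \<longrightarrow> \<not> \<Gamma> x y) \<longrightarrow> (\<exists>S\<in>F1. I \<subseteq> S)"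
      by (elim exE conjE) (rule that)
    have "\<exists>F. finite F \<and> card F \<le> (card U2 + 1) ^ q' \<and> (\<forall>S\<in>F. S \<subseteq> U2 \<and> real (card S) \<le> R + q') \<and>
        (\<forall>I\<subseteq>U2. (\<forall>x\<in>I. \<forall>y\<in>I. x \<noteq> y \<longrightarrow> \<not> \<Gamma> x y) \<longrightarrow> (\<exists>S\<in>F. I \<subseteq> S))"
    proof (rule less.hyps)
      show "card U2 < card U" using cU1 cU2 by simp
      show "\<exists>u\<in>W. \<beta> * card W \<le> card {w \<in> W. w \<noteq> u \<and> \<Gamma> u w}" if "W \<subseteq> U2" "R < card W" for W
        using less.prems(2)[of W] that sub by blast
      have "card U2 + card {w \<in> U. w \<noteq> u \<and> \<Gamma> u w} \<le> card U"
        unfolding U2_def using fU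
        by (subst card_Un_disjoint[symmetric]) (auto intro!: card_mono)
      then have "real (card U2) \<le> card U * (1 - \<beta>)" using u(2) by (simp add: algebra_simps)
      also have "\<dots> \<le> card U * exp (- \<beta>)"
        using exp_ge_add_one_self[of "- \<beta>"] by (intro mult_left_mono) auto
      finally have "card U2 * exp (- \<beta> * real q') \<le> card U * exp (- \<beta>) * exp (- \<beta> * real q')"
        by (rule mult_right_mono) simp
      also have "\<dots> = card U * exp (- \<beta> * real q)"
        by (simp add: q mult_exp_exp algebra_simps)
      finally show "card U2 * exp (- \<beta> * real q') \<le> R" using less.prems(3) by linarith
    qed (rule fin)
    then obtain F2 where F2: "finite F2" "card F2 \<le> (card U2 + 1) ^ q'" "\<forall>S\<in>F2. S \<subseteq> U2 \<and> real (card S) \<le> R + q'"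
      "\<forall>I\<subseteq>U2. (\<forall>x\<in>I. \<forall>y\<in>I. x \<noteq> y \<longrightarrow> \<not> \<Gamma> x y) \<longrightarrow> (\<exists>S\<in>F2. I \<subseteq> S)"
      by (elim exE conjE) (rule that)
    define F where "F = F1 \<union> insert u ` F2"
    have "card F \<le> card F1 + card F2"
      unfolding F_def using card_Un_le card_image_le[OF F2(1)] by (meson add_left_mono le_trans)
    also have "\<dots> \<le> card U ^ q + card U ^ q'"
    proof (intro add_mono)
      show "card F1 \<le> card U ^ q" using F1(2) cU1 by simp
      have "card F2 \<le> (card U2 + 1) ^ q'" by (rule F2)
      also have "\<dots> \<le> card U ^ q'" using cU1 cU2 by (intro power_mono) auto
      finally show "card F2 \<le> card U ^ q'" .
    qed
    also have "\<dots> = (card U + 1) * card U ^ q'" by (simp add: q)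
    also have "\<dots> \<le> (card U + 1) * (card U + 1) ^ q'" by (intro mult_le_mono2 power_mono) auto
    finally have cF: "card F \<le> (card U + 1) ^ q" by (simp add: q)
    have size: "S \<subseteq> U \<and> real (card S) \<le> R + q" if SF: "S \<in> F" for S
    proof (cases "S \<in> F1")
      case True
      then show ?thesis using F1(3) sub by blast
    next
      case False
      then obtain S' where S': "S' \<in> F2" "S = insert u S'" using SF by (auto simp: F_def)
      have "S' \<subseteq> U2" "real (card S') \<le> R + q'" using F2(3) S'(1) by auto
      moreover have "card S \<le> Suc (card S')" unfolding S'(2)
        using fin(2) \<open>S' \<subseteq> U2\<close> finite_subset by (intro card_insert_le_m1) auto
      ultimately show ?thesis using S'(2) u(1) sub q by auto
    qed
    have cover: "\<exists>S\<in>F. I \<subseteq> S" if I: "I \<subseteq> U" "\<forall>x\<in>I. \<forall>y\<in>I. x \<noteq> y \<longrightarrow> \<not> \<Gamma> x y" for I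
    proof (cases "u \<in> I")
      case True
      have "I - {u} \<subseteq> U2" using I True by (auto simp: U2_def)
      then obtain S where "S \<in> F2" "I - {u} \<subseteq> S" using F2(4)[rule_format, of "I - {u}"] I(2) by auto
      then show ?thesis by (intro bexI[of _ "insert u S"]) (auto simp: F_def)
    next
      case False
      then have "I \<subseteq> U1" using I by (auto simp: U1_def)
      then show ?thesis using F1(4)[rule_format, of I] I(2) by (auto simp: F_def)
    qed
    show ?thesis using cF size cover F1(1) F2(1)
      by (intro exI[of _ F]) (auto simp: F_def)
  qed
qed

text \<open>Let \<open>s\<close> count the edges between \<open>V\<close> and \<open>W\<close>, and
  m the vertices of \<open>V\<close>. By Cauchy-Schwarz at least s^2/m cherries have both ends in
  \<open>W\<close>. Only \<open>s\<close> of them are degenerate, which is at most half because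
  \<open>s \<ge> 2 m\<close>. Codegrees are at most one, so the remaining cherries correspond to
  ordered pairs, and averaging over the first end yields \<open>u\<close>.\<close>

lemma exists_high_codegree_vertex:
  assumes V: "finite V" and E: "graph_on V E" and c4: "c4free E"
    and deg: "\<And>v. v \<in> V \<Longrightarrow> D \<le> card (E `` {v})"
    and W: "W \<subseteq> V" and big: "2 * card V < card W * D"
  shows "\<exists>u\<in>W. (real D)\<^sup>2 / (2 * card V) * card W \<le> card {w \<in> W. w \<noteq> u \<and> (\<exists>z. (u,z) \<in> E \<and> (w,z) \<in> E)}"
proof (rule ccontr)
  assume "\<not> ?thesis"
  then have small: "card {w \<in> W. w \<noteq> u \<and> (\<exists>z. (u,z) \<in> E \<and> (w,z) \<in> E)} < (real D)\<^sup>2 / (2 * card V) * card W"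
    if "u \<in> W" for u using that by force
  have fW: "finite W" using W V finite_subset by blast
  have Wne: "W \<noteq> {}" using big by auto
  then have m: "0 < real (card V)" using W V by (auto simp: card_gt_0_iff)
  let ?d = "\<lambda>x. real (card (E `` {x} \<inter> W))"
  let ?cod = "\<lambda>y z. real (card {x. (y,x) \<in> E \<and> (z,x) \<in> E})"
  define s where "s = (\<Sum>x\<in>V. ?d x)"
  have s_eq: "s = (\<Sum>y\<in>W. real (card (E `` {y})))"
  proof -
    have "?d x = (\<Sum>y\<in>W. of_bool ((x,y) \<in> E))" for x
    proof -
      have "(\<Sum>y\<in>W. of_bool ((x,y) \<in> E)) = real (card (W \<inter> {y. (x,y) \<in> E}))" using fW by simp
      also have "W \<inter> {y. (x,y) \<in> E} = E `` {x} \<inter> W" by auto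
      finally show ?thesis by simp
    qed
    then have "s = (\<Sum>x\<in>V. \<Sum>y\<in>W. of_bool ((x,y) \<in> E))" by (simp add: s_def)
    also have "\<dots> = (\<Sum>y\<in>W. \<Sum>x\<in>V. of_bool ((x,y) \<in> E))" by (rule sum.swap)
    also have "\<dots> = (\<Sum>y\<in>W. real (card (E `` {y})))"
    proof (intro sum.cong refl)
      fix y
      have "(\<Sum>x\<in>V. of_bool ((x,y) \<in> E)) = real (card (V \<inter> {x. (x,y) \<in> E}))" using V by simp
      also have "V \<inter> {x. (x,y) \<in> E} = E `` {y}" using graph_onD[OF E] by blast
      finally show "(\<Sum>x\<in>V. of_bool ((x,y) \<in> E)) = real (card (E `` {y}))" .
    qed
    finally show ?thesis .
  qed
  have s_ge: "real (card W) * real D \<le> s"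
  proof -
    have "real (card W) * real D = (\<Sum>y\<in>W. real D)" by simp
    also have "\<dots> \<le> s" unfolding s_eq using deg W by (intro sum_mono) auto
    finally show ?thesis .
  qed
  have "2 * real (card V) < real (card W) * real D"
    using big by (metis of_nat_less_iff of_nat_mult of_nat_numeral)
  with s_ge have s_big: "2 * real (card V) \<le> s" by linarith
  have "s\<^sup>2 \<le> real (card V) * (\<Sum>x\<in>V. (?d x)\<^sup>2)"
    unfolding s_def using sum_squared_le_sum_of_squares[of ?d V] by (simp add: mult.commute)
  also have "(\<Sum>x\<in>V. (?d x)\<^sup>2) = (\<Sum>y\<in>W. \<Sum>z\<in>W. ?cod y z)"
    by (rule sum_degree_square[OF V E W])
  also have "\<dots> < s + (\<Sum>y\<in>W. (real D)\<^sup>2 / (2 * card V) * card W)"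
  proof -
    have "(\<Sum>y\<in>W. \<Sum>z\<in>W. ?cod y z) < (\<Sum>y\<in>W. real (card (E `` {y})) + (real D)\<^sup>2 / (2 * card V) * card W)"
    proof (intro sum_strict_mono fW Wne)
      fix y assume y: "y \<in> W"
      have "(\<Sum>z\<in>W. ?cod y z) = ?cod y y + (\<Sum>z\<in>W-{y}. ?cod y z)"
        using fW y by (rule sum.remove)
      also have "?cod y y = real (card (E `` {y}))" by (auto intro!: arg_cong[where f=card])
      also have "(\<Sum>z\<in>W-{y}. ?cod y z) \<le> (\<Sum>z\<in>W-{y}. of_bool (\<exists>x. (y,x) \<in> E \<and> (z,x) \<in> E))"
      proof (intro sum_mono)
        fix z assume z: "z \<in> W - {y}"
        show "?cod y z \<le> of_bool (\<exists>x. (y,x) \<in> E \<and> (z,x) \<in> E)"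
        proof (cases "\<exists>x. (y,x) \<in> E \<and> (z,x) \<in> E")
          case True
          have "card {x. (y,x) \<in> E \<and> (z,x) \<in> E} \<le> 1"
            by (rule card_codegree_le_1[OF c4]) (use z in auto)
          then show ?thesis using True by (simp only: of_bool_eq)
        next
          case False
          then have "{x. (y,x) \<in> E \<and> (z,x) \<in> E} = {}" by auto
          then have "card {x. (y,x) \<in> E \<and> (z,x) \<in> E} = 0" by (metis card.empty)
          then show ?thesis by simp
        qed
      qed
      also have "\<dots> = real (card ((W - {y}) \<inter> {z. \<exists>x. (y,x) \<in> E \<and> (z,x) \<in> E}))"
        using fW by simp
      also have "(W - {y}) \<inter> {z. \<exists>x. (y,x) \<in> E \<and> (z,x) \<in> E}
          = {w \<in> W. w \<noteq> y \<and> (\<exists>z. (y,z) \<in> E \<and> (w,z) \<in> E)}" by auto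
      finally show "(\<Sum>z\<in>W. ?cod y z) < real (card (E `` {y})) + (real D)\<^sup>2 / (2 * card V) * card W"
        using small[OF y] by linarith
    qed
    then show ?thesis by (simp add: sum.distrib s_eq)
  qed
  also have "(\<Sum>y\<in>W. (real D)\<^sup>2 / (2 * card V) * card W) = (card W * real D)\<^sup>2 / (2 * card V)"
    by (simp add: power2_eq_square)
  also have "\<dots> \<le> s\<^sup>2 / (2 * card V)"
    using s_ge m by (intro divide_right_mono power_mono) auto
  finally have "s\<^sup>2 < real (card V) * (s + s\<^sup>2 / (2 * card V))" using m by simp
  also have "\<dots> = real (card V) * s + s\<^sup>2 / 2" using m by (simp add: field_simps)
  finally have "s * s < 2 * real (card V) * s" by (simp add: power2_eq_square)
  moreover have "2 * real (card V) * s \<le> s * s" using s_big m by (intro mult_right_mono) auto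
  ultimately show False by simp
qed

section \<open>Counting the possible neighbourhoods of an added vertex\<close>

lemma power_self_le_exp_fact: "real d ^ d \<le> exp (real d) * fact d"
proof -
  \<comment> \<open>A single term of the exponential series is at most its sum.\<close>
  have "real d ^ d /\<^sub>R fact d \<le> exp (real d)"
    by (rule sums_le[OF _ sums_single[of d "\<lambda>k. real d ^ k /\<^sub>R fact k"] exp_converges]) auto
  then show ?thesis by (simp add: field_simps)
qed

lemma choose_le_exp_power:
  assumes "0 < d"
  shows "real (R choose d) \<le> (exp 1 * real R / real d) ^ d"
proof -
  have "real (R choose d) * fact d \<le> real R ^ d"
    using binomial_fact_pow[of R d] by (metis of_nat_fact of_nat_le_iff of_nat_mult of_nat_power)
  then have "real (R choose d) * fact d * real d ^ d \<le> real R ^ d * (exp (real d) * fact d)"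
    by (intro mult_mono power_self_le_exp_fact) auto
  then have "real (R choose d) * real d ^ d \<le> real R ^ d * exp (real d)"
    by (simp add: mult_ac)
  also have "exp (real d) = exp 1 ^ d" by (simp add: exp_of_nat_mult[symmetric])
  finally show ?thesis using assms by (simp add: power_divide power_mult_distrib field_simps)
qed

text \<open>The sets to which a new vertex can be joined without creating a 4-cycle: independent
  sets of size \<open>d\<close> in the graph of pairs with a common neighbour.\<close>

definition links :: "'a set \<Rightarrow> ('a \<times> 'a) set \<Rightarrow> nat \<Rightarrow> 'a set set" where
  "links V E d = {N. N \<subseteq> V \<and> card N = d \<and> (\<forall>x\<in>N. \<forall>y\<in>N. x \<noteq> y \<longrightarrow> \<not> (\<exists>z. (x,z) \<in> E \<and> (y,z) \<in> E))}"

text \<open>The container lemma applies with \<open>R = 2 * card V / D\<close>, because a larger set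
  has degree sum above \<open>2 * card V\<close>, and with the \<beta> from
  \<open>exists_high_codegree_vertex\<close>. Every link is then a \<open>d\<close>-subset of a
  container.\<close>

lemma card_links_le_containers:
  assumes V: "finite V" and E: "graph_on V E" and c4: "c4free E" and D: "0 < D"
    and deg: "\<And>v. v \<in> V \<Longrightarrow> D \<le> card (E `` {v})"
    and q: "card V * exp (- ((real D)\<^sup>2 / (2 * card V)) * real q) \<le> 2 * card V / D"
  shows "card (links V E d) \<le> (card V + 1) ^ q * (nat \<lfloor>2 * card V / D + q\<rfloor> choose d)"
proof -
  let ?R = "nat \<lfloor>2 * card V / D + q\<rfloor>"
  have "\<exists>F. finite F \<and> card F \<le> (card V + 1) ^ q \<and> (\<forall>S\<in>F. S \<subseteq> V \<and> real (card S) \<le> 2 * card V / D + q) \<and>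
        (\<forall>I\<subseteq>V. (\<forall>x\<in>I. \<forall>y\<in>I. x \<noteq> y \<longrightarrow> \<not> (\<exists>z. (x,z) \<in> E \<and> (y,z) \<in> E)) \<longrightarrow> (\<exists>S\<in>F. I \<subseteq> S))"
  proof (rule independent_set_containers[OF V _ q])
    fix W assume W: "W \<subseteq> V" "2 * card V / D < card W"
    then have "real (2 * card V) < real (card W * D)" using D by (simp add: pos_divide_less_eq)
    then have "2 * card V < card W * D" by (simp only: of_nat_less_iff)
    from exists_high_codegree_vertex[OF V E c4 deg W(1) this]
    show "\<exists>u\<in>W. (real D)\<^sup>2 / (2 * card V) * card W \<le> card {w \<in> W. w \<noteq> u \<and> (\<exists>z. (u,z) \<in> E \<and> (w,z) \<in> E)}" .
  qed
  then obtain F where F: "finite F" "card F \<le> (card V + 1) ^ q" "\<forall>S\<in>F. S \<subseteq> V \<and> real (card S) \<le> 2 * card V / D + q"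
    "\<forall>I\<subseteq>V. (\<forall>x\<in>I. \<forall>y\<in>I. x \<noteq> y \<longrightarrow> \<not> (\<exists>z. (x,z) \<in> E \<and> (y,z) \<in> E)) \<longrightarrow> (\<exists>S\<in>F. I \<subseteq> S)"
    by (elim exE conjE) (rule that)
  have "links V E d \<subseteq> (\<Union>S\<in>F. {N. N \<subseteq> S \<and> card N = d})"
  proof
    fix N assume "N \<in> links V E d"
    then have N: "N \<subseteq> V" "\<forall>x\<in>N. \<forall>y\<in>N. x \<noteq> y \<longrightarrow> \<not> (\<exists>z. (x,z) \<in> E \<and> (y,z) \<in> E)" and "card N = d"
      unfolding links_def by simp_all
    moreover obtain S where "S \<in> F" "N \<subseteq> S"
      using F(4)[THEN spec, THEN mp, THEN mp, OF N] by (rule bexE)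
    ultimately show "N \<in> (\<Union>S\<in>F. {N. N \<subseteq> S \<and> card N = d})" by auto
  qed
  moreover have fS: "finite S" if "S \<in> F" for S by (rule finite_subset[OF _ V]) (use F(3) that in blast)
  ultimately have "card (links V E d) \<le> card (\<Union>S\<in>F. {N. N \<subseteq> S \<and> card N = d})"
    using F(1) by (intro card_mono) auto
  also have "\<dots> \<le> (\<Sum>S\<in>F. card {N. N \<subseteq> S \<and> card N = d})" by (rule card_UN_le[OF F(1)])
  also have "\<dots> \<le> (\<Sum>S\<in>F. ?R choose d)"
  proof (intro sum_mono)
    fix S assume S: "S \<in> F"
    have "card S \<le> ?R" by (rule le_nat_floor) (use F(3) S in blast)
    then show "card {N. N \<subseteq> S \<and> card N = d} \<le> ?R choose d"
      using n_subsets[OF fS[OF S]] binomial_right_mono by simp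
  qed
  also have "\<dots> \<le> (card V + 1) ^ q * (?R choose d)" using F(2) by simp
  finally show ?thesis .
qed

text \<open>Exponential growth in \<open>d\<close> is harmless, since the degrees will add up to a
  number of edges that is small. The condition on \<open>d - 1\<close> reflects that deleting a
  vertex of minimum degree \<open>d\<close> lowers the other degrees by at most one.\<close>

lemma card_links_le:
  fixes \<eta> :: real
  assumes \<eta>: "0 < \<eta>"
  obtains \<mu> :: real and n0 :: nat where "0 \<le> \<mu>"
    "\<And>n (V :: 'a set) E d. \<lbrakk>n0 \<le> n; finite V; card V \<le> n; graph_on V E; c4free E;
        \<And>v. v \<in> V \<Longrightarrow> d - 1 \<le> card (E `` {v})\<rbrakk>
      \<Longrightarrow> real (card (links V E d)) \<le> exp (\<eta> * sqrt (real n) + \<mu> * real d)"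
proof -
  \<comment> \<open>The tangent bound ln x \<le> ln M + x/M, used at x = 5 sqrt n / d and multiplied
    by 2 d, costs 2 ln M per unit of \<open>d\<close> and 10/M times sqrt n; this \<open>M\<close>
    brings the latter below \<eta>/2 times sqrt n.\<close>
  define M where "M = max 1 (20 / \<eta>)"
  have M: "1 \<le> M" "10 / M \<le> \<eta> / 2" using \<eta> by (auto simp: M_def field_simps max_def)
  have "eventually (\<lambda>n::nat. (real n powr (2/5) + 2) * ln (real n + 1) \<le> \<eta> * sqrt (real n)) at_top"
    using \<eta> by real_asymp
  moreover have "eventually (\<lambda>n::nat. (2 * real n powr (1/5) * ln (real n) + 1) * ln (real n + 1) \<le> \<eta>/2 * sqrt (real n)) at_top"
    using \<eta> by real_asymp
  moreover have "eventually (\<lambda>n::nat. 8 * real n powr (3/5) * ln (real n) \<le> real n) at_top"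
    by real_asymp
  moreover have "eventually (\<lambda>n::nat. 2 \<le> n) at_top" by (rule eventually_ge_at_top)
  ultimately have "eventually (\<lambda>n::nat. (real n powr (2/5) + 2) * ln (real n + 1) \<le> \<eta> * sqrt (real n)
     \<and> (2 * real n powr (1/5) * ln (real n) + 1) * ln (real n + 1) \<le> \<eta>/2 * sqrt (real n)
     \<and> 8 * real n powr (3/5) * ln (real n) \<le> real n \<and> 2 \<le> n) at_top"
    by eventually_elim simp
  then obtain n0 where n0: "\<And>n. n0 \<le> n \<Longrightarrow> (real n powr (2/5) + 2) * ln (real n + 1) \<le> \<eta> * sqrt (real n)
     \<and> (2 * real n powr (1/5) * ln (real n) + 1) * ln (real n + 1) \<le> \<eta>/2 * sqrt (real n)
     \<and> 8 * real n powr (3/5) * ln (real n) \<le> real n \<and> 2 \<le> n"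
    unfolding eventually_sequentially by blast
  have \<mu>: "0 \<le> 2 * ln M" using M by simp
  show thesis
  proof (rule that[OF \<mu>, of n0])
    fix n :: nat and V :: "'a set" and E d
    assume n: "n0 \<le> n" and V: "finite V" and m: "card V \<le> n" and gr: "graph_on V E" and c4: "c4free E"
      and deg: "\<And>v. v \<in> V \<Longrightarrow> d - 1 \<le> card (E `` {v})"
    from n0[OF n] have e1: "(real n powr (2/5) + 2) * ln (real n + 1) \<le> \<eta> * sqrt (real n)"
      and e2: "(2 * real n powr (1/5) * ln (real n) + 1) * ln (real n + 1) \<le> \<eta>/2 * sqrt (real n)"
      and e3: "8 * real n powr (3/5) * ln (real n) \<le> real n" and n2: "2 \<le> n" by auto
    have fl: "links V E d \<subseteq> {N. N \<subseteq> V \<and> card N = d}" by (auto simp: links_def)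
    have triv: "card (links V E d) \<le> card V choose d"
      using card_mono[OF _ fl] V n_subsets[OF V] by simp
    have ln0: "0 \<le> ln (real n + 1)" "0 \<le> ln (real n)" using n2 by auto
    show "real (card (links V E d)) \<le> exp (\<eta> * sqrt (real n) + 2 * ln M * real d)"
    \<comment> \<open>Any exponent strictly between 1/4 and 1/2 would serve: below the threshold
      (n+1)^d is negligible, above it \<open>q\<close> is so small that the number of containers is
      negligible.\<close>
    proof (cases "real d \<le> real n powr (2/5) + 2")
      case True
      have "card V choose d \<le> n choose d" by (rule binomial_right_mono[OF m])
      also have "\<dots> \<le> (n + 1) ^ d"
      proof (cases "d \<le> n")
        case True
        then show ?thesis using binomial_le_pow[OF True] power_mono[of n "n+1" d] by linarith
      qed (simp add: binomial_eq_0)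
      finally have "real (card (links V E d)) \<le> real ((n + 1) ^ d)" using triv by linarith
      also have "\<dots> = exp (real d * ln (real n + 1))"
        using n2 by (simp add: exp_of_nat_mult add.commute)
      also have "\<dots> \<le> exp (\<eta> * sqrt (real n) + 2 * ln M * real d)"
      proof -
        have "real d * ln (real n + 1) \<le> (real n powr (2/5) + 2) * ln (real n + 1)"
          by (intro mult_right_mono True ln0)
        also have "\<dots> \<le> \<eta> * sqrt (real n)" by (rule e1)
        finally show ?thesis using \<mu> by (simp add: add_increasing2)
      qed
      finally show ?thesis .
    next
      case False
      show ?thesis
      proof (cases "V = {}")
        case True
        then have "links V E d = {}" using False by (auto simp: links_def)
        then show ?thesis by simp
      next
        case Vne: False
        define D where "D = d - 1"
        have pw: "1 \<le> real n powr (2/5)" using n2 by (simp add: ge_one_powr_ge_zero)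
        have d3: "3 \<le> d" using False pw by linarith
        have Dd: "real D = real d - 1" "real d / 2 \<le> real D" using d3 by (auto simp: D_def)
        have Dn: "real n powr (2/5) \<le> real D" and D1: "1 \<le> real D" and D0: "0 < D"
          using False Dd(1) pw d3 by (auto simp: D_def)
        have m1: "1 \<le> card V" using Vne V by (simp add: Suc_le_eq card_gt_0_iff)
        \<comment> \<open>With this budget the exponential factor is at most 1/n, so the shrunken
          set has size at most 1, which is below \<open>2 * card V / D\<close>.\<close>
        define q where "q = nat \<lceil>2 * card V / (real D)\<^sup>2 * ln (real n)\<rceil>"
        obtain v where v: "v \<in> V" using Vne by auto
        have "D \<le> card (E `` {v})" using deg[OF v] by (simp add: D_def)
        also have "\<dots> \<le> card V" by (rule card_mono[OF V]) (use graph_onD[OF gr] in auto)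
        finally have DV: "D \<le> card V" .
        have q_lo: "2 * card V / (real D)\<^sup>2 * ln (real n) \<le> real q" unfolding q_def by linarith
        have q_hi: "real q \<le> 2 * card V / (real D)\<^sup>2 * ln (real n) + 1"
        proof -
          have "0 \<le> 2 * card V / (real D)\<^sup>2 * ln (real n)" using ln0 by simp
          then show ?thesis unfolding q_def by linarith
        qed
        have Dsq: "real n powr (4/5) \<le> (real D)\<^sup>2"
        proof -
          have "real n powr (4/5) = (real n powr (2/5))\<^sup>2"
            using n2 by (simp add: power2_eq_square powr_add[symmetric])
          also have "\<dots> \<le> (real D)\<^sup>2" by (intro power_mono Dn) simp
          finally show ?thesis .
        qed
        have q_hi': "real q \<le> 2 * real n powr (1/5) * ln (real n) + 1"
        proof -
          have "2 * real (card V) / (real D)\<^sup>2 \<le> 2 * real n / real n powr (4/5)"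
            using m Dsq n2 by (intro frac_le) auto
          also have "\<dots> = 2 * real n powr (1/5)"
          proof -
            have "real n = real n powr (1/5) * real n powr (4/5)" using n2 by (simp add: powr_add[symmetric])
            then show ?thesis using n2 by (simp add: field_simps)
          qed
          finally have "2 * real (card V) / (real D)\<^sup>2 * ln (real n) \<le> 2 * real n powr (1/5) * ln (real n)"
            by (intro mult_right_mono ln0)
          then show ?thesis using q_hi by simp
        qed
        have qc: "card V * exp (- ((real D)\<^sup>2 / (2 * card V)) * real q) \<le> 2 * card V / D"
        proof -
          have "ln (real n) = (real D)\<^sup>2 / (2 * card V) * (2 * card V / (real D)\<^sup>2 * ln (real n))"
            using D1 m1 by simp
          also have "\<dots> \<le> (real D)\<^sup>2 / (2 * card V) * real q"
            by (intro mult_left_mono q_lo) auto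
          finally have "exp (- ((real D)\<^sup>2 / (2 * card V)) * real q) \<le> exp (- ln (real n))" by simp
          also have "\<dots> = 1 / real n" using n2 by (simp add: exp_minus field_simps)
          finally have "card V * exp (- ((real D)\<^sup>2 / (2 * card V)) * real q) \<le> card V * (1 / real n)"
            by (intro mult_left_mono) auto
          also have "\<dots> \<le> 1" using m n2 by simp
          also have "1 \<le> 2 * card V / D" using DV D0 by simp
          finally show ?thesis .
        qed
        define R where "R = nat \<lfloor>2 * card V / D + q\<rfloor>"
        have "card (links V E d) \<le> (card V + 1) ^ q * (R choose d)"
          unfolding R_def by (rule card_links_le_containers[OF V gr c4 D0 _ qc]) (use deg in \<open>simp add: D_def\<close>)
        then have "real (card (links V E d)) \<le> (real (card V) + 1) ^ q * real (R choose d)"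
          by (metis (mono_tags, lifting) of_nat_1 of_nat_add of_nat_le_iff of_nat_mult of_nat_power)
        also have "\<dots> \<le> (real n + 1) ^ q * (exp 1 * real R / real d) ^ d"
          using m d3 by (intro mult_mono power_mono choose_le_exp_power) auto
        also have "(real n + 1) ^ q = exp (real q * ln (real n + 1))"
          using n2 by (simp add: exp_of_nat_mult)
        also have "\<dots> \<le> exp (\<eta>/2 * sqrt (real n))"
        proof -
          have "real q * ln (real n + 1) \<le> (2 * real n powr (1/5) * ln (real n) + 1) * ln (real n + 1)"
            by (intro mult_right_mono q_hi' ln0)
          then show ?thesis using e2 by simp
        qed
        also have "(exp 1 * real R / real d) ^ d \<le> exp (\<eta>/2 * sqrt (real n) + 2 * ln M * real d)"
        proof -
          \<comment> \<open>As \<open>d \<le> 2 * D\<close>, the term \<open>2 * card V / D\<close>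
            contributes \<open>4 * n\<close>; the term \<open>q\<close> contributes
            \<open>3 * n\<close>.\<close>
          have Rd: "real R * real d \<le> 7 * real n"
          proof -
            have "real R \<le> 2 * card V / D + q" unfolding R_def by (intro of_nat_floor) auto
            then have "real R * real d \<le> (2 * card V / D + q) * real d" by (intro mult_right_mono) auto
            also have "\<dots> = 2 * card V * (real d / D) + q * real d" by (simp add: field_simps)
            also have "2 * card V * (real d / D) \<le> 2 * real n * 2"
              using Dd(2) D1 m by (intro mult_mono) (auto simp: field_simps)
            also have "q * real d \<le> 3 * real n"
            proof -
              have "q * real d \<le> (2 * card V / (real D)\<^sup>2 * ln (real n) + 1) * real d"
                by (intro mult_right_mono q_hi) auto
              also have "\<dots> = 2 * card V * ln (real n) * (real d / (real D)\<^sup>2) + real d" by (simp add: field_simps)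
              also have "real d / (real D)\<^sup>2 \<le> 2 / real n powr (2/5)"
              proof -
                have "real d / (real D)\<^sup>2 \<le> (2 * real D) / (real D)\<^sup>2" using Dd(2) by (intro divide_right_mono) auto
                also have "\<dots> = 2 / real D" using D1 by (simp add: power2_eq_square)
                also have "\<dots> \<le> 2 / real n powr (2/5)" using Dn pw n2 by (intro frac_le) auto
                finally show ?thesis .
              qed
              also have "2 * card V * ln (real n) * (2 / real n powr (2/5)) \<le> 2 * real n * ln (real n) * (2 / real n powr (2/5))"
                using m ln0 by (intro mult_right_mono) auto
              also have "\<dots> = 4 * real n powr (3/5) * ln (real n)"
              proof -
                have "real n = real n powr (3/5) * real n powr (2/5)" using n2 by (simp add: powr_add[symmetric])
                then show ?thesis using n2 by (simp add: field_simps)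
              qed
              also have "\<dots> \<le> real n"
              proof -
                have "0 \<le> real n powr (3/5) * ln (real n)" using ln0 by simp
                then show ?thesis using e3 by linarith
              qed
              also have "real d \<le> 2 * real n" using Dd(1) DV m n2 by simp
              finally show ?thesis using m ln0 by (simp add: mult_left_mono)
            qed
            finally show ?thesis by simp
          qed
          have dpos: "0 < real d" using d3 by simp
          have "exp 1 * real R / real d = exp 1 * (real R * real d) / (real d)\<^sup>2"
            using dpos by (simp add: power2_eq_square)
          also have "\<dots> \<le> 3 * (7 * real n) / (real d)\<^sup>2"
            by (intro divide_right_mono mult_mono[OF exp_le Rd]) auto
          \<comment> \<open>The product 3 times 7 is rounded up to 25 to reach a square.\<close>
          also have "\<dots> \<le> (5 * sqrt (real n) / real d)\<^sup>2"
            by (simp add: power_mult_distrib power_divide divide_right_mono)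
          finally have "(exp 1 * real R / real d) ^ d \<le> ((5 * sqrt (real n) / real d)\<^sup>2) ^ d"
            by (intro power_mono) auto
          also have "\<dots> = exp (2 * real d * ln (5 * sqrt (real n) / real d))"
          proof -
            have pos: "0 < 5 * sqrt (real n) / real d" using n2 dpos by simp
            have "((5 * sqrt (real n) / real d)\<^sup>2) ^ d = (5 * sqrt (real n) / real d) ^ (2 * d)"
              by (simp add: power_mult)
            also have "\<dots> = exp (ln (5 * sqrt (real n) / real d)) ^ (2 * d)" using pos by simp
            also have "\<dots> = exp (real (2 * d) * ln (5 * sqrt (real n) / real d))"
              by (rule exp_of_nat_mult[symmetric])
            finally show ?thesis by simp
          qed
          also have "\<dots> \<le> exp (\<eta>/2 * sqrt (real n) + 2 * ln M * real d)"
          proof -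
            have "ln (5 * sqrt (real n) / real d / M) \<le> 5 * sqrt (real n) / real d / M - 1"
              using n2 dpos M by (intro ln_le_minus_one) auto
            moreover have "ln (5 * sqrt (real n) / real d / M) = ln (5 * sqrt (real n) / real d) - ln M"
              using n2 dpos M by (subst ln_div) auto
            ultimately have "ln (5 * sqrt (real n) / real d) \<le> ln M + 5 * sqrt (real n) / real d / M" by linarith
            then have "2 * real d * ln (5 * sqrt (real n) / real d) \<le> 2 * real d * (ln M + 5 * sqrt (real n) / real d / M)"
              using dpos by (intro mult_left_mono) auto
            also have "\<dots> = 2 * ln M * real d + 10 / M * sqrt (real n)"
              using dpos M by (simp add: field_simps)
            also have "10 / M * sqrt (real n) \<le> \<eta>/2 * sqrt (real n)"
              using M by (intro mult_right_mono) auto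
            finally show ?thesis by simp
          qed
          finally show ?thesis .
        qed
        finally have "real (card (links V E d)) \<le> exp (\<eta>/2 * sqrt (real n)) * exp (\<eta>/2 * sqrt (real n) + 2 * ln M * real d)"
          by (simp add: mult_right_mono)
        also have "\<dots> = exp (\<eta> * sqrt (real n) + 2 * ln M * real d)"
          by (simp add: exp_add[symmetric])
        finally show ?thesis .
      qed
    qed
  qed
qed

text \<open>Giving each edge the weight \<open>exp (- \<mu>)\<close> lets the bounds for the single neighbourhoods be
  multiplied over the vertices, without keeping track of the degree sequence.\<close>
lemma c4free_partition_function_le:
  fixes a \<mu> :: real and n :: nat
  assumes L: "\<And>(V :: 'a set) E d. \<lbrakk>finite V; card V \<le> n; graph_on V E; c4free E;
        \<And>v. v \<in> V \<Longrightarrow> d - 1 \<le> card (E `` {v})\<rbrakk> \<Longrightarrow> real (card (links V E d)) \<le> exp (a + \<mu> * real d)"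
  shows "finite (V :: 'a set) \<Longrightarrow> card V \<le> n \<Longrightarrow>
    (\<Sum>E | graph_on V E \<and> c4free E. exp (- \<mu> / 2 * real (card E))) \<le> (real n * (real n + 1) * exp a) ^ card V"
proof (induction "card V" arbitrary: V)
  case 0
  then have "V = {}" by simp
  then have "{E. graph_on V E \<and> c4free E} = {{}}"
    by (auto simp: graph_on_def c4free_def sym_def irrefl_def)
  then show ?case using 0 by simp
next
  case (Suc k)
  note V = \<open>finite V\<close>
  let ?G = "\<lambda>V. {E. graph_on V E \<and> c4free E}"
  \<comment> \<open>\<open>E\<close> contains both orientations of an edge, so \<mu>/2 for each
    ordered pair amounts to \<mu> for each edge.\<close>
  let ?wt = "\<lambda>E :: ('a \<times> 'a) set. exp (- \<mu> / 2 * real (card E))"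
  have finG: "finite (?G W)" if "finite W" for W :: "'a set"
    by (rule finite_subset[of _ "Pow (W \<times> W)"]) (use that in \<open>auto simp: graph_on_def\<close>)
  have Vne: "V \<noteq> {}" using Suc.hyps(2) by auto
  have "\<exists>v\<in>V. \<forall>u\<in>V. card (E `` {v}) \<le> card (E `` {u})" for E :: "('a \<times> 'a) set"
    using ex_min_if_finite[of "(\<lambda>v. card (E `` {v})) ` V"] V Vne by (auto simp: not_less)
  then obtain mv where mv: "\<And>E :: ('a \<times> 'a) set. mv E \<in> V" "\<And>E u. u \<in> V \<Longrightarrow> card (E `` {mv E}) \<le> card (E `` {u})"
    by metis
  \<comment> \<open>A graph is encoded by a vertex of minimum degree, the graph left after deleting
    it, and its neighbourhood; these three restore the graph.\<close>
  define \<phi> where "\<phi> E = (mv E, E \<inter> (V - {mv E}) \<times> (V - {mv E}), E `` {mv E})" for E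
  \<comment> \<open>After the deletion, minimality survives only in the form with
    \<open>card N - 1\<close>, which is what the bound \<open>L\<close> asks for.\<close>
  define Lk where "Lk v E = {N. N \<in> links (V - {v}) E (card N) \<and> (\<forall>u\<in>V - {v}. card N - 1 \<le> card (E `` {u}))}" for v E
  have finLk: "finite (Lk v E)" for v E
    by (rule finite_subset[of _ "Pow V"]) (use V in \<open>auto simp: Lk_def links_def\<close>)
  let ?S = "Sigma V (\<lambda>v. Sigma (?G (V - {v})) (Lk v))"
  let ?f = "\<lambda>(v :: 'a, E, N :: 'a set). ?wt E * exp (- \<mu> * real (card N))"
  have split: "E = (E \<inter> (V - {v}) \<times> (V - {v})) \<union> {v} \<times> (E `` {v}) \<union> (E `` {v}) \<times> {v}"
    if E: "graph_on V E" for E and v :: 'a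
    using graph_onD[OF E] by auto
  have inj: "inj_on \<phi> (?G V)"
  proof (rule inj_onI)
    fix E E' assume E: "E \<in> ?G V" "E' \<in> ?G V" and eq: "\<phi> E = \<phi> E'"
    have *: "mv E = mv E' \<and> E \<inter> (V - {mv E}) \<times> (V - {mv E}) = E' \<inter> (V - {mv E'}) \<times> (V - {mv E'})
        \<and> E `` {mv E} = E' `` {mv E'}"
      using eq unfolding \<phi>_def prod.inject .
    then have v: "mv E' = mv E" by (elim conjE) (rule sym)
    note r = conjunct1[OF conjunct2[OF *[unfolded v]]] and nb = conjunct2[OF conjunct2[OF *[unfolded v]]]
    have "E = (E \<inter> (V - {mv E}) \<times> (V - {mv E})) \<union> {mv E} \<times> (E `` {mv E}) \<union> (E `` {mv E}) \<times> {mv E}"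
      by (rule split) (use E in simp)
    also have "\<dots> = (E' \<inter> (V - {mv E}) \<times> (V - {mv E})) \<union> {mv E} \<times> (E' `` {mv E}) \<union> (E' `` {mv E}) \<times> {mv E}"
      by (simp only: r nb)
    also have "\<dots> = E'" by (rule split[symmetric]) (use E in simp)
    finally show "E = E'" .
  qed
  have img: "\<phi> E \<in> ?S \<and> ?f (\<phi> E) = ?wt E" if "E \<in> ?G V" for E
  proof -
    let ?v = "mv E"
    let ?E = "E \<inter> (V - {?v}) \<times> (V - {?v})" and ?N = "E `` {?v}"
    have gr: "graph_on V E" and c4: "c4free E" using that by auto
    have finE: "finite E" by (rule finite_subset[of _ "V\<times>V"]) (use V gr in \<open>auto simp: graph_on_def\<close>)
    have NV: "?N \<subseteq> V - {?v}" using graph_onD[OF gr] by auto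
    have g': "graph_on (V - {?v}) ?E" using gr by (auto simp: graph_on_def sym_def irrefl_def)
    have c': "c4free ?E" using c4 unfolding c4free_def by blast
    have lk: "?N \<in> links (V - {?v}) ?E (card ?N)"
    proof -
      have False if "x \<in> ?N" "y \<in> ?N" "x \<noteq> y" "(x,z) \<in> ?E" "(y,z) \<in> ?E" for x y z
        using c4freeD[OF c4, of x z y ?v] that graph_onD(3)[OF gr] by auto
      then show ?thesis using NV unfolding links_def by blast
    qed
    have deg: "card ?N - 1 \<le> card (?E `` {u})" if u: "u \<in> V - {?v}" for u
    proof -
      have "E `` {u} \<subseteq> insert ?v (?E `` {u})" using u graph_onD[OF gr] by auto
      then have "card (E `` {u}) \<le> card (insert ?v (?E `` {u}))"
        by (intro card_mono) (use finE in \<open>auto simp: finite_Image\<close>)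
      also have "\<dots> \<le> card (?E `` {u}) + 1"
        by (rule card_insert_le_m1) auto
      finally show ?thesis using mv(2)[of u E] u by simp
    qed
    have "card E = card ?E + 2 * card ?N"
    proof -
      have "card E = card (?E \<union> {?v} \<times> ?N \<union> ?N \<times> {?v})"
        using split[OF gr, of ?v] by simp
      also have "\<dots> = card (?E \<union> {?v} \<times> ?N) + card (?N \<times> {?v})"
        by (rule card_Un_disjoint) (use finE NV in \<open>auto simp: finite_Image\<close>)
      also have "card (?E \<union> {?v} \<times> ?N) = card ?E + card ({?v} \<times> ?N)"
        by (rule card_Un_disjoint) (use finE NV in \<open>auto simp: finite_Image\<close>)
      finally show ?thesis by (simp add: card_cartesian_product)
    qed
    then have "?f (\<phi> E) = ?wt E"
      by (simp add: \<phi>_def exp_add[symmetric] algebra_simps)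
    moreover have "\<phi> E \<in> ?S"
      using mv(1) g' c' lk deg by (simp add: \<phi>_def Lk_def)
    ultimately show ?thesis by simp
  qed
  \<comment> \<open>For each size \<open>d\<close> the weight cancels the growth \<mu> d in
    \<open>L\<close>; what remains is \<open>exp a\<close> for each of the \<open>n + 1\<close>
    possible sizes.\<close>
  have inner: "(\<Sum>N\<in>Lk v E. exp (- \<mu> * real (card N))) \<le> (real n + 1) * exp a"
    if v: "v \<in> V" and E: "E \<in> ?G (V - {v})" for v E
  proof -
    have bound: "card N < n + 1" if "N \<in> Lk v E" for N
    proof -
      have "card N \<le> card V" by (rule card_mono[OF V]) (use that in \<open>auto simp: Lk_def links_def\<close>)
      then show ?thesis using Suc.prems by simp
    qed
    have "(\<Sum>N\<in>Lk v E. exp (- \<mu> * real (card N)))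
        = (\<Sum>d<n+1. \<Sum>N | N \<in> Lk v E \<and> card N = d. exp (- \<mu> * real (card N)))"
      by (rule sum_over_labels[symmetric]) (use finLk bound in auto)
    also have "\<dots> \<le> (\<Sum>d<n+1. exp a)"
    proof (intro sum_mono)
      fix d
      show "(\<Sum>N | N \<in> Lk v E \<and> card N = d. exp (- \<mu> * real (card N))) \<le> exp a"
      proof (cases "{N. N \<in> Lk v E \<and> card N = d} = {}")
        case True
        then have "(\<Sum>N | N \<in> Lk v E \<and> card N = d. exp (- \<mu> * real (card N))) = 0" by (simp only: sum.empty)
        then show ?thesis by simp
      next
        case False
        then have deg: "d - 1 \<le> card (E `` {u})" if "u \<in> V - {v}" for u
          using that by (auto simp: Lk_def)
        have "(\<Sum>N | N \<in> Lk v E \<and> card N = d. exp (- \<mu> * real (card N)))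
            = real (card {N. N \<in> Lk v E \<and> card N = d}) * exp (- \<mu> * real d)"
          by simp
        also have "\<dots> \<le> real (card (links (V - {v}) E d)) * exp (- \<mu> * real d)"
        proof (intro mult_right_mono of_nat_mono card_mono)
          show "finite (links (V - {v}) E d)"
            by (rule finite_subset[of _ "Pow V"]) (use V in \<open>auto simp: links_def\<close>)
        qed (auto simp: Lk_def)
        also have "\<dots> \<le> exp (a + \<mu> * real d) * exp (- \<mu> * real d)"
        proof (intro mult_right_mono L)
          have "card (V - {v}) \<le> card V" by (rule card_mono[OF V]) auto
          then show "card (V - {v}) \<le> n" using Suc.prems(2) by simp
        qed (use V E deg in auto)
        also have "\<dots> = exp a" by (simp add: exp_add[symmetric])
        finally show ?thesis .
      qed
    qed
    finally show ?thesis by (simp add: algebra_simps)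
  qed
  have "(\<Sum>E\<in>?G V. ?wt E) = (\<Sum>E\<in>?G V. ?f (\<phi> E))"
    by (intro sum.cong refl) (use img in simp)
  also have "\<dots> = sum ?f (\<phi> ` ?G V)" by (simp only: sum.reindex[OF inj] o_def)
  also have "\<dots> \<le> sum ?f ?S"
  proof (intro sum_mono2)
    show "finite ?S" using V finG finLk by (intro finite_SigmaI) auto
    show "\<phi> ` ?G V \<subseteq> ?S" using img by blast
  qed auto
  also have "\<dots> = (\<Sum>v\<in>V. \<Sum>E\<in>?G (V - {v}). \<Sum>N\<in>Lk v E. ?wt E * exp (- \<mu> * real (card N)))"
  proof -
    have "(\<Sum>v\<in>V. \<Sum>E\<in>?G (V - {v}). \<Sum>N\<in>Lk v E. ?wt E * exp (- \<mu> * real (card N)))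
        = (\<Sum>v\<in>V. \<Sum>p\<in>Sigma (?G (V - {v})) (Lk v). ?f (v, p))"
      using V finG finLk by (intro sum.cong refl) (subst sum.Sigma, auto)
    also have "\<dots> = sum ?f ?S"
      using V finG finLk by (subst sum.Sigma) (auto intro!: sum.cong finite_SigmaI)
    finally show ?thesis by simp
  qed
  also have "\<dots> = (\<Sum>v\<in>V. \<Sum>E\<in>?G (V - {v}). ?wt E * (\<Sum>N\<in>Lk v E. exp (- \<mu> * real (card N))))"
    by (simp only: sum_distrib_left)
  also have "\<dots> \<le> (\<Sum>v\<in>V. \<Sum>E\<in>?G (V - {v}). ?wt E * ((real n + 1) * exp a))"
    by (intro sum_mono mult_left_mono inner) auto
  also have "\<dots> = (\<Sum>v\<in>V. (\<Sum>E\<in>?G (V - {v}). ?wt E) * ((real n + 1) * exp a))"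
    by (simp only: sum_distrib_right)
  also have "\<dots> \<le> (\<Sum>v\<in>V. (real n * (real n + 1) * exp a) ^ k * ((real n + 1) * exp a))"
  proof (intro sum_mono mult_right_mono)
    fix v assume v: "v \<in> V"
    have c: "card (V - {v}) = k" using Suc.hyps(2) v V by simp
    have "(\<Sum>E\<in>?G (V - {v}). ?wt E) \<le> (real n * (real n + 1) * exp a) ^ card (V - {v})"
      by (rule Suc.hyps(1)) (use c V Suc.prems(2) Suc.hyps(2) in auto)
    then show "(\<Sum>E\<in>?G (V - {v}). ?wt E) \<le> (real n * (real n + 1) * exp a) ^ k" by (simp only: c)
  qed auto
  also have "\<dots> = real (card V) * ((real n * (real n + 1) * exp a) ^ k * ((real n + 1) * exp a))" by simp
  also have "\<dots> \<le> real n * ((real n * (real n + 1) * exp a) ^ k * ((real n + 1) * exp a))"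
    using Suc.prems(2) by (intro mult_right_mono) auto
  also have "\<dots> = (real n * (real n + 1) * exp a) ^ card V"
    using Suc.hyps(2)[symmetric] by (simp add: mult_ac)
  finally show ?case .
qed

text \<open>An exponential Markov bound: every graph counted carries at least a fixed weight in the
  partition function. The choice of \<epsilon> keeps the cost of this below half of the exponent,
  and the polynomial factors to the power n are of smaller order.\<close>

theorem card_c4free_graphs_le:
  fixes \<delta> :: real
  assumes \<delta>: "0 < \<delta>"
  obtains \<epsilon> :: real and n0 :: nat where "0 < \<epsilon>"
    "\<And>(V :: 'a set). finite V \<Longrightarrow> n0 \<le> card V \<Longrightarrow>
      real (card {E. graph_on V E \<and> c4free E \<and> real (card E) \<le> \<epsilon> * real (card V) * sqrt (real (card V))})
        \<le> exp (\<delta> * real (card V) * sqrt (real (card V)))"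
proof -
  obtain \<mu> :: real and n1 :: nat where \<mu>: "0 \<le> \<mu>" and
    L: "\<And>n (V :: 'a set) E d. \<lbrakk>n1 \<le> n; finite V; card V \<le> n; graph_on V E; c4free E;
        \<And>v. v \<in> V \<Longrightarrow> d - 1 \<le> card (E `` {v})\<rbrakk>
      \<Longrightarrow> real (card (links V E d)) \<le> exp (\<delta>/4 * sqrt (real n) + \<mu> * real d)"
    using card_links_le[of "\<delta>/4", where 'a = 'a] \<delta> by auto
  define \<epsilon> where "\<epsilon> = \<delta> / (\<mu> + 1)"
  have \<epsilon>: "0 < \<epsilon>" using \<delta> \<mu> by (simp add: \<epsilon>_def)
  have \<mu>\<epsilon>: "\<mu> / 2 * \<epsilon> \<le> \<delta> / 2" using \<delta> \<mu> by (simp add: \<epsilon>_def field_simps)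
  have "eventually (\<lambda>n::nat. ln (real n * (real n + 1)) \<le> \<delta>/4 * sqrt (real n)) at_top"
    using \<delta> by real_asymp
  then obtain n2 where n2: "\<And>n. n2 \<le> n \<Longrightarrow> ln (real n * (real n + 1)) \<le> \<delta>/4 * sqrt (real n)"
    unfolding eventually_sequentially by blast
  show thesis
  proof (rule that[OF \<epsilon>, of "max 1 (max n1 n2)"])
    fix V :: "'a set" assume V: "finite V" and big: "max 1 (max n1 n2) \<le> card V"
    define n where "n = card V"
    have n: "1 \<le> n" "n1 \<le> n" "n2 \<le> n" using big by (auto simp: n_def)
    let ?G = "{E. graph_on V E \<and> c4free E}" and ?m = "\<epsilon> * real n * sqrt (real n)"
    have finG: "finite ?G"
      by (rule finite_subset[of _ "Pow (V \<times> V)"]) (use V in \<open>auto simp: graph_on_def\<close>)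
    have "real (card {E. graph_on V E \<and> c4free E \<and> real (card E) \<le> ?m})
        = (\<Sum>E | graph_on V E \<and> c4free E \<and> real (card E) \<le> ?m. 1)" by simp
    also have "\<dots> \<le> (\<Sum>E | graph_on V E \<and> c4free E \<and> real (card E) \<le> ?m. exp (\<mu>/2 * ?m) * exp (- \<mu> / 2 * real (card E)))"
    proof (intro sum_mono)
      fix E assume "E \<in> {E. graph_on V E \<and> c4free E \<and> real (card E) \<le> ?m}"
      then have "\<mu>/2 * real (card E) \<le> \<mu>/2 * ?m" using \<mu> by (intro mult_left_mono) auto
      then show "1 \<le> exp (\<mu>/2 * ?m) * exp (- \<mu> / 2 * real (card E))" by (simp add: exp_add[symmetric])
    qed
    also have "\<dots> \<le> (\<Sum>E\<in>?G. exp (\<mu>/2 * ?m) * exp (- \<mu> / 2 * real (card E)))"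
      by (intro sum_mono2 finG) auto
    also have "\<dots> = exp (\<mu>/2 * ?m) * (\<Sum>E\<in>?G. exp (- \<mu> / 2 * real (card E)))" by (simp only: sum_distrib_left)
    also have "\<dots> \<le> exp (\<mu>/2 * ?m) * (real n * (real n + 1) * exp (\<delta>/4 * sqrt (real n))) ^ card V"
      by (intro mult_left_mono c4free_partition_function_le L V) (use n in \<open>auto simp: n_def\<close>)
    also have "(real n * (real n + 1) * exp (\<delta>/4 * sqrt (real n))) ^ card V
        = exp (real n * (ln (real n * (real n + 1)) + \<delta>/4 * sqrt (real n)))"
    proof -
      have "real n * (real n + 1) * exp (\<delta>/4 * sqrt (real n)) = exp (ln (real n * (real n + 1)) + \<delta>/4 * sqrt (real n))"
        using n by (simp add: exp_add)
      then show ?thesis unfolding n_def[symmetric] by (simp only: exp_of_nat_mult)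
    qed
    also have "exp (\<mu>/2 * ?m) * \<dots> = exp (\<mu>/2 * ?m + real n * (ln (real n * (real n + 1)) + \<delta>/4 * sqrt (real n)))"
      by (simp only: exp_add)
    also have "\<dots> \<le> exp (\<delta> * real n * sqrt (real n))"
    proof -
      have "\<mu>/2 * ?m \<le> \<delta>/2 * (real n * sqrt (real n))"
        using mult_right_mono[OF \<mu>\<epsilon>, of "real n * sqrt (real n)"] by (simp add: mult_ac)
      moreover have "real n * (ln (real n * (real n + 1)) + \<delta>/4 * sqrt (real n)) \<le> real n * (\<delta>/4 * sqrt (real n) + \<delta>/4 * sqrt (real n))"
        using n2[OF n(3)] by (intro mult_left_mono) auto
      moreover have "real n * (\<delta>/4 * sqrt (real n) + \<delta>/4 * sqrt (real n)) = \<delta>/2 * (real n * sqrt (real n))"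
        by (simp add: algebra_simps)
      moreover have "\<delta> * real n * sqrt (real n) = \<delta>/2 * (real n * sqrt (real n)) + \<delta>/2 * (real n * sqrt (real n))"
        by (simp add: algebra_simps)
      ultimately show ?thesis unfolding exp_le_cancel_iff by linarith
    qed
    finally show "real (card {E. graph_on V E \<and> c4free E \<and> real (card E) \<le> \<epsilon> * real (card V) * sqrt (real (card V))})
        \<le> exp (\<delta> * real (card V) * sqrt (real (card V)))"
      by (simp only: n_def)
  qed
qed

section \<open>Hypergraphs of girth greater than five\<close>

lemma all_less_small:
  "(\<forall>i<(2::nat). P i) \<longleftrightarrow> P 0 \<and> P 1"
  "(\<forall>i<(3::nat). P i) \<longleftrightarrow> P 0 \<and> P 1 \<and> P 2"
  "(\<forall>i<(4::nat). P i) \<longleftrightarrow> P 0 \<and> P 1 \<and> P 2 \<and> P 3"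
  "(\<forall>i<(5::nat). P i) \<longleftrightarrow> P 0 \<and> P 1 \<and> P 2 \<and> P 3 \<and> P 4"
  by (auto simp: less_Suc_eq numeral_eq_Suc)

locale girth_gt_5_hypergraph =
  fixes V :: "'a :: linorder set" and r :: nat and H :: "'a set set"
  assumes finV: "finite V" and r: "3 \<le> r" and unif: "e \<in> H \<Longrightarrow> e \<subseteq> V \<and> card e = r"
    and girth: "girth H > 5"
begin

lemma no_berge_cycle: "k \<le> 5 \<Longrightarrow> \<not> berge_cycle H k"
proof
  assume k: "k \<le> 5" and "berge_cycle H k"
  then have "girth H \<le> enat k" unfolding girth_def by (intro INF_lower) simp
  also have "\<dots> \<le> enat 5" using k by simp
  also have "\<dots> = 5" by (simp add: numeral_eq_enat)
  finally show False using girth by simp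
qed

lemma two_common_vertices:
  assumes "e \<in> H" "f \<in> H" "x \<in> e" "x \<in> f" "y \<in> e" "y \<in> f" "x \<noteq> y"
  shows "e = f"
proof (rule ccontr)
  assume "e \<noteq> f"
  then have "berge_cycle H 2" unfolding berge_cycle_def using assms
    by (intro conjI exI[of _ "[x,y]"] exI[of _ "[e,f]"]) (simp_all add: all_less_small)
  then show False using no_berge_cycle by simp
qed

lemma no_berge_triangle:
  assumes "distinct [x,y,z]" "a \<in> H" "b \<in> H" "c \<in> H" "x \<in> a" "y \<in> a" "y \<in> b" "z \<in> b" "z \<in> c" "x \<in> c"
  shows "\<not> distinct [a,b,c]"
proof
  assume "distinct [a,b,c]"
  then have "berge_cycle H 3" unfolding berge_cycle_def using assms
    by (intro conjI exI[of _ "[x,y,z]"] exI[of _ "[a,b,c]"]) (simp_all add: all_less_small)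
  then show False using no_berge_cycle by simp
qed

lemma no_berge_4_cycle:
  assumes "distinct [x,y,z,w]" "a \<in> H" "b \<in> H" "c \<in> H" "d \<in> H"
    "x \<in> a" "y \<in> a" "y \<in> b" "z \<in> b" "z \<in> c" "w \<in> c" "w \<in> d" "x \<in> d"
  shows "\<not> distinct [a,b,c,d]"
proof
  assume "distinct [a,b,c,d]"
  then have "berge_cycle H 4" unfolding berge_cycle_def using assms
    by (intro conjI exI[of _ "[x,y,z,w]"] exI[of _ "[a,b,c,d]"]) (simp_all add: all_less_small)
  then show False using no_berge_cycle by simp
qed

lemma no_berge_5_cycle:
  assumes "distinct [x,y,z,w,v]" "a \<in> H" "b \<in> H" "c \<in> H" "d \<in> H" "e \<in> H"
    "x \<in> a" "y \<in> a" "y \<in> b" "z \<in> b" "z \<in> c" "w \<in> c" "w \<in> d" "v \<in> d" "v \<in> e" "x \<in> e"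
  shows "\<not> distinct [a,b,c,d,e]"
proof
  assume "distinct [a,b,c,d,e]"
  then have "berge_cycle H 5" unfolding berge_cycle_def using assms
    by (intro conjI exI[of _ "[x,y,z,w,v]"] exI[of _ "[a,b,c,d,e]"]) (simp_all add: all_less_small)
  then show False using no_berge_cycle by simp
qed

text \<open>Without 3-cycles two of the three hyperedges agree, and the common one then shares two
  vertices with the third.\<close>

lemma triangle_in_one_edge:
  assumes "x \<noteq> y" "y \<noteq> z" "x \<noteq> z" "a \<in> H" "b \<in> H" "c \<in> H"
    "x \<in> a" "y \<in> a" "y \<in> b" "z \<in> b" "z \<in> c" "x \<in> c"
  shows "a = b \<and> a = c"
proof -
  have "\<not> distinct [a,b,c]" by (rule no_berge_triangle[of x y z]) (use assms in auto)
  then consider "a = b" | "b = c" | "a = c" by auto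
  then show ?thesis
  proof cases
    case 1
    then show ?thesis using two_common_vertices[of a c x z] assms by auto
  next
    case 2
    then show ?thesis using two_common_vertices[of a b x y] assms by auto
  next
    case 3
    then show ?thesis using two_common_vertices[of a b y z] assms by auto
  qed
qed

section \<open>Recovering a hypergraph from its pair graphs\<close>

definition vtx :: "'a set \<Rightarrow> nat \<Rightarrow> 'a" where
  "vtx e i = sorted_list_of_set e ! i"

lemma finH: "finite H"
  by (rule finite_subset[of _ "Pow V"]) (use unif finV in auto)

lemma fin_edge: "e \<subseteq> V \<Longrightarrow> finite e"
  using finV finite_subset by blast

text \<open>Stated for all \<open>r\<close>-subsets of \<open>V\<close>, because
  \<open>edge_iff_pair_graphs\<close> speaks of sets not yet known to be hyperedges.\<close>

lemma vtx_in: "e \<subseteq> V \<Longrightarrow> card e = r \<Longrightarrow> i < r \<Longrightarrow> vtx e i \<in> e"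
  using fin_edge[of e] nth_mem[of i "sorted_list_of_set e"] by (simp add: vtx_def)

lemma vtx_eq_iff: "e \<subseteq> V \<Longrightarrow> card e = r \<Longrightarrow> i < r \<Longrightarrow> j < r \<Longrightarrow> vtx e i = vtx e j \<longleftrightarrow> i = j"
  using fin_edge[of e] by (simp add: vtx_def nth_eq_iff_index_eq)

lemma vtx_surj: "e \<subseteq> V \<Longrightarrow> card e = r \<Longrightarrow> x \<in> e \<Longrightarrow> \<exists>i<r. x = vtx e i"
  using fin_edge[of e] by (auto simp: vtx_def in_set_conv_nth[symmetric])
    (metis in_set_conv_nth length_sorted_list_of_set set_sorted_list_of_set)

definition pair_graph :: "nat \<Rightarrow> nat \<Rightarrow> ('a \<times> 'a) set" where
  "pair_graph i j = (\<lambda>e. (vtx e i, vtx e j)) ` H \<union> (\<lambda>e. (vtx e j, vtx e i)) ` H"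

lemma pair_graphD:
  assumes "(x,y) \<in> pair_graph i j"
  shows "\<exists>e\<in>H. {x,y} = {vtx e i, vtx e j}"
  using assms by (auto simp: pair_graph_def)

lemma pair_graph_on:
  assumes "i < r" "j < r" "i \<noteq> j"
  shows "graph_on V (pair_graph i j)"
proof -
  have 1: "vtx e i \<in> V" "vtx e j \<in> V" "vtx e i \<noteq> vtx e j" if "e \<in> H" for e
    using unif[OF that] vtx_in[of e] vtx_eq_iff[of e i j] assms by auto
  show ?thesis unfolding graph_on_def
  proof (intro conjI)
    show "pair_graph i j \<subseteq> V \<times> V" using 1 by (auto simp: pair_graph_def)
    show "sym (pair_graph i j)" by (auto simp: pair_graph_def sym_def)
    show "irrefl (pair_graph i j)" using 1(3) by (fastforce simp: pair_graph_def irrefl_def)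
  qed
qed

lemma card_pair_graph_le: "card (pair_graph i j) \<le> 2 * card H"
proof -
  have "card (pair_graph i j) \<le> card ((\<lambda>e. (vtx e i, vtx e j)) ` H) + card ((\<lambda>e. (vtx e j, vtx e i)) ` H)"
    unfolding pair_graph_def by (rule card_Un_le)
  also have "\<dots> \<le> card H + card H" by (intro add_mono card_image_le finH)
  finally show ?thesis by simp
qed

text \<open>A hyperedge contributes a single pair, so the four edges of a 4-cycle come from four
  distinct hyperedges, which form a Berge cycle.\<close>

lemma pair_graph_c4free:
  assumes ij: "i < r" "j < r" "i \<noteq> j"
  shows "c4free (pair_graph i j)"
  unfolding c4free_def
proof (intro allI impI, elim conjE, rule ccontr)
  fix x y u v
  assume xy: "x \<noteq> y" and uv: "u \<noteq> v" and E: "(x,u) \<in> pair_graph i j" "(y,u) \<in> pair_graph i j"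
    "(x,v) \<in> pair_graph i j" "(y,v) \<in> pair_graph i j"
  have ne: "x \<noteq> u" "y \<noteq> u" "x \<noteq> v" "y \<noteq> v"
    using E graph_onD(4)[OF pair_graph_on[OF ij]] by metis+
  obtain a where a: "a \<in> H" "{x,u} = {vtx a i, vtx a j}" using pair_graphD[OF E(1)] by blast
  obtain b where b: "b \<in> H" "{y,u} = {vtx b i, vtx b j}" using pair_graphD[OF E(2)] by blast
  obtain c where c: "c \<in> H" "{x,v} = {vtx c i, vtx c j}" using pair_graphD[OF E(3)] by blast
  obtain d where d: "d \<in> H" "{y,v} = {vtx d i, vtx d j}" using pair_graphD[OF E(4)] by blast
  have sub: "{vtx e i, vtx e j} \<subseteq> e" if "e \<in> H" for e
    using unif[OF that] vtx_in ij by auto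
  have mem: "x \<in> a" "u \<in> a" "y \<in> b" "u \<in> b" "x \<in> c" "v \<in> c" "y \<in> d" "v \<in> d"
    using sub[OF a(1)] sub[OF b(1)] sub[OF c(1)] sub[OF d(1)]
    unfolding a(2)[symmetric] b(2)[symmetric] c(2)[symmetric] d(2)[symmetric] by auto
  have "\<not> distinct [a,b,d,c]"
    by (rule no_berge_4_cycle[of x u y v]) (use xy uv ne a(1) b(1) c(1) d(1) mem in auto)
  moreover define f where "f e = {vtx e i, vtx e j}" for e
  have "{x,u} \<noteq> {y,u}" "{x,u} \<noteq> {y,v}" "{x,u} \<noteq> {x,v}" "{y,u} \<noteq> {y,v}" "{y,u} \<noteq> {x,v}" "{y,v} \<noteq> {x,v}"
    using xy uv ne by (auto simp: doubleton_eq_iff)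
  then have "f a \<noteq> f b" "f a \<noteq> f d" "f a \<noteq> f c" "f b \<noteq> f d" "f b \<noteq> f c" "f d \<noteq> f c"
    unfolding a(2) b(2) c(2) d(2) f_def .
  then have "distinct [a,b,d,c]" by auto
  ultimately show False by contradiction
qed

text \<open>If every pair of \<open>e\<close> is covered, the hyperedge \<open>f\<close> on its two
  smallest vertices and the hyperedges joining them to any third vertex must collapse by
  \<open>triangle_in_one_edge\<close>. So \<open>f\<close> contains \<open>e\<close>, and the
  cardinalities agree.\<close>

lemma edge_iff_pair_graphs:
  assumes e: "e \<subseteq> V" "card e = r"
  shows "e \<in> H \<longleftrightarrow> (\<forall>i j. i < j \<and> j < r \<longrightarrow> (vtx e i, vtx e j) \<in> pair_graph i j)"
proof
  assume "e \<in> H"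
  then show "\<forall>i j. i < j \<and> j < r \<longrightarrow> (vtx e i, vtx e j) \<in> pair_graph i j"
    by (auto simp: pair_graph_def)
next
  assume *: "\<forall>i j. i < j \<and> j < r \<longrightarrow> (vtx e i, vtx e j) \<in> pair_graph i j"
  have ex: "\<exists>f\<in>H. vtx e i \<in> f \<and> vtx e j \<in> f" if "i < j" "j < r" for i j
  proof -
    from pair_graphD[of "vtx e i" "vtx e j" i j] * that
    obtain f where f: "f \<in> H" "{vtx e i, vtx e j} = {vtx f i, vtx f j}" by blast
    have "{vtx f i, vtx f j} \<subseteq> f" using unif[OF f(1)] vtx_in[of f] that by auto
    then show ?thesis using f unfolding f(2)[symmetric] by auto
  qed
  obtain f where f: "f \<in> H" "vtx e 0 \<in> f" "vtx e 1 \<in> f" using ex[of 0 1] r by auto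
  have "vtx e k \<in> f" if k: "k < r" for k
  proof (cases "k < 2")
    case True
    then show ?thesis using f by (cases k) (auto simp: less_Suc_eq numeral_eq_Suc)
  next
    case False
    obtain p where p: "p \<in> H" "vtx e 1 \<in> p" "vtx e k \<in> p" using ex[of 1 k] k False by auto
    obtain q where q: "q \<in> H" "vtx e 0 \<in> q" "vtx e k \<in> q" using ex[of 0 k] k False by auto
    have "f = p \<and> f = q"
      by (rule triangle_in_one_edge[of "vtx e 0" "vtx e 1" "vtx e k"])
        (use f p q vtx_eq_iff[OF e] k False r in auto)
    then show ?thesis using p by simp
  qed
  then have "e \<subseteq> f" using vtx_surj[OF e] by blast
  then have "e = f"
    using unif[OF f(1)] e fin_edge[of f] by (intro card_subset_eq) auto
  then show "e \<in> H" using f by simp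
qed

section \<open>Triangles on the first three vertices\<close>

definition tri :: "'a set \<Rightarrow> 'a set" where
  "tri e = {vtx e 0, vtx e 1, vtx e 2}"

text \<open>Each hyperedge is cut down to a triple because four of its vertices would span a
  4-cycle.\<close>

definition shadow :: "('a \<times> 'a) set" where
  "shadow = {(x,y). x \<noteq> y \<and> (\<exists>e\<in>H. x \<in> tri e \<and> y \<in> tri e)}"

lemma tri_sub: "e \<in> H \<Longrightarrow> tri e \<subseteq> e"
  using unif[of e] vtx_in[of e] r by (auto simp: tri_def)

lemma tri_no_four:
  assumes "x \<in> tri e" "y \<in> tri e" "z \<in> tri e" "w \<in> tri e"
  shows "\<not> distinct [x,y,z,w]"
  using assms by (auto simp: tri_def)

lemma shadow_graph_on: "graph_on V shadow"
  using tri_sub unif by (fastforce simp: graph_on_def shadow_def sym_def irrefl_def)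

text \<open>Two of the four hyperedges coincide. On opposite sides this puts four vertices into one
  triple; on adjacent sides \<open>triangle_in_one_edge\<close> draws in the other two hyperedges,
  with the same outcome.\<close>

lemma shadow_c4free: "c4free shadow"
  unfolding c4free_def
proof (intro allI impI, elim conjE, rule ccontr)
  fix x y u v
  assume xy: "x \<noteq> y" and uv: "u \<noteq> v" and E: "(x,u) \<in> shadow" "(y,u) \<in> shadow" "(x,v) \<in> shadow" "(y,v) \<in> shadow"
  have ne: "x \<noteq> u" "y \<noteq> u" "x \<noteq> v" "y \<noteq> v" using E by (auto simp: shadow_def)
  obtain a where a: "a \<in> H" "x \<in> tri a" "u \<in> tri a" using E(1) by (auto simp: shadow_def)
  obtain b where b: "b \<in> H" "y \<in> tri b" "u \<in> tri b" using E(2) by (auto simp: shadow_def)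
  obtain c where c: "c \<in> H" "x \<in> tri c" "v \<in> tri c" using E(3) by (auto simp: shadow_def)
  obtain d where d: "d \<in> H" "y \<in> tri d" "v \<in> tri d" using E(4) by (auto simp: shadow_def)
  note mem = a b c d a(2,3)[THEN tri_sub[OF a(1), THEN subsetD]] b(2,3)[THEN tri_sub[OF b(1), THEN subsetD]]
    c(2,3)[THEN tri_sub[OF c(1), THEN subsetD]] d(2,3)[THEN tri_sub[OF d(1), THEN subsetD]]
  have four: "\<not> (x \<in> tri e \<and> y \<in> tri e \<and> u \<in> tri e \<and> v \<in> tri e)" for e
    using tri_no_four[of x e y u v] xy uv ne by auto
  have "\<not> distinct [a,b,d,c]"
    by (rule no_berge_4_cycle[of x u y v]) (use xy uv ne mem in auto)
  then consider "a = b" | "a = d" | "a = c" | "b = d" | "b = c" | "d = c" by auto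
  then show False
  proof cases
    case 1
    have "a = d \<and> a = c" by (rule triangle_in_one_edge[of x y v]) (use 1 xy ne mem in auto)
    then show False using four[of a] a b c 1 by auto
  next
    case 2
    then show False using four[of a] a d by auto
  next
    case 3
    have "a = d \<and> a = b" by (rule triangle_in_one_edge[of u v y]) (use 3 uv ne mem in auto)
    then show False using four[of a] a b c 3 by auto
  next
    case 4
    have "b = c \<and> b = a" by (rule triangle_in_one_edge[of u v x]) (use 4 uv ne mem in auto)
    then show False using four[of a] a b c d 4 by auto
  next
    case 5
    then show False using four[of b] b c by auto
  next
    case 6
    have "c = b \<and> c = a" by (rule triangle_in_one_edge[of x y u]) (use 6 xy ne mem in auto)
    then show False using four[of a] a b c d 6 by auto
  qed
qed

text \<open>Two of the five hyperedges coincide. On consecutive sides this gives a chord that closes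
  a 4-cycle with the three remaining sides; on other sides it puts four vertices into one
  triple.\<close>

lemma shadow_c5free: "c5free shadow"
  unfolding c5free_def
proof (intro allI impI notI, elim conjE)
  fix a b c d e
  assume E: "(a,b) \<in> shadow" "(b,c) \<in> shadow" "(c,d) \<in> shadow" "(d,e) \<in> shadow" "(e,a) \<in> shadow"
    and dist: "distinct [a,b,c,d,e]"
  obtain p where p: "p \<in> H" "a \<in> tri p" "b \<in> tri p" using E(1) by (auto simp: shadow_def)
  obtain q where q: "q \<in> H" "b \<in> tri q" "c \<in> tri q" using E(2) by (auto simp: shadow_def)
  obtain s where s: "s \<in> H" "c \<in> tri s" "d \<in> tri s" using E(3) by (auto simp: shadow_def)
  obtain t where t: "t \<in> H" "d \<in> tri t" "e \<in> tri t" using E(4) by (auto simp: shadow_def)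
  obtain z where z: "z \<in> H" "e \<in> tri z" "a \<in> tri z" using E(5) by (auto simp: shadow_def)
  have "\<not> distinct [p,q,s,t,z]"
    by (rule no_berge_5_cycle[of a b c d e])
      (use dist p q s t z tri_sub[OF p(1)] tri_sub[OF q(1)] tri_sub[OF s(1)] tri_sub[OF t(1)] tri_sub[OF z(1)] in auto)
  then consider "p = q" | "q = s" | "s = t" | "t = z" | "z = p" | "p = s" | "q = t" | "s = z" | "t = p" | "z = q" by auto
  moreover have adj: "False" if "(x1,x2) \<in> shadow" "(x2,x3) \<in> shadow" "(x3,x4) \<in> shadow" "(x4,x1) \<in> shadow"
    "x1 \<noteq> x3" "x2 \<noteq> x4" for x1 x2 x3 x4
    using c4freeD[OF shadow_c4free, of x1 x2 x3 x4] graph_onD(3)[OF shadow_graph_on] that by blast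
  ultimately show False
  proof cases
    case 1
    then have "(a,c) \<in> shadow" using p q dist by (auto simp: shadow_def)
    then show False using adj[of a c d e] E dist by auto
  next
    case 2
    then have "(b,d) \<in> shadow" using q s dist by (auto simp: shadow_def)
    then show False using adj[of a b d e] E dist by auto
  next
    case 3
    then have "(c,e) \<in> shadow" using s t dist by (auto simp: shadow_def)
    then show False using adj[of a b c e] E dist by auto
  next
    case 4
    then have "(d,a) \<in> shadow" using t z dist by (auto simp: shadow_def)
    then show False using adj[of a b c d] E dist by auto
  next
    case 5
    then have "(e,b) \<in> shadow" using z p dist by (auto simp: shadow_def)
    then show False using adj[of e b c d] E dist by auto
  next
    case 6
    then show False using tri_no_four[of a p b c d] p s dist by auto
  next
    case 7
    then show False using tri_no_four[of b q c d e] q t dist by auto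
  next
    case 8
    then show False using tri_no_four[of c s d e a] s z dist by auto
  next
    case 9
    then show False using tri_no_four[of d t e a b] t p dist by auto
  next
    case 10
    then show False using tri_no_four[of e z a b c] z q dist by auto
  qed
qed

lemma vtx_012_distinct: "e \<in> H \<Longrightarrow> distinct [vtx e 0, vtx e 1, vtx e 2]"
  using unif[of e] vtx_eq_iff[of e] r by auto

lemma triangle_family_tri: "triangle_family shadow (tri ` H)"
proof -
  have "\<exists>x y z. tri e = {x,y,z} \<and> (x,y) \<in> shadow \<and> (y,z) \<in> shadow \<and> (x,z) \<in> shadow" if "e \<in> H" for e
    using vtx_012_distinct[OF that] that
    by (intro exI[of _ "vtx e 0"] exI[of _ "vtx e 1"] exI[of _ "vtx e 2"]) (auto simp: shadow_def tri_def)
  then show ?thesis using finH by (auto simp: triangle_family_def)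
qed

text \<open>Hyperedges with the same triple share two vertices and are equal.\<close>

lemma card_tri_image: "card (tri ` H) = card H"
proof (rule card_image, rule inj_onI)
  fix e f assume ef: "e \<in> H" "f \<in> H" "tri e = tri f"
  have "vtx e 0 \<in> tri e" "vtx e 1 \<in> tri e" by (auto simp: tri_def)
  then show "e = f"
    using two_common_vertices[of e f "vtx e 0" "vtx e 1"] tri_sub[OF ef(1)] tri_sub[OF ef(2)] ef
      vtx_012_distinct[OF ef(1)] by auto
qed

end

text \<open>A hypergraph is sent to the family of its pair graphs. The map is injective and each
  member of the family is one of the sparse graphs counted before, so the exponent is the number of
  pairs of positions, independent of n.\<close>

lemma card_girth_gt_5_hypergraphs_le:
  fixes r :: nat and \<delta> :: real
  assumes r: "3 \<le> r" and \<delta>: "0 < \<delta>"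
  obtains n0 :: nat where "\<And>n. n0 \<le> n \<Longrightarrow> real (card {H \<in> uniform_hypergraphs r n. girth H > 5})
    \<le> exp (\<delta> * real n * sqrt (real n)) ^ card {(i,j). i < j \<and> j < r}"
proof -
  obtain \<epsilon> :: real and n1 :: nat where \<epsilon>: "0 < \<epsilon>" and
    cnt: "\<And>(V :: nat set). finite V \<Longrightarrow> n1 \<le> card V \<Longrightarrow>
      real (card {E. graph_on V E \<and> c4free E \<and> real (card E) \<le> \<epsilon> * real (card V) * sqrt (real (card V))})
        \<le> exp (\<delta> * real (card V) * sqrt (real (card V)))"
    using card_c4free_graphs_le[OF \<delta>, where 'a = nat] by blast
  \<comment> \<open>Half of \<epsilon>, since a pair graph contains both orientations and so up to
    \<open>2 * card H\<close> pairs.\<close>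
  obtain n2 :: nat where
    ext: "\<And>(V :: nat set) E T. \<lbrakk>finite V; graph_on V E; c4free E; c5free E; triangle_family E T; n2 \<le> card V\<rbrakk>
      \<Longrightarrow> real (card T) \<le> \<epsilon>/2 * real (card V) * sqrt (real (card V))"
    using few_triangles[of "\<epsilon>/2", where 'a = nat] \<epsilon> by auto
  show thesis
  proof (rule that[of "max n1 n2"])
    fix n :: nat assume n: "max n1 n2 \<le> n"
    define V :: "nat set" where "V = {1..n}"
    have V: "finite V" "card V = n" by (auto simp: V_def)
    let ?X = "{H \<in> uniform_hypergraphs r n. girth H > 5}"
    define I :: "(nat \<times> nat) set" where "I = {(i,j). i < j \<and> j < r}"
    have finI: "finite I" by (rule finite_subset[of _ "{..<r} \<times> {..<r}"]) (auto simp: I_def)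
    define G where "G = {E. graph_on V E \<and> c4free E \<and> real (card E) \<le> \<epsilon> * real n * sqrt (real n)}"
    have finG: "finite G"
      by (rule finite_subset[of _ "Pow (V \<times> V)"]) (use V in \<open>auto simp: graph_on_def G_def\<close>)
    define \<Phi> where "\<Phi> H = restrict (\<lambda>(i,j). girth_gt_5_hypergraph.pair_graph H i j) I" for H :: "nat set set"
    have loc: "girth_gt_5_hypergraph V r H" if "H \<in> ?X" for H
      by unfold_locales (use that r V in \<open>auto simp: uniform_hypergraphs_def V_def\<close>)
    have img: "\<Phi> H \<in> PiE I (\<lambda>_. G)" if HX: "H \<in> ?X" for H
    proof -
      interpret girth_gt_5_hypergraph V r H by (rule loc[OF HX])
      have "real (card H) \<le> \<epsilon>/2 * real n * sqrt (real n)"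
        using ext[OF finV shadow_graph_on shadow_c4free shadow_c5free triangle_family_tri] n V card_tri_image by simp
      then have "real (card (pair_graph i j)) \<le> \<epsilon> * real n * sqrt (real n)" for i j
        using of_nat_mono[OF card_pair_graph_le[of i j], where 'a = real] by simp
      then show ?thesis
        unfolding \<Phi>_def by (auto simp: G_def I_def intro!: pair_graph_on pair_graph_c4free)
    qed
    have inj: "inj_on \<Phi> ?X"
    proof (rule inj_onI)
      fix H H' assume HX: "H \<in> ?X" "H' \<in> ?X" and eq: "\<Phi> H = \<Phi> H'"
      interpret A: girth_gt_5_hypergraph V r H by (rule loc[OF HX(1)])
      interpret B: girth_gt_5_hypergraph V r H' by (rule loc[OF HX(2)])
      have pg: "A.pair_graph i j = B.pair_graph i j" if "i < j" "j < r" for i j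
        using fun_cong[OF eq, of "(i,j)"] that by (simp add: \<Phi>_def I_def)
      have "e \<in> H \<longleftrightarrow> e \<in> H'" if "e \<subseteq> V" "card e = r" for e
        unfolding A.edge_iff_pair_graphs[OF that] B.edge_iff_pair_graphs[OF that]
        using pg by auto
      then show "H = H'" using A.unif B.unif by blast
    qed
    have "card ?X \<le> card (PiE I (\<lambda>_. G))"
      by (rule card_inj_on_le[OF inj]) (use img finI finG in \<open>auto intro!: finite_PiE\<close>)
    also have "\<dots> = card G ^ card I" using finI by (simp add: card_PiE)
    finally have "real (card ?X) \<le> real (card G) ^ card I"
      by (metis of_nat_le_iff of_nat_power)
    also have "\<dots> \<le> exp (\<delta> * real n * sqrt (real n)) ^ card I"
      using cnt[OF V(1)] n unfolding V(2) G_def[symmetric] by (intro power_mono) auto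
    finally show "real (card ?X) \<le> exp (\<delta> * real n * sqrt (real n)) ^ card {(i,j). i < j \<and> j < r}"
      by (simp only: I_def)
  qed
qed

theorem theorem1p12:
  fixes r :: nat
  assumes "r \<ge> 3"
  shows "(\<lambda>n::nat. log 2 (real (card {H \<in> uniform_hypergraphs r n. girth H > 5})))
           \<in> o(\<lambda>n. real n powr (3/2))"
proof (rule landau_o.smallI)
  fix c :: real assume c: "0 < c"
  define M where "M = real (card {(i,j). i < j \<and> j < r})"
  \<comment> \<open>The denominator absorbs the \<open>M\<close> pairs of positions and
    \<open>ln 2\<close> the change to base 2.\<close>
  define \<delta> where "\<delta> = c * ln 2 / (M + 1)"
  have M: "0 \<le> M" by (simp add: M_def)
  have \<delta>: "0 < \<delta>" using c M by (simp add: \<delta>_def)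
  have M\<delta>: "M * \<delta> \<le> c * ln 2"
    using c M by (simp add: \<delta>_def divide_le_eq mult_left_mono algebra_simps)
  obtain n0 where n0: "\<And>n. n0 \<le> n \<Longrightarrow> real (card {H \<in> uniform_hypergraphs r n. girth H > 5})
    \<le> exp (\<delta> * real n * sqrt (real n)) ^ card {(i,j). i < j \<and> j < r}"
    using card_girth_gt_5_hypergraphs_le[OF assms \<delta>] by blast
  show "\<forall>\<^sub>F n in at_top. norm (log 2 (real (card {H \<in> uniform_hypergraphs r n. girth H > 5})))
      \<le> c * norm (real n powr (3/2))"
  proof (rule eventually_sequentiallyI[of n0])
    fix n assume n: "n0 \<le> n"
    let ?X = "{H \<in> uniform_hypergraphs r n. girth H > 5}"
    have "\<not> berge_cycle ({} :: nat set set) k" for k by (auto simp: berge_cycle_def)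
    then have "girth ({} :: nat set set) = \<infinity>" by (simp add: girth_def top_enat_def)
    then have "{} \<in> ?X" by (simp add: uniform_hypergraphs_def)
    moreover have "finite ?X"
      by (rule finite_subset[of _ "Pow (Pow {1..n})"]) (auto simp: uniform_hypergraphs_def)
    ultimately have X1: "1 \<le> real (card ?X)" by (metis One_nat_def Suc_leI card_gt_0_iff empty_iff of_nat_1 of_nat_le_iff)
    have "ln (real (card ?X)) \<le> ln (exp (\<delta> * real n * sqrt (real n)) ^ card {(i,j). i < j \<and> j < r})"
      using n0[OF n] X1 by (subst ln_le_cancel_iff) auto
    also have "\<dots> = M * \<delta> * (real n * sqrt (real n))"
      by (simp add: ln_realpow M_def)
    also have "\<dots> \<le> c * ln 2 * (real n * sqrt (real n))"
      by (intro mult_right_mono M\<delta>) auto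
    finally have "log 2 (real (card ?X)) \<le> c * (real n * sqrt (real n))"
      by (simp add: log_def divide_le_eq mult_ac)
    moreover have "real n * sqrt (real n) = real n powr (3/2)"
    proof (cases "n = 0")
      case False
      have "real n powr (3/2) = real n powr 1 * real n powr (1/2)"
        unfolding powr_add[symmetric] by simp
      then show ?thesis using False by (simp add: powr_half_sqrt)
    qed simp
    moreover have "0 \<le> log 2 (real (card ?X))" using X1 by (simp add: zero_le_log_cancel_iff)
    ultimately show "norm (log 2 (real (card ?X))) \<le> c * norm (real n powr (3/2))" by simp
  qed
qed

end
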